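(* Let $n\ge 2$, $0\le p\le n$, and let $M$ be a real invertible $n\times n$ matrix which is self-adjoint with respect to $\langle\cdot,\cdot\rangle_p$, i.e. $\langle Mx,y\rangle_p=\langle x,My\rangle_p$ for all $x,y\in\mathbb{R}^n$. Let $c\in\mathbb{R}$ be such that the quadric $\mathcal{S}:=\{x\in\mathbb{R}^n\mid\langle x,Mx\rangle_p=c\}$ (with the origin removed if $c=0$) is a non-degenerate hypersurface of $(\mathbb{R}^n,\langle\cdot,\cdot\rangle_p)$, and let $r$ be a smooth positive function on an interval $I$ of $\mathbb{R}$. Then the Lagrangian immersion $f:I\times\mathcal{S}\to\mathbb{C}^n$, $f(s,x)=r(s)\,e^{iMs}x$, is minimal in $(\mathbb{C}^n,\langle\langle\cdot,\cdot\rangle\rangle_p)$ if and only if one of the following three statements holds: (i) $\mathrm{tr}\,M=0$ and the function $r$ is constant; (ii) $\mathrm{tr}\,M=0$ and the constant $c$ vanishes; (iii) the image of $f$ is, up to congruence, a part of a Lagrangian catenoid $\{\gamma\,x\in\mathbb{C}^n\mid x\in\mathbb{X}^{n-1}_{p,\epsilon},\ \gamma\in\mathbb{C},\ \mathrm{Im}\,\gamma^n=c_0\}$, for some $\epsilon\in\{1,-1\}$ and some non-vanishing real constant $c_0$.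
   Context: $\mathbb{C}^n$ carries the pseudo-Hermitian form $\langle\langle z,w\rangle\rangle_p=-\sum_{j=1}^p z_j\bar w_j+\sum_{j=p+1}^n z_j\bar w_j$, with $\langle\cdot,\cdot\rangle_{2p}=\mathrm{Re}\,\langle\langle\cdot,\cdot\rangle\rangle_p$ (pseudo-Riemannian metric) and $\omega_p=-\mathrm{Im}\,\langle\langle\cdot,\cdot\rangle\rangle_p$ (symplectic form). On $\mathbb{R}^n$ let $\langle x,y\rangle_p=-\sum_{j\le p}x_jy_j+\sum_{j>p}x_jy_j$, and let $\mathbb{X}^{n-1}_{p,\epsilon}=\{x\in\mathbb{R}^n\mid\langle x,x\rangle_p=\epsilon\}$. A submanifold (or immersion) is non-degenerate if the induced metric is non-degenerate. A non-degenerate immersion is minimal if it is a critical point of the volume with respect to compactly supported variations. An immersion of an $n$-manifold is Lagrangian if $\omega_p$ pulls back to zero; the immersion $f$ in the claim is Lagrangian. Two subsets of $\mathbb{C}^n$ are congruent if one is the image of the other under an affine isometry of $(\mathbb{C}^n,\langle\cdot,\cdot\rangle_{2p})$. *)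

theory Defs
  imports "HOL-Analysis.Analysis"
begin

section \<open>Smooth maps and submanifolds of Euclidean spaces\<close>

text \<open>\<open>ck_on k U f\<close> says that \<open>f\<close> is of class \<open>C\<^sup>k\<close> on \<open>U\<close>; it is only meaningful for open \<open>U\<close>.\<close>

primrec ck_on :: "nat \<Rightarrow> 'a::real_normed_vector set \<Rightarrow> ('a \<Rightarrow> 'b::real_normed_vector) \<Rightarrow> bool" where
  "ck_on 0 U f \<longleftrightarrow> continuous_on U f"
| "ck_on (Suc k) U f \<longleftrightarrow>
     (\<forall>x\<in>U. f differentiable (at x)) \<and>
     (\<forall>v. ck_on k U (\<lambda>x. frechet_derivative f (at x) v))"

text \<open>A map on an arbitrary subset is smooth if it extends locally to a smooth map on an open
  neighbourhood; on an open set this is the usual notion.\<close>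

definition smooth_on :: "'a::euclidean_space set \<Rightarrow> ('a \<Rightarrow> 'b::euclidean_space) \<Rightarrow> bool" where
  "smooth_on A f \<longleftrightarrow>
     (\<forall>x\<in>A. \<exists>U g. open U \<and> x \<in> U \<and> (\<forall>k. ck_on k U g) \<and> (\<forall>y\<in>A \<inter> U. g y = f y))"

definition submanifold :: "nat \<Rightarrow> 'a::euclidean_space set \<Rightarrow> bool" where
  "submanifold k X \<longleftrightarrow>
     (\<forall>x\<in>X. \<exists>(U::'a set) (V::'a set) \<Phi> \<Psi> T.
        open U \<and> x \<in> U \<and> open V \<and> homeomorphism U V \<Phi> \<Psi> \<and> smooth_on U \<Phi> \<and> smooth_on V \<Psi> \<and>
        subspace T \<and> dim T = k \<and> \<Phi> ` (X \<inter> U) = T \<inter> V)"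

definition tangent_space :: "'a::euclidean_space set \<Rightarrow> 'a \<Rightarrow> 'a set" where
  "tangent_space X x =
     {v. \<exists>c \<delta>. \<delta> > 0 \<and> smooth_on {-\<delta><..<\<delta>} c \<and> c ` {-\<delta><..<\<delta>} \<subseteq> X \<and> c 0 = x \<and>
        (c has_vector_derivative v) (at 0)}"

definition local_parametrization ::
  "'a::euclidean_space set \<Rightarrow> (real^'n) set \<Rightarrow> (real^'n \<Rightarrow> 'a) \<Rightarrow> bool" where
  "local_parametrization X W \<phi> \<longleftrightarrow>
     open W \<and> smooth_on W \<phi> \<and> openin (top_of_set X) (\<phi> ` W) \<and>
     (\<exists>\<psi>. homeomorphism W (\<phi> ` W) \<phi> \<psi>) \<and>
     (\<forall>u\<in>W. inj (frechet_derivative \<phi> (at u)))"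


section \<open>Pseudo-Euclidean and pseudo-Hermitian forms\<close>

text \<open>The coordinates are indexed by a finite well-ordered type; an index is among the first
  \<open>p\<close> ones iff fewer than \<open>p\<close> indices lie below it.\<close>

definition first_indices :: "nat \<Rightarrow> 'n::{finite,wellorder} set" where
  "first_indices p = {j. card {i. i < j} < p}"

definition real_form :: "nat \<Rightarrow> real^('n::{finite,wellorder}) \<Rightarrow> real^('n::_) \<Rightarrow> real" where
  "real_form p x y =
     - (\<Sum>j\<in>first_indices p. x $ j * y $ j) + (\<Sum>j\<in>- first_indices p. x $ j * y $ j)"

definition herm_form :: "nat \<Rightarrow> complex^('n::{finite,wellorder}) \<Rightarrow> complex^('n::_) \<Rightarrow> complex" where
  "herm_form p z w =
     - (\<Sum>j\<in>first_indices p. z $ j * cnj (w $ j)) + (\<Sum>j\<in>- first_indices p. z $ j * cnj (w $ j))"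

definition metric :: "nat \<Rightarrow> complex^('n::{finite,wellorder}) \<Rightarrow> complex^('n::_) \<Rightarrow> real" where
  "metric p z w = Re (herm_form p z w)"

definition symplectic_form :: "nat \<Rightarrow> complex^('n::{finite,wellorder}) \<Rightarrow> complex^('n::_) \<Rightarrow> real" where
  "symplectic_form p z w = - Im (herm_form p z w)"

definition pseudo_sphere :: "nat \<Rightarrow> real \<Rightarrow> (real^('n::{finite,wellorder})) set" where
  "pseudo_sphere p \<epsilon> = {x. real_form p x x = \<epsilon>}"

definition nondegenerate_hypersurface :: "nat \<Rightarrow> (real^('n::{finite,wellorder})) set \<Rightarrow> bool" where
  "nondegenerate_hypersurface p S \<longleftrightarrow>
     submanifold (CARD('n) - 1) S \<and>
     (\<forall>x\<in>S. \<forall>v\<in>tangent_space S x.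
        (\<forall>w\<in>tangent_space S x. real_form p v w = 0) \<longrightarrow> v = 0)"


section \<open>Lagrangian and minimal immersions\<close>

text \<open>In the following, \<open>X\<close> is an \<open>n\<close>-dimensional submanifold of a Euclidean space and
  \<open>f\<close> is a map from \<open>X\<close> to \<open>\<complex>\<^sup>n\<close>; values of \<open>f\<close> outside \<open>X\<close> are irrelevant.\<close>

definition immersion_on :: "'a::euclidean_space set \<Rightarrow> ('a \<Rightarrow> complex^'n) \<Rightarrow> bool" where
  "immersion_on X f \<longleftrightarrow> smooth_on X f \<and>
     (\<forall>(W::(real^'n) set) \<phi>. local_parametrization X W \<phi> \<longrightarrow>
        (\<forall>u\<in>W. inj (frechet_derivative (f \<circ> \<phi>) (at u))))"

definition lagrangian_immersion ::
  "nat \<Rightarrow> 'a::euclidean_space set \<Rightarrow> ('a \<Rightarrow> complex^('n::{finite,wellorder})) \<Rightarrow> bool" where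
  "lagrangian_immersion p X f \<longleftrightarrow> immersion_on X f \<and>
     (\<forall>(W::(real^('n::_)) set) \<phi>. local_parametrization X W \<phi> \<longrightarrow>
        (\<forall>u\<in>W. \<forall>v w. symplectic_form p (frechet_derivative (f \<circ> \<phi>) (at u) v)
                                        (frechet_derivative (f \<circ> \<phi>) (at u) w) = 0))"

definition nondegenerate_immersion ::
  "nat \<Rightarrow> 'a::euclidean_space set \<Rightarrow> ('a \<Rightarrow> complex^('n::{finite,wellorder})) \<Rightarrow> bool" where
  "nondegenerate_immersion p X f \<longleftrightarrow> immersion_on X f \<and>
     (\<forall>(W::(real^('n::_)) set) \<phi>. local_parametrization X W \<phi> \<longrightarrow>
        (\<forall>u\<in>W. \<forall>v. (\<forall>w. metric p (frechet_derivative (f \<circ> \<phi>) (at u) v)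
                                   (frechet_derivative (f \<circ> \<phi>) (at u) w) = 0) \<longrightarrow> v = 0))"

definition gram_matrix ::
  "nat \<Rightarrow> (real^('n::_) \<Rightarrow> complex^('n::{finite,wellorder})) \<Rightarrow> real^('n::_) \<Rightarrow> real^('n::_)^('n::_)" where
  "gram_matrix p h u =
     (\<chi> i j. metric p (frechet_derivative h (at u) (axis i 1)) (frechet_derivative h (at u) (axis j 1)))"

text \<open>A compact subset \<open>K\<close> of \<open>X\<close> is decomposed into finitely many disjoint Borel pieces
  \<open>\<phi> i ` B i\<close>, each contained in the image of one local parametrization. The volume of \<open>K\<close>
  for the metric induced by \<open>f\<close> is the sum of the integrals of \<open>sqrt \<bar>det g\<bar>\<close> over the
  pieces. By the change of variables formula it does not depend on the decomposition.\<close>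

definition volume_decomposition ::
  "'a::euclidean_space set \<Rightarrow> 'a set \<Rightarrow> nat \<Rightarrow> (nat \<Rightarrow> (real^'n) set) \<Rightarrow>
     (nat \<Rightarrow> real^'n \<Rightarrow> 'a) \<Rightarrow> (nat \<Rightarrow> (real^'n) set) \<Rightarrow> bool" where
  "volume_decomposition X K N W \<phi> B \<longleftrightarrow>
     (\<forall>i<N. local_parametrization X (W i) (\<phi> i) \<and>
        B i \<in> sets borel \<and> bounded (B i) \<and> closure (B i) \<subseteq> W i) \<and>
     disjoint_family_on (\<lambda>i. \<phi> i ` B i) {..<N} \<and>
     (\<Union>i<N. \<phi> i ` B i) = K"

definition volume ::
  "nat \<Rightarrow> ('a \<Rightarrow> complex^('n::{finite,wellorder})) \<Rightarrow> nat \<Rightarrow> (nat \<Rightarrow> real^('n::_) \<Rightarrow> 'a) \<Rightarrow>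
     (nat \<Rightarrow> (real^('n::_)) set) \<Rightarrow> real" where
  "volume p f N \<phi> B =
     (\<Sum>i<N. LINT u:B i|lborel. sqrt \<bar>det (gram_matrix p (f \<circ> \<phi> i) u)\<bar>)"

definition supported_variation ::
  "'a::euclidean_space set \<Rightarrow> ('a \<Rightarrow> complex^'n) \<Rightarrow> 'a set \<Rightarrow> real \<Rightarrow> (real \<Rightarrow> 'a \<Rightarrow> complex^'n) \<Rightarrow> bool" where
  "supported_variation X f K \<delta> F \<longleftrightarrow>
     \<delta> > 0 \<and> smooth_on ({-\<delta><..<\<delta>} \<times> X) (\<lambda>(t, x). F t x) \<and>
     (\<forall>x\<in>X. F 0 x = f x) \<and>
     (\<forall>t\<in>{-\<delta><..<\<delta>}. \<forall>x\<in>X - K. F t x = f x)"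

definition minimal_immersion ::
  "nat \<Rightarrow> 'a::euclidean_space set \<Rightarrow> ('a \<Rightarrow> complex^('n::{finite,wellorder})) \<Rightarrow> bool" where
  "minimal_immersion p X f \<longleftrightarrow> nondegenerate_immersion p X f \<and>
     (\<forall>K \<delta> F. compact K \<and> K \<subseteq> X \<and> supported_variation X f K \<delta> F \<longrightarrow>
        (\<forall>N W \<phi> B. volume_decomposition X K N W \<phi> B \<longrightarrow>
           ((\<lambda>t. volume p (F t) N \<phi> B) has_real_derivative 0) (at 0)))"


section \<open>Congruence\<close>

text \<open>The linear part is automatically bijective since the metric is non-degenerate.\<close>

definition affine_isometry ::
  "nat \<Rightarrow> (complex^('n::{finite,wellorder}) \<Rightarrow> complex^('n::_)) \<Rightarrow> bool" where
  "affine_isometry p \<Phi> \<longleftrightarrow>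
     (\<exists>A b. linear A \<and> (\<forall>z w. metric p (A z) (A w) = metric p z w) \<and> (\<forall>z. \<Phi> z = A z + b))"

definition congruent_sets ::
  "nat \<Rightarrow> (complex^('n::{finite,wellorder})) set \<Rightarrow> (complex^('n::_)) set \<Rightarrow> bool" where
  "congruent_sets p A B \<longleftrightarrow> (\<exists>\<Phi>. affine_isometry p \<Phi> \<and> B = \<Phi> ` A)"


section \<open>The immersion and the Lagrangian catenoids\<close>

definition complex_vec :: "real^'n \<Rightarrow> complex^'n" where
  "complex_vec x = (\<chi> j. of_real (x $ j))"

definition matrix_exp :: "complex^'n^'n \<Rightarrow> complex^'n^'n" where
  "matrix_exp A = (\<Sum>k. (((**) A ^^ k) (mat 1)) /\<^sub>R fact k)"

definition self_adjoint :: "nat \<Rightarrow> real^('n::{finite,wellorder})^('n::_) \<Rightarrow> bool" where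
  "self_adjoint p M \<longleftrightarrow> (\<forall>x y. real_form p (M *v x) y = real_form p x (M *v y))"

definition quadric :: "nat \<Rightarrow> real^('n::{finite,wellorder})^('n::_) \<Rightarrow> real \<Rightarrow> (real^('n::_)) set" where
  "quadric p M c = {x. real_form p x (M *v x) = c} - (if c = 0 then {0} else {})"

definition quadric_immersion ::
  "real^'n^'n \<Rightarrow> (real \<Rightarrow> real) \<Rightarrow> real \<times> (real^'n) \<Rightarrow> complex^'n" where
  "quadric_immersion M r =
     (\<lambda>(s, x). r s *\<^sub>R (matrix_exp (\<chi> j k. \<i> * of_real (M $ j $ k) * of_real s) *v complex_vec x))"

definition lagrangian_catenoid :: "nat \<Rightarrow> real \<Rightarrow> real \<Rightarrow> (complex^('n::{finite,wellorder})) set" where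
  "lagrangian_catenoid p \<epsilon> c\<^sub>0 =
     {\<gamma> *s complex_vec x | \<gamma> x. x \<in> pseudo_sphere p \<epsilon> \<and> Im (\<gamma> ^ CARD('n)) = c\<^sub>0}"

end

(*
  For a Lagrangian chart h put D = det_C(dh). The volume density is |D|, and its first variation along
  any field V is Re (cnj D * dD[V]) / |D|: the Gram matrix of the Hermitian form has determinant +-|D|^2
  also along non-Lagrangian variations. If the phase of D is constant this is a divergence, so
  f is minimal; conversely the fields i b dh[e_j] with b a bump function show that D is stationary in
  phase if f is minimal.

  For f(s, x) = r(s) exp(i M s) x, the number D is a real multiple of
    exp(i s tr M) (r'(s) c / <Mx, Mx> + i r(s)).
  If tr M = 0 and r' c = 0 this is imaginary. Conversely, stationarity of its phase in the direction of s
  gives an ordinary differential equation for r, and in the direction of S it gives r' c <Mx, Mn> = 0 for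
  all n tangent to S. If r' c is nonzero somewhere, the latter forces M to be scalar, S is a
  pseudo-sphere, and the differential equation says that gamma = r exp(i mu s) is such that gamma^n runs
  on a line. Finally, on a Lagrangian catenoid D itself is real.
*)
theory Submission
  imports Defs
begin

section \<open>Calculus of \<open>C\<^sup>k\<close> maps\<close>

text \<open>Minimality is tested on arbitrary decompositions of a compact set into Borel pieces,
  each in its own parametrization. A piece cuts through the support of the variation field, so the
  divergence identity says nothing about a single piece. Therefore the field is split by bump
  functions into fields supported in one chart with smooth inverse. For each of them all pieces are
  carried into that chart by change of variables, where they add up to one integral of a compactly
  supported divergence, and this vanishes by translation invariance of the Lebesgue measure.

  The complex determinant replaces the mean curvature: the first variation becomes algebra of
  \<open>det\<close> and symmetry of second derivatives, and the signature only contributes a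
  constant sign.

  That the normal \<open>M *v x\<close> is not null is a consequence of non-degeneracy, available
  once the tangent space, which is defined by velocities of curves, is known to be a full
  hyperplane.

  A congruence is merely a real isometry and may change the complex determinant, so for catenoids it
  is the volume, not the phase, that is carried back to the original immersion.\<close>

lemma frechet_derivative_eqI: "(f has_derivative f') (at x) \<Longrightarrow> frechet_derivative f (at x) = f'"
  using frechet_derivative_at by blast

lemma ck_on_cong:
  assumes "open U" "ck_on k U f" "\<And>x. x \<in> U \<Longrightarrow> f x = g x"
  shows "ck_on k U g"
  using assms(2,3)
proof (induction k arbitrary: f g)
  case 0
  then show ?case by (simp cong: continuous_on_cong)
next
  case (Suc k)
  have g: "(g has_derivative frechet_derivative f (at x)) (at x)" if x: "x \<in> U" for x
  proof -
    have "(f has_derivative frechet_derivative f (at x)) (at x)"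
      using Suc.prems x frechet_derivative_works by auto
    then show ?thesis
      using \<open>open U\<close> x Suc.prems(2) by (rule has_derivative_transform_within_open)
  qed
  have "ck_on k U (\<lambda>x. frechet_derivative g (at x) v)" for v
    by (rule Suc.IH[where f = "\<lambda>x. frechet_derivative f (at x) v"])
      (use Suc.prems(1) frechet_derivative_eqI[OF g] in auto)
  then show ?case using g by (auto simp: differentiable_def)
qed

text \<open>The recursion of \<open>ck_on\<close> speaks about \<open>frechet_derivative\<close>;
  here any formula for the derivative on the open set is accepted. Through this rule the
  differentiation rules enter the inductions on the order.\<close>

lemma ck_on_SucI:
  assumes "open U" "\<And>x. x \<in> U \<Longrightarrow> (f has_derivative f' x) (at x)" "\<And>v. ck_on k U (\<lambda>x. f' x v)"
  shows "ck_on (Suc k) U f"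
proof -
  have "ck_on k U (\<lambda>x. frechet_derivative f (at x) v)" for v
    by (rule ck_on_cong[OF assms(1) assms(3)[of v]]) (simp add: frechet_derivative_eqI[OF assms(2)])
  then show ?thesis using assms(2) by (auto simp: differentiable_def)
qed

lemma ck_on_has_derivative:
  assumes "ck_on (Suc k) U f" "x \<in> U"
  shows "(f has_derivative frechet_derivative f (at x)) (at x)"
  using assms frechet_derivative_works by auto

lemma ck_on_Suc_imp: "ck_on (Suc k) U f \<Longrightarrow> ck_on k U f"
proof (induction k arbitrary: f)
  case 0
  then show ?case
    by (auto intro!: continuous_at_imp_continuous_on differentiable_imp_continuous_within)
qed auto

lemma ck_on_mono: "ck_on k U f \<Longrightarrow> j \<le> k \<Longrightarrow> ck_on j U f"
  by (induction k arbitrary: j) (auto simp: le_Suc_eq dest: ck_on_Suc_imp simp del: ck_on.simps)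

lemma ck_on_subset: "ck_on k U f \<Longrightarrow> V \<subseteq> U \<Longrightarrow> ck_on k V f"
  by (induction k arbitrary: f) (auto intro: continuous_on_subset)

lemma ck_on_local:
  assumes "\<And>x. x \<in> U \<Longrightarrow> \<exists>V. open V \<and> x \<in> V \<and> ck_on k V f"
  shows "ck_on k U f"
  using assms
proof (induction k arbitrary: f)
  case 0
  have "isCont f x" if x: "x \<in> U" for x
  proof -
    obtain V where "open V" "x \<in> V" "continuous_on V f" using 0[OF x] by auto
    then show ?thesis using continuous_on_eq_continuous_at by blast
  qed
  then show ?case by (auto intro: continuous_at_imp_continuous_on)
next
  case (Suc k)
  have "f differentiable (at x)" if x: "x \<in> U" for x
    using Suc.prems[OF x] by auto
  moreover have "ck_on k U (\<lambda>x. frechet_derivative f (at x) v)" for v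
  proof (rule Suc.IH)
    fix x assume "x \<in> U"
    then obtain V where "open V" "x \<in> V" "ck_on (Suc k) V f" using Suc.prems by blast
    then show "\<exists>V. open V \<and> x \<in> V \<and> ck_on k V (\<lambda>x. frechet_derivative f (at x) v)"
      by auto
  qed
  ultimately show ?case by simp
qed

lemma ck_on_const: "open U \<Longrightarrow> ck_on k U (\<lambda>x. c)"
proof (induction k arbitrary: c)
  case (Suc k)
  show ?case by (rule ck_on_SucI[OF Suc.prems, where f' = "\<lambda>x v. 0"]) (use Suc in auto)
qed auto

lemma ck_on_bounded_linear:
  assumes "bounded_linear L" "open U" "ck_on k U f"
  shows "ck_on k U (\<lambda>x. L (f x))"
  using assms(3)
proof (induction k arbitrary: f)
  case 0
  then show ?case using assms(1) by (auto intro: bounded_linear.continuous_on)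
next
  case (Suc k)
  show ?case
  proof (rule ck_on_SucI[OF \<open>open U\<close>, where f' = "\<lambda>x v. L (frechet_derivative f (at x) v)"])
    show "((\<lambda>x. L (f x)) has_derivative (\<lambda>v. L (frechet_derivative f (at x) v))) (at x)"
      if "x \<in> U" for x
      using bounded_linear.has_derivative[OF assms(1) ck_on_has_derivative[OF Suc.prems that]] .
    show "ck_on k U (\<lambda>x. L (frechet_derivative f (at x) v))" for v
      using Suc by auto
  qed
qed

lemma ck_on_add:
  assumes "open U" "ck_on k U f" "ck_on k U g"
  shows "ck_on k U (\<lambda>x. f x + g x)"
  using assms(2,3)
proof (induction k arbitrary: f g)
  case 0
  then show ?case by (auto intro: continuous_intros)
next
  case (Suc k)
  show ?case
    by (rule ck_on_SucI[OF \<open>open U\<close>])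
      (rule has_derivative_add[OF ck_on_has_derivative ck_on_has_derivative, OF Suc.prems(1) _ Suc.prems(2)],
       use Suc in auto)
qed

lemma ck_on_bilinear:
  assumes "bounded_bilinear B" "open U" "ck_on k U f" "ck_on k U g"
  shows "ck_on k U (\<lambda>x. B (f x) (g x))"
  using assms(3,4)
proof (induction k arbitrary: f g)
  case 0
  then show ?case using assms(1) by (auto intro: bounded_bilinear.continuous_on)
next
  case (Suc k)
  show ?case
  proof (rule ck_on_SucI[OF \<open>open U\<close>])
    show "((\<lambda>x. B (f x) (g x)) has_derivative (\<lambda>v. B (f x) (frechet_derivative g (at x) v) +
      B (frechet_derivative f (at x) v) (g x))) (at x)" if "x \<in> U" for x
      using bounded_bilinear.FDERIV[OF assms(1) ck_on_has_derivative[OF Suc.prems(1) that]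
          ck_on_has_derivative[OF Suc.prems(2) that]] .
    show "ck_on k U (\<lambda>x. B (f x) (frechet_derivative g (at x) v) +
      B (frechet_derivative f (at x) v) (g x))" for v
      by (intro ck_on_add \<open>open U\<close> Suc.IH) (use Suc.prems ck_on_Suc_imp[OF Suc.prems(1)] ck_on_Suc_imp[OF Suc.prems(2)] in auto)
  qed
qed

lemma ck_on_sum:
  assumes "open U" "\<And>i. i \<in> S \<Longrightarrow> ck_on k U (f i)"
  shows "ck_on k U (\<lambda>x. \<Sum>i\<in>S. f i x)"
  using assms(2)
proof (induction S rule: infinite_finite_induct)
  case (insert i S)
  then show ?case by (simp add: ck_on_add[OF assms(1)])
qed (simp_all add: ck_on_const[OF assms(1)])

lemma ck_on_mult:
  fixes f g :: "_ \<Rightarrow> 'b::real_normed_algebra"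
  shows "open U \<Longrightarrow> ck_on k U f \<Longrightarrow> ck_on k U g \<Longrightarrow> ck_on k U (\<lambda>x. f x * g x)"
  by (rule ck_on_bilinear[OF bounded_bilinear_mult])

lemma ck_on_scaleR: "open U \<Longrightarrow> ck_on k U f \<Longrightarrow> ck_on k U g \<Longrightarrow> ck_on k U (\<lambda>x. f x *\<^sub>R g x)"
  by (rule ck_on_bilinear[OF bounded_bilinear_scaleR])

lemma ck_on_prod:
  fixes f :: "'i \<Rightarrow> _ \<Rightarrow> 'b::{real_normed_algebra,comm_ring_1}"
  assumes "open U" "\<And>i. i \<in> S \<Longrightarrow> ck_on k U (f i)"
  shows "ck_on k U (\<lambda>x. \<Prod>i\<in>S. f i x)"
  using assms(2)
proof (induction S rule: infinite_finite_induct)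
  case (insert i S)
  then show ?case by (simp add: ck_on_mult[OF assms(1)])
qed (simp_all add: ck_on_const[OF assms(1)])

lemma ck_on_ident: "open U \<Longrightarrow> ck_on k U (\<lambda>x. x)"
proof (cases k)
  case (Suc j)
  assume "open U"
  then show ?thesis unfolding Suc by (intro ck_on_SucI[where f' = "\<lambda>x v. v"] ck_on_const) auto
qed auto

lemma ck_on_minus: "open U \<Longrightarrow> ck_on k U f \<Longrightarrow> ck_on k U (\<lambda>x. - f x)"
  by (rule ck_on_bounded_linear[OF bounded_linear_minus[OF bounded_linear_ident]])

lemma ck_on_diff: "open U \<Longrightarrow> ck_on k U f \<Longrightarrow> ck_on k U g \<Longrightarrow> ck_on k U (\<lambda>x. f x - g x)"
  using ck_on_add[of U k f "\<lambda>x. - g x"] ck_on_minus[of U k g] by simp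

lemma ck_on_fst: "open U \<Longrightarrow> ck_on k U f \<Longrightarrow> ck_on k U (\<lambda>x. fst (f x))"
  by (rule ck_on_bounded_linear[OF bounded_linear_fst])

lemma ck_on_snd: "open U \<Longrightarrow> ck_on k U f \<Longrightarrow> ck_on k U (\<lambda>x. snd (f x))"
  by (rule ck_on_bounded_linear[OF bounded_linear_snd])

lemma ck_on_Pair:
  assumes "open U" "ck_on k U f" "ck_on k U g"
  shows "ck_on k U (\<lambda>x. (f x, g x))"
proof -
  have "ck_on k U (\<lambda>x. (f x, 0) + (0, g x))"
    by (intro ck_on_add assms ck_on_bounded_linear[of "\<lambda>y. (y, 0)"] ck_on_bounded_linear[of "\<lambda>y. (0, y)"]
        bounded_linear_intros)
  then show ?thesis by simp
qed

lemma bounded_linear_axis: "bounded_linear (axis i :: 'a::real_normed_vector \<Rightarrow> 'a^'n)"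
proof (rule bounded_linear_intro[where K=1])
  show "norm (axis i x :: 'a^'n) \<le> norm x * 1" for x :: 'a by (simp add: norm_vec_def axis_def L2_set_def if_distrib[of norm] if_distrib[of "\<lambda>x. x ^ 2"] cong: if_cong)
qed (auto simp: axis_def vec_eq_iff)

lemma ck_on_vec:
  fixes f :: "'i::finite \<Rightarrow> _ \<Rightarrow> 'b::real_normed_vector"
  assumes "open U" "\<And>i. ck_on k U (f i)"
  shows "ck_on k U (\<lambda>x. \<chi> i. f i x)"
proof -
  have "ck_on k U (\<lambda>x. \<Sum>i\<in>UNIV. axis i (f i x))"
    by (intro ck_on_sum assms ck_on_bounded_linear[OF bounded_linear_axis])
  moreover have "(\<Sum>i\<in>UNIV. axis i (f i x)) = (\<chi> i. f i x)" for x
    by (simp add: vec_eq_iff axis_def if_distrib cong: if_cong)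
  ultimately show ?thesis by simp
qed

lemma ck_on_nth: "open U \<Longrightarrow> ck_on k U f \<Longrightarrow> ck_on k U (\<lambda>x. f x $ i)"
  by (rule ck_on_bounded_linear[OF bounded_linear_vec_nth])

lemma ck_on_det:
  fixes A :: "_ \<Rightarrow> 'b::{real_normed_algebra,comm_ring_1}^'n^'n"
  assumes "open U" "\<And>i j. ck_on k U (\<lambda>x. A x $ i $ j)"
  shows "ck_on k U (\<lambda>x. det (A x))"
  unfolding det_def by (intro ck_on_sum ck_on_mult ck_on_const ck_on_prod assms)

text \<open>The induction hypothesis covers derivatives of \<open>g\<close> in fixed directions,
  whereas the chain rule differentiates \<open>g\<close> in a direction that moves with the point.
  Expanding that direction in \<open>Basis\<close> leaves fixed directions with scalar
  coefficients.\<close>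

lemma ck_on_compose:
  fixes f :: "'a::real_normed_vector \<Rightarrow> 'b::euclidean_space"
  assumes "open U" "open V" "ck_on k U f" "ck_on k V g" "f ` U \<subseteq> V"
  shows "ck_on k U (\<lambda>x. g (f x))"
  using assms(3,4)
proof (induction k arbitrary: g)
  case 0
  then show ?case
    using assms(5) by (auto intro: continuous_on_compose2)
next
  case (Suc k)
  let ?g = "\<lambda>y. frechet_derivative g (at y)"
  have f': "(f has_derivative frechet_derivative f (at x)) (at x)" if "x \<in> U" for x
    using ck_on_has_derivative[OF Suc.prems(1) that] .
  have g': "(g has_derivative ?g y) (at y)" if "y \<in> V" for y
    using ck_on_has_derivative[OF Suc.prems(2) that] .
  show ?case
  proof (rule ck_on_SucI[OF \<open>open U\<close>])
    show "((\<lambda>x. g (f x)) has_derivative (\<lambda>v. \<Sum>b\<in>Basis. (frechet_derivative f (at x) v \<bullet> b) *\<^sub>R ?g (f x) b)) (at x)"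
      if "x \<in> U" for x
    proof -
      have l: "linear (?g (f x))" using g'[of "f x"] that assms(5)
        by (intro has_derivative_linear) auto
      have "((\<lambda>x. g (f x)) has_derivative (\<lambda>v. ?g (f x) (frechet_derivative f (at x) v))) (at x)"
        using has_derivative_compose[OF f' g'] that assms(5) by blast
      moreover have eq: "?g (f x) w = (\<Sum>b\<in>Basis. (w \<bullet> b) *\<^sub>R ?g (f x) b)" for w
      proof -
        have "?g (f x) w = ?g (f x) (\<Sum>b\<in>Basis. (w \<bullet> b) *\<^sub>R b)"
          by (simp add: euclidean_representation)
        also have "\<dots> = (\<Sum>b\<in>Basis. (w \<bullet> b) *\<^sub>R ?g (f x) b)"
          using l by (simp add: linear_sum linear_cmul)
        finally show ?thesis .
      qed
      ultimately show ?thesis by - (rule has_derivative_eq_rhs, assumption, rule ext, rule eq)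
    qed
    show "ck_on k U (\<lambda>x. \<Sum>b\<in>Basis. (frechet_derivative f (at x) v \<bullet> b) *\<^sub>R ?g (f x) b)" for v
    proof (intro ck_on_sum ck_on_scaleR \<open>open U\<close>)
      show "ck_on k U (\<lambda>x. frechet_derivative f (at x) v \<bullet> b)" for b
        using Suc.prems(1) by (intro ck_on_bounded_linear[OF bounded_linear_inner_left] \<open>open U\<close>) auto
      show "ck_on k U (\<lambda>x. ?g (f x) b)" for b
        using Suc.prems by (intro Suc.IH ck_on_Suc_imp[OF Suc.prems(1)]) auto
    qed
  qed
qed

lemma ck_on_real:
  fixes g :: "'a::real_normed_field \<Rightarrow> 'a"
  assumes "open U" "\<And>x. x \<in> U \<Longrightarrow> (g has_field_derivative g' x) (at x)" "ck_on k U g'"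
  shows "ck_on (Suc k) U g"
proof (rule ck_on_SucI[OF assms(1)])
  show "(g has_derivative (\<lambda>v. g' x * v)) (at x)" if "x \<in> U" for x
    using assms(2)[OF that] by (simp add: has_field_derivative_def)
  show "ck_on k U (\<lambda>x. g' x * v)" for v
    by (intro ck_on_mult ck_on_const assms)
qed

lemma ck_on_inverse: "ck_on k (- {0}) (inverse :: 'a::real_normed_field \<Rightarrow> 'a)"
proof (induction k)
  case 0
  then show ?case by (auto intro: continuous_intros)
next
  case (Suc k)
  show ?case
    by (rule ck_on_real[where g' = "\<lambda>x. - (inverse x * inverse x)"])
      (auto intro!: ck_on_minus ck_on_mult Suc derivative_eq_intros)
qed

lemma ck_on_frechet_continuous:
  assumes "ck_on (Suc k) U f"
  shows "continuous_on U (\<lambda>x. frechet_derivative f (at x) v)"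
  using ck_on_mono[of k U "\<lambda>x. frechet_derivative f (at x) v" 0] assms by auto

section \<open>Symmetry of second derivatives\<close>

text \<open>Two applications of the mean value theorem write the second difference over a small
  parallelogram as h^2 times a mixed derivative at some point of it. The second difference does not
  change when \<open>v\<close> and \<open>w\<close> are exchanged, so the two mixed derivatives
  share a value arbitrarily close to \<open>x\<close>, and continuity does the rest.\<close>

lemma symmetric_second_derivative_real:
  fixes f :: "'a::real_normed_vector \<Rightarrow> real"
  assumes U: "open U" "x \<in> U" and f: "ck_on (Suc (Suc 0)) U f"
  shows "frechet_derivative (\<lambda>y. frechet_derivative f (at y) v) (at x) w =
         frechet_derivative (\<lambda>y. frechet_derivative f (at y) w) (at x) v"
proof (rule ccontr)
  define D where "D = (\<lambda>v w y. frechet_derivative (\<lambda>y. frechet_derivative f (at y) v) (at y) w)"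
  assume "\<not> ?thesis"
  then have ne: "D v w x \<noteq> D w v x" by (simp add: D_def)
  \<comment> \<open>Half of the gap: a number within \<open>e\<close> of \<open>D v w x\<close>
    cannot be within \<open>e\<close> of \<open>D w v x\<close>.\<close>
  define e where "e = \<bar>D v w x - D w v x\<bar> / 2"
  have e: "e > 0" using ne by (simp add: e_def)
  have cD: "continuous_on U (D a b)" for a b
    using f unfolding D_def by auto
  have "\<exists>d>0. \<forall>y. dist y x < d \<longrightarrow> y \<in> U \<and> dist (D a b y) (D a b x) < e" for a b
  proof -
    have "isCont (D a b) x" using cD U continuous_on_eq_continuous_at by blast
    then obtain d1 where "d1 > 0" "\<forall>y. dist y x < d1 \<longrightarrow> dist (D a b y) (D a b x) < e"
      using e unfolding continuous_at_eps_delta by blast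
    moreover obtain d2 where "d2 > 0" "\<forall>y. dist y x < d2 \<longrightarrow> y \<in> U"
      using U open_dist by blast
    ultimately show ?thesis by (intro exI[of _ "min d1 d2"]) auto
  qed
  then obtain d1 d2 where d1: "d1 > 0" "\<And>y. dist y x < d1 \<Longrightarrow> y \<in> U \<and> dist (D v w y) (D v w x) < e"
    and d2: "d2 > 0" "\<And>y. dist y x < d2 \<Longrightarrow> y \<in> U \<and> dist (D w v y) (D w v x) < e"
    by metis
  define d where "d = min d1 d2"
  have d: "d > 0" using d1 d2 by (simp add: d_def)
  \<comment> \<open>Small enough that the parallelogram with sides \<open>h *\<^sub>R v\<close> and
    \<open>h *\<^sub>R w\<close> at \<open>x\<close> stays within distance \<open>d\<close>; the
    summand 1 keeps the denominator positive.\<close>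
  define h where "h = d / (2 * (norm v + norm w + 1))"
  have h: "h > 0" using d unfolding h_def
    by (intro divide_pos_pos mult_pos_pos add_nonneg_pos add_nonneg_nonneg) auto
  have near: "dist (x + s *\<^sub>R v + t *\<^sub>R w) x < d" if "0 \<le> s" "s \<le> h" "0 \<le> t" "t \<le> h" for s t
  proof -
    have "dist (x + s *\<^sub>R v + t *\<^sub>R w) x = norm (s *\<^sub>R v + t *\<^sub>R w)" by (simp add: dist_norm)
    also have "\<dots> \<le> s * norm v + t * norm w"
      using norm_triangle_ineq[of "s *\<^sub>R v" "t *\<^sub>R w"] that by simp
    also have "\<dots> \<le> h * norm v + h * norm w"
      using that by (intro add_mono mult_right_mono) auto
    also have "\<dots> < h * (2 * (norm v + norm w + 1))"
    proof -
      have "norm v + norm w < 2 * (norm v + norm w + 1)"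
        using norm_ge_zero[of v] norm_ge_zero[of w] unfolding distrib_left by (smt (verit))
      then have "h * (norm v + norm w) < h * (2 * (norm v + norm w + 1))"
        by (rule mult_strict_left_mono[OF _ h])
      then show ?thesis by (simp only: distrib_left)
    qed
    also have "\<dots> = d" 
    proof -
      have "norm v + norm w + 1 > 0" by (intro add_nonneg_pos add_nonneg_nonneg) auto
      then show ?thesis unfolding h_def by (simp add: field_simps)
    qed
    finally show ?thesis .
  qed
  have main: "\<exists>s t. 0 \<le> s \<and> s \<le> h \<and> 0 \<le> t \<and> t \<le> h \<and>
      f (x + h *\<^sub>R a + h *\<^sub>R b) - f (x + h *\<^sub>R a) - f (x + h *\<^sub>R b) + f x = h * (h * D a b (x + s *\<^sub>R a + t *\<^sub>R b))"
    if in_U: "\<And>s t. 0 \<le> s \<Longrightarrow> s \<le> h \<Longrightarrow> 0 \<le> t \<Longrightarrow> t \<le> h \<Longrightarrow> x + s *\<^sub>R a + t *\<^sub>R b \<in> U" for a b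
  proof -
    have der1: "((\<lambda>s. f (z + s *\<^sub>R a)) has_real_derivative frechet_derivative f (at (z + s *\<^sub>R a)) a) (at s)"
      if "z + s *\<^sub>R a \<in> U" for z s
    proof -
      have "((\<lambda>s. f (z + s *\<^sub>R a)) has_derivative (\<lambda>k. frechet_derivative f (at (z + s *\<^sub>R a)) (k *\<^sub>R a))) (at s)"
        by (rule has_derivative_compose[of "\<lambda>s. z + s *\<^sub>R a", OF _ ck_on_has_derivative[OF f that]])
          (auto intro!: derivative_eq_intros)
      moreover have "linear (frechet_derivative f (at (z + s *\<^sub>R a)))"
        using ck_on_has_derivative[OF f that] has_derivative_linear by blast
      ultimately show ?thesis
        by (simp add: has_field_derivative_def linear_cmul mult_commute_abs)
    qed
    have der2: "((\<lambda>t. frechet_derivative f (at (z + t *\<^sub>R b)) a) has_real_derivative D a b (z + t *\<^sub>R b)) (at t)"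
      if "z + t *\<^sub>R b \<in> U" for z t
    proof -
      let ?f = "\<lambda>y. frechet_derivative f (at y) a"
      have f1: "ck_on (Suc 0) U ?f" using f by simp
      have "((\<lambda>s. ?f (z + s *\<^sub>R b)) has_derivative (\<lambda>k. frechet_derivative ?f (at (z + t *\<^sub>R b)) (k *\<^sub>R b))) (at t)"
        by (rule has_derivative_compose[of "\<lambda>s. z + s *\<^sub>R b", OF _ ck_on_has_derivative[OF f1 that]])
          (auto intro!: derivative_eq_intros)
      moreover have "linear (frechet_derivative ?f (at (z + t *\<^sub>R b)))"
        using ck_on_has_derivative[OF f1 that] has_derivative_linear by blast
      ultimately show ?thesis
        by (simp add: has_field_derivative_def linear_cmul mult_commute_abs D_def)
    qed
    \<comment> \<open>The second difference is the increment of \<open>\<phi>\<close> from 0 to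
      \<open>h\<close>. The mean value theorem for \<open>\<phi>\<close> yields a difference of
      derivatives along \<open>a\<close>, and a second application along \<open>b\<close> yields the
      mixed derivative.\<close>
    define \<phi> where "\<phi> = (\<lambda>s. f (x + h *\<^sub>R b + s *\<^sub>R a) - f (x + s *\<^sub>R a))"
    have "\<exists>s. 0 < s \<and> s < h \<and> \<phi> h - \<phi> 0 = (h - 0) * 
        (frechet_derivative f (at (x + h *\<^sub>R b + s *\<^sub>R a)) a - frechet_derivative f (at (x + s *\<^sub>R a)) a)"
      unfolding \<phi>_def
    proof (rule MVT2[OF h])
      show "((\<lambda>s. f (x + h *\<^sub>R b + s *\<^sub>R a) - f (x + s *\<^sub>R a)) has_real_derivative
        frechet_derivative f (at (x + h *\<^sub>R b + s *\<^sub>R a)) a - frechet_derivative f (at (x + s *\<^sub>R a)) a) (at s)"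
        if "0 \<le> s" "s \<le> h" for s
        using in_U[of s h] in_U[of s 0] that h by (intro DERIV_diff der1) (auto simp: algebra_simps)
    qed
    then obtain s where s: "0 < s" "s < h" "\<phi> h - \<phi> 0 = h * 
        (frechet_derivative f (at (x + h *\<^sub>R b + s *\<^sub>R a)) a - frechet_derivative f (at (x + s *\<^sub>R a)) a)"
      by auto
    have "\<exists>t. 0 < t \<and> t < h \<and> frechet_derivative f (at (x + s *\<^sub>R a + h *\<^sub>R b)) a - frechet_derivative f (at (x + s *\<^sub>R a + 0 *\<^sub>R b)) a
       = (h - 0) * D a b (x + s *\<^sub>R a + t *\<^sub>R b)"
    proof (rule MVT2[OF h])
      show "((\<lambda>t. frechet_derivative f (at (x + s *\<^sub>R a + t *\<^sub>R b)) a) has_real_derivative D a b (x + s *\<^sub>R a + t *\<^sub>R b)) (at t)"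
        if "0 \<le> t" "t \<le> h" for t
        using in_U[of s t] that s by (intro der2) auto
    qed
    then obtain t where t: "0 < t" "t < h" "frechet_derivative f (at (x + s *\<^sub>R a + h *\<^sub>R b)) a - frechet_derivative f (at (x + s *\<^sub>R a)) a
       = h * D a b (x + s *\<^sub>R a + t *\<^sub>R b)"
      by auto
    have "f (x + h *\<^sub>R a + h *\<^sub>R b) - f (x + h *\<^sub>R a) - f (x + h *\<^sub>R b) + f x = \<phi> h - \<phi> 0"
      by (simp add: \<phi>_def algebra_simps)
    also have "\<dots> = h * (h * D a b (x + s *\<^sub>R a + t *\<^sub>R b))"
      unfolding s(3) t(3)[symmetric] by (simp add: algebra_simps)
    finally show ?thesis using s t by (intro exI[of _ s] exI[of _ t]) auto
  qed
  have in1: "x + s *\<^sub>R v + t *\<^sub>R w \<in> U" if "0 \<le> s" "s \<le> h" "0 \<le> t" "t \<le> h" for s t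
    using near[OF that] d1 by (simp add: d_def)
  have in2: "x + s *\<^sub>R w + t *\<^sub>R v \<in> U" if "0 \<le> s" "s \<le> h" "0 \<le> t" "t \<le> h" for s t
    using in1[OF that(3,4,1,2)] by (simp add: algebra_simps)
  obtain s t where 1: "0 \<le> s" "s \<le> h" "0 \<le> t" "t \<le> h"
      "f (x + h *\<^sub>R v + h *\<^sub>R w) - f (x + h *\<^sub>R v) - f (x + h *\<^sub>R w) + f x = h * (h * D v w (x + s *\<^sub>R v + t *\<^sub>R w))"
    using main[of v w] in1 by blast
  obtain s' t' where 2: "0 \<le> s'" "s' \<le> h" "0 \<le> t'" "t' \<le> h"
      "f (x + h *\<^sub>R w + h *\<^sub>R v) - f (x + h *\<^sub>R w) - f (x + h *\<^sub>R v) + f x = h * (h * D w v (x + s' *\<^sub>R w + t' *\<^sub>R v))"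
    using main[of w v] in2 by blast
  have "h * (h * D v w (x + s *\<^sub>R v + t *\<^sub>R w)) = h * (h * D w v (x + s' *\<^sub>R w + t' *\<^sub>R v))"
    unfolding 1(5)[symmetric] 2(5)[symmetric] by (simp add: algebra_simps)
  then have "D v w (x + s *\<^sub>R v + t *\<^sub>R w) = D w v (x + s' *\<^sub>R w + t' *\<^sub>R v)"
    using h by simp
  moreover have "x + s' *\<^sub>R w + t' *\<^sub>R v = x + t' *\<^sub>R v + s' *\<^sub>R w" by simp
  ultimately have "D v w (x + s *\<^sub>R v + t *\<^sub>R w) = D w v (x + t' *\<^sub>R v + s' *\<^sub>R w)"
    by simp
  moreover have "dist (D v w (x + s *\<^sub>R v + t *\<^sub>R w)) (D v w x) < e"
    using d1(2) near[OF 1(1-4)] by (simp add: d_def)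
  moreover have "dist (D w v (x + t' *\<^sub>R v + s' *\<^sub>R w)) (D w v x) < e"
    using d2(2) near[OF 2(3,4,1,2)] by (simp add: d_def)
  ultimately show False
    unfolding e_def dist_real_def by argo
qed

lemma symmetric_second_derivative:
  fixes f :: "'a::real_normed_vector \<Rightarrow> 'b::euclidean_space"
  assumes U: "open U" "x \<in> U" and f: "ck_on (Suc (Suc k)) U f"
  shows "frechet_derivative (\<lambda>y. frechet_derivative f (at y) v) (at x) w =
         frechet_derivative (\<lambda>y. frechet_derivative f (at y) w) (at x) v"
proof (rule euclidean_eqI)
  fix b :: 'b assume b: "b \<in> Basis"
  have f: "ck_on (Suc (Suc 0)) U f" using f by (rule ck_on_mono) auto
  have *: "frechet_derivative (\<lambda>y. g y \<bullet> b) (at y) a = frechet_derivative g (at y) a \<bullet> b"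
    if "ck_on (Suc j) U g" "y \<in> U" for g :: "'a \<Rightarrow> 'b" and y a j
    using frechet_derivative_eqI[OF bounded_linear.has_derivative[OF bounded_linear_inner_left ck_on_has_derivative[OF that]]]
    by metis
  have **: "frechet_derivative (\<lambda>y. frechet_derivative f (at y) v) (at x) w \<bullet> b =
     frechet_derivative (\<lambda>y. frechet_derivative (\<lambda>y. f y \<bullet> b) (at y) v) (at x) w" for v w
  proof -
    have f1: "ck_on (Suc 0) U (\<lambda>y. frechet_derivative f (at y) v)" using f by simp
    have "frechet_derivative (\<lambda>y. frechet_derivative f (at y) v) (at x) w \<bullet> b =
       frechet_derivative (\<lambda>y. frechet_derivative f (at y) v \<bullet> b) (at x) w"
      using *[OF f1 U(2)] by simp
    also have "frechet_derivative (\<lambda>y. frechet_derivative f (at y) v \<bullet> b) (at x) =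
      frechet_derivative (\<lambda>y. frechet_derivative (\<lambda>y. f y \<bullet> b) (at y) v) (at x)"
    proof (rule frechet_derivative_transform_within_open[OF _ U])
      show "(\<lambda>y. frechet_derivative f (at y) v \<bullet> b) differentiable at x"
        by (rule differentiableI[OF bounded_linear.has_derivative[OF bounded_linear_inner_left ck_on_has_derivative[OF f1 U(2)]]])
      show "frechet_derivative f (at y) v \<bullet> b = frechet_derivative (\<lambda>y. f y \<bullet> b) (at y) v" if "y \<in> U" for y
        using *[OF f that] by simp
    qed
    finally show ?thesis .
  qed
  have "ck_on (Suc (Suc 0)) U (\<lambda>y. f y \<bullet> b)"
    by (rule ck_on_bounded_linear[OF bounded_linear_inner_left U(1) f])
  from symmetric_second_derivative_real[OF U this]
  show "frechet_derivative (\<lambda>y. frechet_derivative f (at y) v) (at x) w \<bullet> b =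
      frechet_derivative (\<lambda>y. frechet_derivative f (at y) w) (at x) v \<bullet> b"
    unfolding ** .
qed

section \<open>Smooth maps on arbitrary subsets\<close>

lemma smooth_onI:
  assumes "open U" "\<And>k. ck_on k U f" "A \<subseteq> U"
  shows "smooth_on A f"
  unfolding smooth_on_def using assms by blast

lemma smooth_on_openD:
  assumes "open A" "smooth_on A f"
  shows "ck_on k A f"
proof (rule ck_on_local)
  fix x assume "x \<in> A"
  then obtain U g where U: "open U" "x \<in> U" "ck_on k U g" "\<forall>y\<in>A \<inter> U. g y = f y"
    using assms(2) unfolding smooth_on_def by blast
  have "ck_on k (A \<inter> U) f"
    by (rule ck_on_cong[OF _ ck_on_subset[OF U(3)]]) (use U assms in auto)
  then show "\<exists>V. open V \<and> x \<in> V \<and> ck_on k V f"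
    using U assms \<open>x \<in> A\<close> by (intro exI[of _ "A \<inter> U"]) auto
qed

lemma smooth_onE:
  assumes "smooth_on A f" "x \<in> A"
  obtains U g where "open U" "x \<in> U" "\<forall>k. ck_on k U g" "\<forall>y\<in>A. y \<in> U \<longrightarrow> g y = f y"
proof -
  from assms have "\<exists>U g. open U \<and> x \<in> U \<and> (\<forall>k. ck_on k U g) \<and> (\<forall>y\<in>A \<inter> U. g y = f y)"
    unfolding smooth_on_def by blast
  then obtain U g where "open U" "x \<in> U" "\<forall>k. ck_on k U g" "\<forall>y\<in>A \<inter> U. g y = f y" by blast
  then show ?thesis using that[of U g] by simp
qed

lemma smooth_on_extensionI:
  assumes "\<And>x. x \<in> A \<Longrightarrow> \<exists>U g. open U \<and> x \<in> U \<and> (\<forall>k. ck_on k U g) \<and> (\<forall>y. y \<in> A \<longrightarrow> y \<in> U \<longrightarrow> g y = f y)"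
  shows "smooth_on A f"
  unfolding smooth_on_def
proof
  fix x assume "x \<in> A"
  from assms[OF this] obtain U g where "open U" "x \<in> U" "\<forall>k. ck_on k U g" "\<forall>y. y \<in> A \<longrightarrow> y \<in> U \<longrightarrow> g y = f y"
    by blast
  then show "\<exists>U g. open U \<and> x \<in> U \<and> (\<forall>k. ck_on k U g) \<and> (\<forall>y\<in>A \<inter> U. g y = f y)"
    by (intro exI[of _ U] exI[of _ g]) simp
qed

lemma smooth_on_subset:
  assumes "smooth_on A f" "B \<subseteq> A"
  shows "smooth_on B f"
proof (rule smooth_on_extensionI)
  fix x assume "x \<in> B"
  then have "x \<in> A" using assms by blast
  from smooth_onE[OF assms(1) this] obtain U g where "open U" "x \<in> U" "\<forall>k. ck_on k U g"
    "\<forall>y\<in>A. y \<in> U \<longrightarrow> g y = f y" by blast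
  then show "\<exists>U g. open U \<and> x \<in> U \<and> (\<forall>k. ck_on k U g) \<and> (\<forall>y. y \<in> B \<longrightarrow> y \<in> U \<longrightarrow> g y = f y)"
    using assms(2) by (intro exI[of _ U] exI[of _ g]) auto
qed

lemma smooth_on_cong:
  assumes "smooth_on A f" "\<And>x. x \<in> A \<Longrightarrow> f x = g x"
  shows "smooth_on A g"
proof (rule smooth_on_extensionI)
  fix x assume "x \<in> A"
  from smooth_onE[OF assms(1) this] obtain U h where "open U" "x \<in> U" "\<forall>k. ck_on k U h"
    "\<forall>y\<in>A. y \<in> U \<longrightarrow> h y = f y" by blast
  then show "\<exists>U h. open U \<and> x \<in> U \<and> (\<forall>k. ck_on k U h) \<and> (\<forall>y. y \<in> A \<longrightarrow> y \<in> U \<longrightarrow> h y = g y)"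
    using assms(2) by (intro exI[of _ U] exI[of _ h]) auto
qed

lemma smooth_on_local:
  assumes "\<And>x. x \<in> A \<Longrightarrow> \<exists>U. open U \<and> x \<in> U \<and> smooth_on (A \<inter> U) f"
  shows "smooth_on A f"
  unfolding smooth_on_def
proof
  fix x assume x: "x \<in> A"
  then obtain U where U: "open U" "x \<in> U" "smooth_on (A \<inter> U) f" using assms by blast
  then obtain V g where "open V" "x \<in> V" "\<forall>k. ck_on k V g" "\<forall>y\<in>A \<inter> U \<inter> V. g y = f y"
    unfolding smooth_on_def using x by blast
  then show "\<exists>U g. open U \<and> x \<in> U \<and> (\<forall>k. ck_on k U g) \<and> (\<forall>y\<in>A \<inter> U. g y = f y)"
    using U by (intro exI[of _ "U \<inter> V"] exI[of _ g]) (auto intro: ck_on_subset)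
qed

lemma smooth_on_compose:
  assumes "smooth_on A f" "smooth_on B g" "f ` A \<subseteq> B"
  shows "smooth_on A (\<lambda>x. g (f x))"
  unfolding smooth_on_def
proof
  fix x assume x: "x \<in> A"
  obtain U f' where U: "open U" "x \<in> U" "\<forall>k. ck_on k U f'" "\<forall>y\<in>A. y \<in> U \<longrightarrow> f' y = f y"
    by (rule smooth_onE[OF assms(1) x])
  have fx: "f x \<in> B" using x assms(3) by blast
  obtain V g' where V: "open V" "f x \<in> V" "\<forall>k. ck_on k V g'" "\<forall>y\<in>B. y \<in> V \<longrightarrow> g' y = g y"
    by (rule smooth_onE[OF assms(2) fx])
  \<comment> \<open>Off \<open>A\<close> the extension \<open>f'\<close> may leave the domain
    \<open>V\<close> of the extension of \<open>g\<close>, so its own preimage of \<open>V\<close>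
    is taken.\<close>
  define W where "W = U \<inter> f' -` V"
  have "continuous_on U f'" using U(3)[rule_format, of 0] by simp
  then have W: "open W" using U V unfolding W_def by (intro continuous_open_preimage) 
  have "ck_on k W (\<lambda>x. g' (f' x))" for k
    by (rule ck_on_compose[OF W V(1) ck_on_subset[OF U(3)[rule_format]] V(3)[rule_format]]) (auto simp: W_def)
  moreover have "x \<in> W" using U V x by (auto simp: W_def)
  moreover have "g' (f' y) = g (f y)" if "y \<in> A \<inter> W" for y
    using that U(4) V(4) assms(3) by (auto simp: W_def)
  ultimately show "\<exists>U h. open U \<and> x \<in> U \<and> (\<forall>k. ck_on k U h) \<and> (\<forall>y\<in>A \<inter> U. h y = g (f y))"
    using W by (intro exI[of _ W] exI[of _ "\<lambda>x. g' (f' x)"]) auto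
qed

lemma smooth_on_Pair:
  assumes "smooth_on A f" "smooth_on A g"
  shows "smooth_on A (\<lambda>x. (f x, g x))"
  unfolding smooth_on_def
proof
  fix x assume x: "x \<in> A"
  obtain U f' where U: "open U" "x \<in> U" "\<forall>k. ck_on k U f'" "\<forall>y\<in>A. y \<in> U \<longrightarrow> f' y = f y"
    by (rule smooth_onE[OF assms(1) x])
  obtain V g' where V: "open V" "x \<in> V" "\<forall>k. ck_on k V g'" "\<forall>y\<in>A. y \<in> V \<longrightarrow> g' y = g y"
    by (rule smooth_onE[OF assms(2) x])
  have "ck_on k (U \<inter> V) (\<lambda>x. (f' x, g' x))" for k
    by (rule ck_on_Pair[OF _ ck_on_subset[OF U(3)[rule_format]] ck_on_subset[OF V(3)[rule_format]]]) (use U V in auto)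
  then show "\<exists>U h. open U \<and> x \<in> U \<and> (\<forall>k. ck_on k U h) \<and> (\<forall>y\<in>A \<inter> U. h y = (f y, g y))"
    using U V by (intro exI[of _ "U \<inter> V"] exI[of _ "\<lambda>x. (f' x, g' x)"]) auto
qed

lemma smooth_on_const: "smooth_on A (\<lambda>x. c)"
  by (rule smooth_onI[OF open_UNIV]) (auto intro: ck_on_const)

lemma smooth_on_ident: "smooth_on A (\<lambda>x. x)"
  by (rule smooth_onI[OF open_UNIV]) (auto intro: ck_on_ident)

lemma smooth_on_bounded_linear:
  assumes "bounded_linear L" "smooth_on A f"
  shows "smooth_on A (\<lambda>x. L (f x))"
  by (rule smooth_on_compose[OF assms(2), of UNIV L])
    (auto intro!: smooth_onI[OF open_UNIV] ck_on_bounded_linear[OF assms(1)] ck_on_ident)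

lemma smooth_on_bilinear:
  fixes B :: "'b::euclidean_space \<Rightarrow> 'c::euclidean_space \<Rightarrow> 'd::euclidean_space"
  assumes "bounded_bilinear B" "smooth_on A f" "smooth_on A g"
  shows "smooth_on A (\<lambda>x. B (f x) (g x))"
proof -
  have "smooth_on UNIV (\<lambda>z. B (fst z) (snd z))"
    by (intro smooth_onI[OF open_UNIV] ck_on_bilinear[OF assms(1)] ck_on_fst ck_on_snd ck_on_ident) auto
  from smooth_on_compose[OF smooth_on_Pair[OF assms(2,3)] this] show ?thesis by simp
qed

lemma smooth_on_add:
  fixes f g :: "_ \<Rightarrow> 'b::euclidean_space"
  assumes "smooth_on A f" "smooth_on A g"
  shows "smooth_on A (\<lambda>x. f x + g x)"
proof -
  have "smooth_on UNIV (\<lambda>z. fst z + snd z :: 'b)"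
    by (intro smooth_onI[OF open_UNIV] ck_on_add ck_on_fst ck_on_snd ck_on_ident) auto
  from smooth_on_compose[OF smooth_on_Pair[OF assms(1,2)] this] show ?thesis by simp
qed

lemmas smooth_on_scaleR = smooth_on_bilinear[OF bounded_bilinear_scaleR]
lemmas smooth_on_fst = smooth_on_bounded_linear[OF bounded_linear_fst]
lemmas smooth_on_snd = smooth_on_bounded_linear[OF bounded_linear_snd]

lemma smooth_on_inverse:
  fixes f :: "_ \<Rightarrow> real"
  assumes "smooth_on A f" "\<And>x. x \<in> A \<Longrightarrow> f x \<noteq> 0"
  shows "smooth_on A (\<lambda>x. inverse (f x))"
  by (rule smooth_on_compose[OF assms(1), of "-{0}"]) (use assms(2) in \<open>auto intro!: smooth_onI[of "-{0}"] ck_on_inverse\<close>)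

lemma smooth_on_continuous_on:
  assumes "smooth_on A f"
  shows "continuous_on A f"
  unfolding continuous_on_eq_continuous_within
proof
  fix x assume x: "x \<in> A"
  obtain U g where U: "open U" "x \<in> U" "\<forall>k. ck_on k U g" "\<forall>y\<in>A. y \<in> U \<longrightarrow> g y = f y"
    by (rule smooth_onE[OF assms x])
  have "isCont g x" using U(1,2) U(3)[rule_format, of 0] continuous_on_eq_continuous_at by auto
  then have "(g \<longlongrightarrow> g x) (at x within A)"
    using continuous_at_imp_continuous_within continuous_within by blast
  moreover have "eventually (\<lambda>y. g y = f y) (at x within A)"
    using eventually_at_topological U by blast
  moreover have "g x = f x" using U x by auto
  ultimately show "continuous (at x within A) f"
    by (simp add: continuous_within filterlim_cong)
qed

section \<open>Bump functions\<close>

text \<open>The powers of \<open>inverse t\<close> make the family closed under differentiation.\<close>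

definition flat :: "nat \<Rightarrow> real \<Rightarrow> real" where
  "flat m t = (if t \<le> 0 then 0 else exp (- inverse t) * inverse t ^ m)"

lemma power_le_fact_exp:
  fixes x :: real assumes "x \<ge> 0" shows "x ^ k \<le> fact k * exp x"
proof -
  have "(\<Sum>n\<in>{k}. x ^ n /\<^sub>R fact n) \<le> exp x"
    unfolding exp_def by (rule sum_le_suminf) (use assms summable_exp_generic[of x] in auto)
  then show ?thesis by (simp add: field_simps)
qed

text \<open>The exponential beats every power of \<open>inverse t\<close>. The factor
  \<open>t\<^sup>2\<close>, one power more than continuity would ask for, makes the difference
  quotient at 0 tend to 0.\<close>

lemma flat_bound: "\<bar>flat m t\<bar> \<le> fact (m + 2) * t\<^sup>2"
proof (cases "t \<le> 0")
  case False
  then have t: "t > 0" by simp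
  have "inverse t ^ (m + 2) \<le> fact (m + 2) * exp (inverse t)"
    using power_le_fact_exp[of "inverse t" "m+2"] t by simp
  then have "inverse t ^ (m + 2) * exp (- inverse t) \<le> fact (m + 2) * exp (inverse t) * exp (- inverse t)"
    by (rule mult_right_mono) simp
  then have "inverse t ^ m * inverse t ^ 2 * exp (- inverse t) \<le> fact (m + 2)"
    by (simp only: power_add mult.assoc exp_minus_inverse mult_1_right)
  then have "t\<^sup>2 * (inverse t ^ m * inverse t ^ 2 * exp (- inverse t)) \<le> t\<^sup>2 * fact (m + 2)"
    by (intro mult_left_mono) auto
  moreover have "t\<^sup>2 * (inverse t ^ m * inverse t ^ 2 * exp (- inverse t)) = flat m t"
    using t by (simp add: flat_def field_simps)
  moreover have "flat m t \<ge> 0" using t by (simp add: flat_def)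
  ultimately show ?thesis by (simp add: mult.commute)
qed (simp add: flat_def)

lemma flat_derivative: "(flat m has_real_derivative flat (m + 2) t - m * flat (m + 1) t) (at t)"
proof -
  consider "t < 0" | "t = 0" | "t > 0" by linarith
  then show ?thesis
  proof cases
    case 1
    have "(flat m has_real_derivative 0) (at t)"
      by (rule has_field_derivative_transform_within_open[where S = "{..<0}" and f = "\<lambda>t. 0"])
        (use 1 in \<open>auto simp: flat_def\<close>)
    then show ?thesis using 1 by (simp add: flat_def)
  next
    case 2
    have "((\<lambda>h. flat m h / h) \<longlongrightarrow> 0) (at 0)"
    proof (rule Lim_null_comparison)
      show "\<forall>\<^sub>F h in at 0. norm (flat m h / h) \<le> fact (m + 2) * \<bar>h\<bar>"
      proof (rule eventually_at_filter[THEN iffD2], rule always_eventually, intro allI impI)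
        fix h :: real assume h: "h \<noteq> 0"
        have "norm (flat m h / h) = \<bar>flat m h\<bar> / \<bar>h\<bar>" by simp
        also have "\<dots> \<le> fact (m + 2) * h\<^sup>2 / \<bar>h\<bar>" by (intro divide_right_mono flat_bound) auto
        also have "\<dots> = fact (m + 2) * \<bar>h\<bar>" using h
          by (simp add: power2_eq_square field_simps del: fact_Suc)
        finally show "norm (flat m h / h) \<le> fact (m + 2) * \<bar>h\<bar>" .
      qed
      have "((\<lambda>h. fact (m + 2) * \<bar>h\<bar>) \<longlongrightarrow> fact (m + 2) * \<bar>0::real\<bar>) (at 0)" by (intro tendsto_intros)
      then show "((\<lambda>h. fact (m + 2) * \<bar>h::real\<bar>) \<longlongrightarrow> 0) (at 0)" by (simp del: fact_Suc)
    qed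
    then have "(flat m has_real_derivative 0) (at 0)"
      unfolding DERIV_def by (simp add: flat_def)
    then show ?thesis using 2 by (simp add: flat_def)
  next
    case 3
    have "((\<lambda>t. exp (- inverse t) * inverse t ^ m) has_real_derivative flat (m + 2) t - m * flat (m + 1) t) (at t)"
    proof (cases m)
      case 0
      then show ?thesis
        using 3 by (auto intro!: derivative_eq_intros simp: flat_def power2_eq_square field_simps)
    next
      case (Suc j)
      then show ?thesis
        using 3 by (auto intro!: derivative_eq_intros simp: flat_def algebra_simps simp del: inverse_eq_divide)
          (cases j, auto)
    qed
    then show ?thesis
      by (rule has_field_derivative_transform_within_open[where S = "{0<..}"])
        (use 3 in \<open>auto simp: flat_def\<close>)
  qed
qed

lemma ck_on_flat: "ck_on k UNIV (flat m)"
proof (induction k arbitrary: m)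
  case 0
  have "isCont (flat m) x" for x by (rule DERIV_isCont[OF flat_derivative])
  then show ?case by (auto intro!: continuous_at_imp_continuous_on)
next
  case (Suc k)
  show ?case
    by (rule ck_on_real[OF open_UNIV flat_derivative]) (intro ck_on_diff ck_on_mult ck_on_const Suc open_UNIV)
qed

text \<open>The squared distance is polynomial, hence smooth at the centre \<open>a\<close> as well,
  and its difference from \<open>\<rho>\<^sup>2\<close> changes sign exactly on the sphere of radius
  \<open>\<rho>\<close>.\<close>

definition bump :: "'a::euclidean_space \<Rightarrow> real \<Rightarrow> 'a \<Rightarrow> real" where
  "bump a \<rho> x = flat 0 (\<rho>\<^sup>2 - (x - a) \<bullet> (x - a))"

lemma bump_nonneg: "bump a \<rho> x \<ge> 0"
  by (simp add: bump_def flat_def)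

lemma bump_pos_iff: "\<rho> > 0 \<Longrightarrow> bump a \<rho> x > 0 \<longleftrightarrow> dist a x < \<rho>"
proof -
  assume r: "\<rho> > 0"
  have "dist a x < \<rho> \<longleftrightarrow> norm (x - a) ^ 2 < \<rho> ^ 2"
    using r abs_less_iff abs_le_square_iff[of \<rho> "norm (x - a)"] by (simp add: dist_norm norm_minus_commute not_le[symmetric])
  then show ?thesis by (simp add: bump_def flat_def power2_norm_eq_inner not_le)
qed

lemma bump_eq_0: "\<rho> > 0 \<Longrightarrow> \<rho> \<le> dist a x \<Longrightarrow> bump a \<rho> x = 0"
  using bump_pos_iff[of \<rho> a x] bump_nonneg[of a \<rho> x] by linarith

lemma ck_on_bump: "ck_on k UNIV (bump a \<rho>)"
  unfolding bump_def
  by (rule ck_on_compose[where V=UNIV and g = "flat 0"])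
    (auto intro!: ck_on_flat ck_on_diff ck_on_const ck_on_bilinear[OF bounded_bilinear_inner] ck_on_ident)


lemma ck_on_slice_derivative:
  fixes g :: "real \<times> 'a::real_normed_vector \<Rightarrow> real"
  assumes "ck_on (Suc k) \<Omega> g" "(t, u) \<in> \<Omega>"
  shows "((\<lambda>t. g (t, u)) has_real_derivative frechet_derivative g (at (t, u)) (1, 0)) (at t)"
proof -
  have d: "(g has_derivative frechet_derivative g (at (t, u))) (at (t, u))"
    using ck_on_has_derivative[OF assms] .
  have "((\<lambda>t. g (t, u)) has_derivative (\<lambda>h. frechet_derivative g (at (t, u)) (h, 0))) (at t)"
    by (rule has_derivative_compose[of "\<lambda>t. (t, u)", OF _ d]) (auto intro!: derivative_eq_intros)
  moreover have eq: "frechet_derivative g (at (t, u)) (h, 0) = frechet_derivative g (at (t, u)) (1, 0) * h" for h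
    using linear_cmul[OF has_derivative_linear[OF d], of h "(1, 0)"] by simp
  ultimately show ?thesis
    unfolding has_field_derivative_def by - (rule has_derivative_eq_rhs, assumption, rule ext, rule eq)
qed

section \<open>Integrals depending on a parameter\<close>

lemma set_integrable_on_compact:
  fixes f :: "'a::euclidean_space \<Rightarrow> real"
  assumes "compact C" "continuous_on C f" "B \<in> sets borel" "B \<subseteq> C"
  shows "set_integrable lborel B f"
proof (rule set_integrable_subset)
  show "set_integrable lborel C f"
    unfolding set_integrable_def by (rule borel_integrable_compact[OF assms(1,2)])
qed (use assms in auto)

text \<open>Compactness of \<open>C\<close> provides a tube of uniform width about
  \<open>{0} \<times> C\<close> inside \<open>\<Omega>\<close> and a bound \<open>K\<close> for the
  partial derivative there. By the mean value theorem \<open>K\<close> dominates the difference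
  quotients.\<close>

lemma set_integral_has_derivative:
  fixes g :: "real \<times> 'a::euclidean_space \<Rightarrow> real"
  assumes \<Omega>: "open \<Omega>" and g: "ck_on (Suc 0) \<Omega> g" and C: "compact C" "{0} \<times> C \<subseteq> \<Omega>"
    and B: "B \<in> sets borel" "B \<subseteq> C"
  shows "((\<lambda>t. LINT u:B|lborel. g (t, u)) has_real_derivative
    (LINT u:B|lborel. frechet_derivative g (at (0, u)) (1, 0))) (at 0)"
proof -
  let ?g' = "\<lambda>z. frechet_derivative g (at z) (1, 0)"
  have "compact ({0::real} \<times> C)" using C by (intro compact_Times) auto
  from compact_subset_open_imp_ball_epsilon_subset[OF this \<Omega> C(2)]
  obtain e where e: "e > 0" "(\<Union>x\<in>{0} \<times> C. ball x e) \<subseteq> \<Omega>" by blast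
  define d where "d = e / 2"
  have d: "d > 0" using e by (simp add: d_def)
  have in_\<Omega>: "(t, u) \<in> \<Omega>" if "\<bar>t\<bar> \<le> d" "u \<in> C" for t u
  proof -
    have "dist (0, u) (t, u) < e" using that e by (simp add: dist_Pair_Pair d_def)
    then show ?thesis using e(2) that(2) by force
  qed
  define Q where "Q = {-d..d} \<times> C"
  have Q: "compact Q" "Q \<subseteq> \<Omega>"
    using C in_\<Omega> unfolding Q_def by (auto intro!: compact_Times)
  have cg': "continuous_on \<Omega> ?g'" using ck_on_frechet_continuous[OF g] .
  have cg: "continuous_on \<Omega> g" using ck_on_Suc_imp[OF g] by simp
  have "bounded (?g' ` Q)"
    by (intro compact_imp_bounded compact_continuous_image continuous_on_subset[OF cg'] Q)
  then obtain K where K: "\<And>z. z \<in> Q \<Longrightarrow> \<bar>?g' z\<bar> \<le> K"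
    unfolding bounded_iff by auto
  have int_g: "set_integrable lborel B (\<lambda>u. g (t, u))" if "\<bar>t\<bar> \<le> d" for t
    by (rule set_integrable_on_compact[OF C(1) _ B])
      (use in_\<Omega>[OF that] in \<open>auto intro!: continuous_on_compose2[OF cg] continuous_intros\<close>)
  have int_g': "set_integrable lborel B (\<lambda>u. ?g' (0, u))"
    by (rule set_integrable_on_compact[OF C(1) _ B])
      (use in_\<Omega>[of 0] d in \<open>auto intro!: continuous_on_compose2[OF cg'] continuous_intros\<close>)
  have int_K: "set_integrable lborel B (\<lambda>u. K)"
    by (rule set_integrable_on_compact[OF C(1) _ B]) (auto intro!: continuous_intros)
  have lip: "\<bar>(g (t, u) - g (0, u)) / t\<bar> \<le> K" if t: "\<bar>t\<bar> \<le> d" "t \<noteq> 0" and u: "u \<in> C" for t u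
  proof -
    have "norm (g (t, u) - g (0, u)) \<le> K * norm (t - 0)"
    proof (rule field_differentiable_bound[of "{-d..d}" "\<lambda>t. g (t, u)" "\<lambda>t. ?g' (t, u)"])
      show "((\<lambda>t. g (t, u)) has_real_derivative ?g' (s, u)) (at s within {-d..d})" if "s \<in> {-d..d}" for s
        using ck_on_slice_derivative[OF g in_\<Omega>[of s u]] that u by (auto intro: has_field_derivative_at_within)
      show "norm (?g' (s, u)) \<le> K" if "s \<in> {-d..d}" for s
        using K[of "(s, u)"] that u by (simp add: Q_def)
    qed (use t d in auto)
    then show ?thesis using t by (simp add: field_simps)
  qed
  have "((\<lambda>t. LINT u:B|lborel. g (t, u)) has_real_derivative
    (LINT u:B|lborel. ?g' (0, u))) (at 0 within {-d..d})"
    \<comment> \<open>Dominated convergence is a statement about sequences, so the limit of the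
      difference quotient is tested along sequences tending to 0.\<close>
    unfolding has_field_derivative_iff tendsto_at_iff_sequentially
  proof (intro allI impI)
    fix X :: "nat \<Rightarrow> real"
    assume X: "\<forall>i. X i \<in> {-d..d} - {0}" and lim: "X \<longlonglongrightarrow> 0"
    have Xd: "\<bar>X i\<bar> \<le> d" "X i \<noteq> 0" for i using X[rule_format, of i] by auto
    have lim_int: "(\<lambda>i. LINT u|lborel. indicator B u *\<^sub>R ((g (X i, u) - g (0, u)) / X i)) \<longlonglongrightarrow>
        (LINT u|lborel. indicator B u *\<^sub>R ?g' (0, u))"
    proof (rule integral_dominated_convergence)
      show "(\<lambda>u. indicator B u *\<^sub>R ?g' (0, u)) \<in> borel_measurable lborel"
        using int_g' unfolding set_integrable_def by (rule borel_measurable_integrable)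
      show "(\<lambda>u. indicator B u *\<^sub>R ((g (X i, u) - g (0, u)) / X i)) \<in> borel_measurable lborel" for i
      proof -
        have "set_integrable lborel B (\<lambda>u. (g (X i, u) - g (0, u)) / X i)"
          using int_g[OF Xd(1)[of i]] int_g[of 0] d by (intro set_integrable_divide set_integral_diff) auto
        then show ?thesis unfolding set_integrable_def by (rule borel_measurable_integrable)
      qed
      show "integrable lborel (\<lambda>u. indicator B u *\<^sub>R K)"
        using int_K unfolding set_integrable_def .
      show "AE u in lborel. (\<lambda>i. indicator B u *\<^sub>R ((g (X i, u) - g (0, u)) / X i)) \<longlonglongrightarrow> indicator B u *\<^sub>R ?g' (0, u)"
      proof (rule AE_I2)
        fix u :: 'a
        show "(\<lambda>i. indicator B u *\<^sub>R ((g (X i, u) - g (0, u)) / X i)) \<longlonglongrightarrow> indicator B u *\<^sub>R ?g' (0, u)"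
        proof (cases "u \<in> B")
          case True
          then have "u \<in> C" using B by blast
          then have "((\<lambda>t. g (t, u)) has_real_derivative ?g' (0, u)) (at 0)"
            using ck_on_slice_derivative[OF g in_\<Omega>[of 0 u]] d by simp
          then have "((\<lambda>y. (g (y, u) - g (0, u)) / (y - 0)) \<longlongrightarrow> ?g' (0, u)) (at 0)"
            unfolding has_field_derivative_iff .
          then have "((\<lambda>y. (g (y, u) - g (0, u)) / (y - 0)) \<circ> X) \<longlonglongrightarrow> ?g' (0, u)"
            unfolding tendsto_at_iff_sequentially using Xd lim by auto
          then show ?thesis using True by (simp add: o_def)
        qed simp
      qed
      show "AE u in lborel. norm (indicator B u *\<^sub>R ((g (X i, u) - g (0, u)) / X i)) \<le> indicator B u *\<^sub>R K" for i
        using lip[OF Xd] B by (intro AE_I2) (auto simp: indicator_def)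
    qed
    have eq: "(LINT u|lborel. indicator B u *\<^sub>R ((g (X i, u) - g (0, u)) / X i)) =
       ((LINT u:B|lborel. g (X i, u)) - (LINT u:B|lborel. g (0, u))) / X i" for i
      using int_g[OF Xd(1)[of i]] int_g[of 0] d
      by (subst set_integral_diff(2)[symmetric]) (auto simp: set_lebesgue_integral_def simp flip: integral_divide_zero)
    show "((\<lambda>y. ((LINT u:B|lborel. g (y, u)) - (LINT u:B|lborel. g (0, u))) / (y - 0)) \<circ> X)
        \<longlonglongrightarrow> (LINT u:B|lborel. ?g' (0, u))"
      using lim_int unfolding eq unfolding o_def diff_0_right set_lebesgue_integral_def .
  qed
  moreover have "at 0 within {-d..d} = at (0::real)"
    by (rule at_within_interior) (use d in \<open>simp add: interior_atLeastAtMost_real\<close>)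
  ultimately show ?thesis by simp
qed

text \<open>By translation invariance the integral of P(u + t v) over u does not depend on t; its
  derivative at t = 0 is the integral in question.\<close>

lemma integral_directional_derivative_eq_0:
  fixes P :: "'a::euclidean_space \<Rightarrow> real"
  assumes P: "ck_on (Suc 0) UNIV P" and C: "compact C" "\<And>u. u \<notin> C \<Longrightarrow> P u = 0"
  shows "(LINT u|lborel. frechet_derivative P (at u) v) = 0"
proof -
  define g where "g = (\<lambda>z::real \<times> 'a. P (snd z + fst z *\<^sub>R v))"
  have ck: "ck_on (Suc 0) UNIV g"
    unfolding g_def
    by (rule ck_on_compose[OF open_UNIV open_UNIV _ P])
      (auto intro!: ck_on_add ck_on_scaleR ck_on_fst ck_on_snd ck_on_ident ck_on_const simp del: ck_on.simps)
  obtain R where R: "R > 0" "\<And>u. u \<in> C \<Longrightarrow> norm u \<le> R"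
    using compact_imp_bounded[OF C(1)] unfolding bounded_pos by auto
  \<comment> \<open>One ball that contains the supports of all translates with parameter between -1
    and 1, so that the domain of integration is fixed.\<close>
  define B where "B = cball (0::'a) (R + norm v)"
  have "((\<lambda>t. LINT u:B|lborel. g (t, u)) has_real_derivative
    (LINT u:B|lborel. frechet_derivative g (at (0, u)) (1, 0))) (at 0)"
    by (rule set_integral_has_derivative[OF open_UNIV ck, of B]) (auto simp: B_def)
  moreover have "((\<lambda>t. LINT u:B|lborel. g (t, u)) has_real_derivative 0) (at 0)"
  proof (rule has_field_derivative_transform_within_open)
    show "((\<lambda>t. LINT u|lborel. P u) has_real_derivative 0) (at 0)" by simp
    show "(LINT u|lborel. P u) = (LINT u:B|lborel. g (t, u))" if "t \<in> ball 0 1" for t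
    proof -
      have "indicator B u *\<^sub>R g (t, u) = P (t *\<^sub>R v + u)" for u
      proof (cases "P (t *\<^sub>R v + u) = 0")
        case True then show ?thesis by (simp add: g_def add.commute)
      next
        case False
        then have "norm (t *\<^sub>R v + u) \<le> R" using C(2) R(2) by blast
        then have "norm u \<le> R + norm (t *\<^sub>R v)"
          using norm_triangle_ineq4[of "t *\<^sub>R v + u" "t *\<^sub>R v"] by simp
        also have "\<dots> \<le> R + norm v" using that by (simp add: mult_left_le_one_le)
        finally have "u \<in> B" by (simp add: B_def)
        then show ?thesis by (simp add: g_def add.commute)
      qed
      then have "(LINT u:B|lborel. g (t, u)) = (LINT u|lborel. P (t *\<^sub>R v + u))"
        unfolding set_lebesgue_integral_def by simp
      also have "\<dots> = (LINT u|distr lborel borel ((+) (t *\<^sub>R v)). P u)"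
      proof (rule integral_distr[symmetric])
        have "continuous_on UNIV P" using ck_on_Suc_imp[OF P] by simp
        then show "P \<in> borel_measurable borel" by (rule borel_measurable_continuous_onI)
      qed simp
      finally show ?thesis by (simp add: lborel_distr_plus)
    qed
  qed auto
  ultimately have "(LINT u:B|lborel. frechet_derivative g (at (0, u)) (1, 0)) = 0"
    by (rule DERIV_unique)
  moreover have "indicator B u *\<^sub>R frechet_derivative g (at (0, u)) (1, 0) = frechet_derivative P (at u) v" for u
  proof -
    have "(g has_derivative (\<lambda>h. frechet_derivative P (at u) (snd h + fst h *\<^sub>R v))) (at (0, u))"
      unfolding g_def
      by (rule has_derivative_compose[of "\<lambda>z. snd z + fst z *\<^sub>R v" _ "(0, u)"])
       (use ck_on_has_derivative[OF P, of u] in \<open>auto intro!: derivative_eq_intros\<close>)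
    then have 1: "frechet_derivative g (at (0, u)) (1, 0) = frechet_derivative P (at u) v"
      by (simp add: frechet_derivative_eqI)
    have 2: "frechet_derivative P (at u) v = 0" if "u \<notin> B"
    proof -
      have "u \<notin> C"
      proof
        assume "u \<in> C"
        then have "norm u \<le> R + norm v" using R(2)[of u] norm_ge_zero[of v] by linarith
        then show False using that by (simp add: B_def)
      qed
      moreover have "open (- C)" using C(1) compact_imp_closed by blast
      ultimately have "(P has_derivative (\<lambda>v. 0)) (at u)"
        by (intro has_derivative_transform_within_open[OF has_derivative_const, of "- C" u "0"])
          (use C(2) in auto)
      then show ?thesis by (simp add: frechet_derivative_eqI)
    qed
    show ?thesis using 1 2 by (cases "u \<in> B") auto
  qed
  ultimately show ?thesis unfolding set_lebesgue_integral_def by simp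
qed

section \<open>The first variation of the volume of Lagrangian maps\<close>

text \<open>The derivative of \<open>det\<close> at \<open>A\<close> in direction \<open>B\<close>,
  one row at a time, as \<open>det_has_derivative\<close> shows.\<close>

definition ddet :: "'a::comm_ring_1^'n^'n \<Rightarrow> 'a^'n^'n \<Rightarrow> 'a" where
  "ddet A B = (\<Sum>k\<in>UNIV. det (\<chi> i. if i = k then B $ i else A $ i))"

lemma ddet_expand:
  "ddet A B = (\<Sum>p | p permutes UNIV. of_int (sign p) * (\<Sum>k\<in>UNIV. B $ k $ p k * (\<Prod>i\<in>UNIV - {k}. A $ i $ p i)))"
proof -
  have "(\<Prod>i\<in>UNIV. (\<chi> i. if i = k then B $ i else A $ i) $ i $ p i) = B $ k $ p k * (\<Prod>i\<in>UNIV - {k}. A $ i $ p i)" for p k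
  proof -
    have "(\<Prod>i\<in>UNIV. (\<chi> i. if i = k then B $ i else A $ i) $ i $ p i) =
      (\<Prod>i\<in>insert k (UNIV - {k}). (if i = k then B $ i else A $ i) $ p i)"
      by (rule prod.cong) auto
    also have "\<dots> = B $ k $ p k * (\<Prod>i\<in>UNIV - {k}. (if i = k then B $ i else A $ i) $ p i)"
      by (subst prod.insert) auto
    also have "(\<Prod>i\<in>UNIV - {k}. (if i = k then B $ i else A $ i) $ p i) = (\<Prod>i\<in>UNIV - {k}. A $ i $ p i)"
      by (rule prod.cong) auto
    finally show ?thesis .
  qed
  then show ?thesis
    unfolding ddet_def det_def sum_distrib_left by (subst sum.swap) simp
qed

lemma det_has_derivative:
  fixes A :: "'x::real_normed_vector \<Rightarrow> 'b::real_normed_field^'n^'n"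
  assumes "\<And>i j. ((\<lambda>x. A x $ i $ j) has_derivative (\<lambda>v. A' v $ i $ j)) (at x)"
  shows "((\<lambda>x. det (A x)) has_derivative (\<lambda>v. ddet (A x) (A' v))) (at x)"
  unfolding det_def ddet_expand
  by (intro has_derivative_sum has_derivative_mult_right has_derivative_prod assms)

lemma ddet_add: "ddet A (B + C) = ddet A B + ddet A C"
  unfolding ddet_expand by (simp add: sum.distrib algebra_simps)

lemma ddet_scale: "ddet A (\<chi> i. c *s B $ i) = c * ddet A B"
  unfolding ddet_expand by (simp add: sum_distrib_left algebra_simps)

lemma ddet_sum:
  assumes "finite S" shows "ddet A (\<Sum>s\<in>S. B s) = (\<Sum>s\<in>S. ddet A (B s))"
  using assms
proof (induction S rule: finite_induct)
  case empty
  then show ?case unfolding ddet_expand by simp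
qed (simp add: ddet_add)

definition cmat :: "real^'m^'n \<Rightarrow> complex^'m^'n" where
  "cmat A = (\<chi> i j. complex_of_real (A $ i $ j))"

lemma det_cmat: "det (cmat A) = of_real (det A)"
  by (simp add: cmat_def det_def)

lemma ddet_cmat: "ddet (cmat A) (cmat B) = of_real (ddet A B)"
  by (simp add: cmat_def ddet_expand)

text \<open>At a real matrix the derivative of \<open>det\<close> is a linear form with real
  coefficients, and such a form commutes with taking real parts.\<close>

lemma Re_ddet_cmat: "Re (ddet (cmat A) B) = ddet A (\<chi> i j. Re (B $ i $ j))"
proof -
  have "B = cmat (\<chi> i j. Re (B $ i $ j)) + (\<chi> i. \<i> *s cmat (\<chi> i j. Im (B $ i $ j)) $ i)"
    by (simp add: vec_eq_iff cmat_def complex_eq_iff)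
  then have "ddet (cmat A) B = ddet (cmat A) (cmat (\<chi> i j. Re (B $ i $ j))) +
     \<i> * ddet (cmat A) (cmat (\<chi> i j. Im (B $ i $ j)))"
    by (metis ddet_add ddet_scale)
  then show ?thesis by (simp add: ddet_cmat)
qed

text \<open>Characterises \<open>ddet\<close> as a derivative along a line. The product rules that
  follow then come from multiplicativity of \<open>det\<close> and uniqueness of derivatives,
  without expanding any determinant.\<close>

lemma det_line_derivative:
  fixes X Y :: "complex^'n^'n"
  shows "((\<lambda>t::real. det (\<chi> i j. X $ i $ j + of_real t * Y $ i $ j)) has_derivative
    (\<lambda>v. ddet X (\<chi> i j. of_real v * Y $ i $ j))) (at 0)"
proof -
  have "((\<lambda>t. X $ i $ j + of_real t * Y $ i $ j) has_derivative (\<lambda>v. of_real v * Y $ i $ j)) (at (0::real))" for i j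
    by (auto intro!: derivative_eq_intros)
  then have "((\<lambda>t::real. det (\<chi> i j. X $ i $ j + of_real t * Y $ i $ j)) has_derivative
    (\<lambda>v. ddet (\<chi> i j. X $ i $ j + of_real 0 * Y $ i $ j) (\<chi> i j. of_real v * Y $ i $ j))) (at 0)"
    by (intro det_has_derivative) simp
  then show ?thesis by simp
qed

lemma ddet_mult_right:
  fixes A :: "complex^'n^'n"
  shows "ddet (A ** B) (A' ** B) = ddet A A' * det B"
proof -
  note d = det_line_derivative
  have "(\<chi> i j. (A ** B) $ i $ j + of_real t * (A' ** B) $ i $ j) = (\<chi> i j. A $ i $ j + of_real t * A' $ i $ j) ** B" for t
    by (simp add: matrix_matrix_mult_def vec_eq_iff sum.distrib[symmetric] sum_distrib_left algebra_simps)
  then have "((\<lambda>t::real. det (\<chi> i j. (A ** B) $ i $ j + of_real t * (A' ** B) $ i $ j)) has_derivative (\<lambda>v. ddet A (\<chi> i j. of_real v * A' $ i $ j) * det B)) (at 0)"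
    using has_derivative_mult_left[OF d[of A A'], of "det B"] by (simp add: det_mul)
  from fun_cong[OF has_derivative_unique[OF d this], of 1]
  show ?thesis by simp
qed

lemma ddet_mult_left:
  fixes A :: "complex^'n^'n"
  shows "ddet (B ** A) (B ** A') = det B * ddet A A'"
proof -
  note d = det_line_derivative
  have "(\<chi> i j. (B ** A) $ i $ j + of_real t * (B ** A') $ i $ j) = B ** (\<chi> i j. A $ i $ j + of_real t * A' $ i $ j)" for t
    by (simp add: matrix_matrix_mult_def vec_eq_iff sum.distrib[symmetric] sum_distrib_left algebra_simps)
  then have "((\<lambda>t::real. det (\<chi> i j. (B ** A) $ i $ j + of_real t * (B ** A') $ i $ j)) has_derivative (\<lambda>v. det B * ddet A (\<chi> i j. of_real v * A' $ i $ j))) (at 0)"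
    using has_derivative_mult_right[OF d[of A A'], of "det B"] by (simp add: det_mul)
  from fun_cong[OF has_derivative_unique[OF d this], of 1]
  show ?thesis by simp
qed

section \<open>The forms in coordinates and Gram determinants\<close>

definition form_sign :: "nat \<Rightarrow> 'n::{finite,wellorder} \<Rightarrow> real" where
  "form_sign p j = (if j \<in> first_indices p then -1 else 1)"

lemma herm_form_sum: "herm_form p z w = (\<Sum>j\<in>UNIV. of_real (form_sign p j) * (z $ j * cnj (w $ j)))"
proof -
  have "(\<Sum>j\<in>UNIV. of_real (form_sign p j) * (z $ j * cnj (w $ j))) =
    (\<Sum>j\<in>first_indices p. of_real (form_sign p j) * (z $ j * cnj (w $ j))) +
    (\<Sum>j\<in>- first_indices p. of_real (form_sign p j) * (z $ j * cnj (w $ j)))"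
    by (subst sum.union_disjoint[symmetric]) (auto simp: Un_commute)
  also have "\<dots> = herm_form p z w"
    unfolding herm_form_def by (auto simp: form_sign_def sum_negf intro!: arg_cong2[where f="(+)"] sum.cong)
  finally show ?thesis by simp
qed

lemma real_form_sum: "real_form p x y = (\<Sum>j\<in>UNIV. form_sign p j * (x $ j * y $ j))"
proof -
  have "(\<Sum>j\<in>UNIV. form_sign p j * (x $ j * y $ j)) =
    (\<Sum>j\<in>first_indices p. form_sign p j * (x $ j * y $ j)) +
    (\<Sum>j\<in>- first_indices p. form_sign p j * (x $ j * y $ j))"
    by (subst sum.union_disjoint[symmetric]) (auto simp: Un_commute)
  also have "\<dots> = real_form p x y"
    unfolding real_form_def by (auto simp: form_sign_def sum_negf intro!: arg_cong2[where f="(+)"] sum.cong)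
  finally show ?thesis by simp
qed

lemma prod_form_sign: "(\<Prod>j\<in>S. form_sign p j) = 1 \<or> (\<Prod>j\<in>S. form_sign p j) = -1"
  by (induction S rule: infinite_finite_induct) (auto simp: form_sign_def)

text \<open>The Gram matrix is the product of \<open>A\<close>, the diagonal matrix of signs and the
  conjugate transpose of \<open>A\<close>.\<close>

lemma det_herm_gram:
  fixes A :: "complex^('n::{finite,wellorder})^('n::_)"
  shows "det (\<chi> i j. herm_form p (A $ i) (A $ j)) =
    of_real (\<Prod>j\<in>(UNIV :: ('n::_) set). form_sign p j) * (det A * cnj (det A))"
proof -
  have "(\<chi> i j. herm_form p (A $ i) (A $ j)) =
     A ** ((\<chi> i j. if i = j then of_real (form_sign p i) else 0) ** transpose (\<chi> i j. cnj (A $ i $ j)))"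
    by (simp add: vec_eq_iff matrix_matrix_mult_def transpose_def herm_form_sum if_distrib[of "\<lambda>x. x * _"] if_distrib[of "\<lambda>x. _ * x"] 
        ac_simps cong: if_cong)
  moreover have "det (\<chi> i j. cnj (A $ i $ j)) = cnj (det A)"
    by (simp add: det_def)
  moreover have "det (\<chi> i j. if i = j then complex_of_real (form_sign p i) else 0 :: complex^('n::_)^('n::_)) = (\<Prod>j\<in>(UNIV :: ('n::_) set). of_real (form_sign p j))"
    by (subst det_diagonal) auto
  ultimately show ?thesis by (simp add: det_mul)
qed

lemma sqrt_abs_has_derivative:
  fixes y :: real assumes "y \<noteq> 0"
  shows "((\<lambda>y. sqrt \<bar>y\<bar>) has_real_derivative sgn y / (2 * sqrt \<bar>y\<bar>)) (at y)"
proof (cases "y > 0")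
  case True
  have "(sqrt has_real_derivative sgn y / (2 * sqrt \<bar>y\<bar>)) (at y)"
    using DERIV_real_sqrt[OF True] True by (simp add: field_simps)
  then show ?thesis
    by (rule has_field_derivative_transform_within_open[of _ _ _ "{0<..}"]) (use True in auto)
next
  case False
  then have y: "y < 0" using assms by simp
  have "((\<lambda>y. sqrt (- y)) has_real_derivative sgn y / (2 * sqrt \<bar>y\<bar>)) (at y)"
    using y by (auto intro!: derivative_eq_intros simp: field_simps)
  then show ?thesis
    by (rule has_field_derivative_transform_within_open[of _ _ _ "{..<0}"]) (use y in auto)
qed

text \<open>The determinant of the Hermitian Gram matrix is real, equal to \<open>\<plusminus> \<bar>det A\<bar>\<^sup>2\<close>, for every
  \<open>t\<close>, while its entries are real only at \<open>t\<^sub>0\<close>. This suffices: there the derivative of the determinant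
  is linear in the entries with real coefficients, so that taking real parts of the entries does not
  change it.\<close>

lemma sqrt_det_metric_gram_derivative:
  fixes A :: "real \<Rightarrow> complex^'n::{finite,wellorder}^'n::_"
  assumes A: "\<And>i j. ((\<lambda>t. A t $ i $ j) has_vector_derivative A' $ i $ j) (at t\<^sub>0)"
    and lag: "\<And>i j. Im (herm_form p (A t\<^sub>0 $ i) (A t\<^sub>0 $ j)) = 0"
    and D: "det (A t\<^sub>0) \<noteq> 0"
  shows "((\<lambda>t. sqrt \<bar>det (\<chi> i j. metric p (A t $ i) (A t $ j))\<bar>) has_real_derivative
     Re (cnj (det (A t\<^sub>0)) * ddet (A t\<^sub>0) A') / cmod (det (A t\<^sub>0))) (at t\<^sub>0)"
proof -
  define \<sigma> where "\<sigma> = (\<Prod>j\<in>(UNIV :: ('n::_) set). form_sign p j)"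
  have \<sigma>: "\<sigma> \<in> {-1, 1}" using prod_form_sign[of p "UNIV :: ('n::_) set"] by (auto simp: \<sigma>_def)
  have detG: "det (\<chi> i j. herm_form p (B $ i) (B $ j)) = of_real \<sigma> * (det B * cnj (det B))"
    for B :: "complex^('n::_)^('n::_)"
    unfolding \<sigma>_def by (rule det_herm_gram)
  let ?D = "det (A t\<^sub>0)" and ?D' = "ddet (A t\<^sub>0) A'"
  define G where "G = (\<lambda>t. \<chi> i j. herm_form p (A t $ i) (A t $ j))"
  define G' where "G' = (\<chi> i j. \<Sum>k\<in>UNIV. of_real (form_sign p k) * (A' $ i $ k * cnj (A t\<^sub>0 $ j $ k) + A t\<^sub>0 $ i $ k * cnj (A' $ j $ k)))"
  have A_der: "((\<lambda>t. A t $ i $ j) has_derivative (\<lambda>v. v *\<^sub>R A' $ i $ j)) (at t\<^sub>0)" for i j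
    using A by (simp add: has_vector_derivative_def)
  have cA_der: "((\<lambda>t. cnj (A t $ i $ j)) has_derivative (\<lambda>v. v *\<^sub>R cnj (A' $ i $ j))) (at t\<^sub>0)" for i j
    using bounded_linear.has_derivative[OF bounded_linear_cnj A_der[of i j]] by simp
  have G_der: "((\<lambda>t. G t $ i $ j) has_derivative (\<lambda>v. v *\<^sub>R G' $ i $ j)) (at t\<^sub>0)" for i j
    unfolding G_def G'_def herm_form_sum
    by (auto intro!: derivative_eq_intros A_der cA_der simp: scaleR_sum_right) (simp add: fun_eq_iff scaleR_conv_of_real algebra_simps sum.distrib)
  have D_der: "((\<lambda>t. det (A t)) has_derivative (\<lambda>v. v *\<^sub>R ?D')) (at t\<^sub>0)"
  proof -
    have "((\<lambda>t. det (A t)) has_derivative (\<lambda>v. ddet (A t\<^sub>0) (\<chi> i. of_real v *s A' $ i))) (at t\<^sub>0)"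
      using A_der by (intro det_has_derivative) (simp add: scaleR_conv_of_real)
    then show ?thesis by (simp add: ddet_scale scaleR_conv_of_real)
  qed
  have cD_der: "((\<lambda>t. cnj (det (A t))) has_derivative (\<lambda>v. v *\<^sub>R cnj ?D')) (at t\<^sub>0)"
    using bounded_linear.has_derivative[OF bounded_linear_cnj D_der] by simp
  \<comment> \<open>The derivative from the product formula \<open>detG\<close>, which holds for
    every \<open>t\<close>. Comparing it with the derivative taken entry by entry determines
    \<open>ddet\<close> at the Gram matrix.\<close>
  have "((\<lambda>t. det (G t)) has_derivative (\<lambda>v. of_real \<sigma> * (v *\<^sub>R (?D' * cnj ?D + ?D * cnj ?D')))) (at t\<^sub>0)"
    unfolding G_def detG
    by (auto intro!: derivative_eq_intros D_der cD_der) (simp add: fun_eq_iff scaleR_conv_of_real algebra_simps)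
  moreover have "((\<lambda>t. det (G t)) has_derivative (\<lambda>v. ddet (G t\<^sub>0) (\<chi> i. of_real v *s G' $ i))) (at t\<^sub>0)"
    using G_der by (intro det_has_derivative) (simp add: scaleR_conv_of_real)
  ultimately have "(\<lambda>v::real. of_real \<sigma> * (v *\<^sub>R (?D' * cnj ?D + ?D * cnj ?D'))) = (\<lambda>v. ddet (G t\<^sub>0) (\<chi> i. of_real v *s G' $ i))"
    by (rule has_derivative_unique)
  from fun_cong[OF this, of 1]
  have ddG: "ddet (G t\<^sub>0) G' = of_real \<sigma> * (?D' * cnj ?D + ?D * cnj ?D')" by (simp add: ddet_scale)
  define R where "R = (\<lambda>t. \<chi> i j. metric p (A t $ i) (A t $ j))"
  \<comment> \<open>The Lagrangian condition enters here: at \<open>t\<^sub>0\<close> the Hermitian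
    Gram matrix coincides with the real one, so that \<open>Re_ddet_cmat\<close> applies.\<close>
  have G0: "G t\<^sub>0 = cmat (R t\<^sub>0)"
    using lag by (simp add: G_def R_def cmat_def vec_eq_iff complex_eq_iff metric_def)
  have "Re (ddet (G t\<^sub>0) G') = \<sigma> * (2 * Re (cnj ?D * ?D'))"
    unfolding ddG by (simp add: algebra_simps)
  then have ddR: "ddet (R t\<^sub>0) (\<chi> i j. Re (G' $ i $ j)) = \<sigma> * (2 * Re (cnj ?D * ?D'))"
    unfolding G0 Re_ddet_cmat .
  have "complex_of_real (det (R t\<^sub>0)) = of_real (\<sigma> * (cmod ?D)\<^sup>2)"
    using detG[of "A t\<^sub>0"] unfolding G_def[symmetric] 
    by (metis G0 G_def complex_norm_square det_cmat of_real_mult)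
  then have detR: "det (R t\<^sub>0) = \<sigma> * (cmod ?D)\<^sup>2" using of_real_eq_iff by blast
  have R_der: "((\<lambda>t. det (R t)) has_real_derivative \<sigma> * (2 * Re (cnj ?D * ?D'))) (at t\<^sub>0)"
  proof -
    have "((\<lambda>t. R t $ i $ j) has_derivative (\<lambda>v. v * Re (G' $ i $ j))) (at t\<^sub>0)" for i j
      using bounded_linear.has_derivative[OF bounded_linear_Re G_der[of i j]]
      by (simp add: R_def G_def metric_def)
    then have "((\<lambda>t. det (R t)) has_derivative (\<lambda>v. ddet (R t\<^sub>0) (\<chi> i. v *s (\<chi> i j. Re (G' $ i $ j)) $ i))) (at t\<^sub>0)"
      by (intro det_has_derivative) simp
    then show ?thesis
      unfolding ddet_scale ddR has_field_derivative_def
      by (rule has_derivative_eq_rhs) (simp add: fun_eq_iff)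
  qed
  have nz: "det (R t\<^sub>0) \<noteq> 0" using detR \<sigma> D by auto
  have "((\<lambda>t. sqrt \<bar>det (R t)\<bar>) has_real_derivative
     (sgn (det (R t\<^sub>0)) / (2 * sqrt \<bar>det (R t\<^sub>0)\<bar>)) * (\<sigma> * (2 * Re (cnj ?D * ?D')))) (at t\<^sub>0)"
    by (rule DERIV_chain2[OF sqrt_abs_has_derivative[OF nz] R_der])
  moreover have sq: "sqrt \<bar>det (R t\<^sub>0)\<bar> = cmod ?D" using \<sigma> by (auto simp: detR abs_mult)
  moreover have sg: "sgn (det (R t\<^sub>0)) = \<sigma>" using \<sigma> D by (auto simp: detR sgn_mult)
  moreover have "\<sigma> / (2 * d) * (\<sigma> * (2 * x)) = x / d" for d x :: real using \<sigma> by auto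
  ultimately have "((\<lambda>t. sqrt \<bar>det (R t)\<bar>) has_real_derivative Re (cnj ?D * ?D') / cmod ?D) (at t\<^sub>0)"
    by (simp only:)
  then show ?thesis by (simp only: R_def)
qed

section \<open>Complex Jacobians and the variation density\<close>

text \<open>The rows are the partial derivatives, so this is the transpose of the usual Jacobian. It
  is a square complex matrix since the real dimension of the domain equals the complex dimension of
  the target.\<close>

definition jac :: "(real^'n \<Rightarrow> complex^'n) \<Rightarrow> real^'n \<Rightarrow> complex^'n^'n" where
  "jac h u = (\<chi> j. frechet_derivative h (at u) (axis j 1))"

lemma jac_nth [simp]: "jac h u $ j = frechet_derivative h (at u) (axis j 1)"
  by (simp add: jac_def)

definition variation_density :: "(real^'n \<Rightarrow> complex^'n) \<Rightarrow> (real^'n \<Rightarrow> complex^'n) \<Rightarrow> real^'n \<Rightarrow> real" where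
  "variation_density h V u = Re (cnj (det (jac h u)) * ddet (jac h u) (jac V u)) / cmod (det (jac h u))"

lemma linear_axis_expansion:
  fixes L :: "real^'n \<Rightarrow> 'b::real_normed_vector"
  assumes "linear L" shows "L v = (\<Sum>i\<in>UNIV. v $ i *\<^sub>R L (axis i 1))"
proof -
  have "L v = L (\<Sum>i\<in>UNIV. v $ i *\<^sub>R axis i 1)"
    using basis_expansion[of v] by (simp add: scalar_mult_eq_scaleR)
  also have "\<dots> = (\<Sum>i\<in>UNIV. v $ i *\<^sub>R L (axis i 1))"
    using assms by (simp add: linear_sum linear_cmul)
  finally show ?thesis .
qed

lemma jac_compose:
  assumes "h differentiable at (\<tau> u)" "(\<tau> has_derivative \<tau>') (at u)"
  shows "jac (\<lambda>x. h (\<tau> x)) u = cmat (transpose (matrix \<tau>')) ** jac h (\<tau> u)"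
proof -
  let ?h' = "frechet_derivative h (at (\<tau> u))"
  have h: "(h has_derivative ?h') (at (\<tau> u))" using assms(1) frechet_derivative_works by blast
  have "frechet_derivative (\<lambda>x. h (\<tau> x)) (at u) = (\<lambda>v. ?h' (\<tau>' v))"
    by (rule frechet_derivative_eqI[OF has_derivative_compose[OF assms(2) h]])
  moreover have "?h' (\<tau>' (axis j 1)) = (\<Sum>i\<in>UNIV. \<tau>' (axis j 1) $ i *\<^sub>R ?h' (axis i 1))" for j
    using has_derivative_linear[OF h] by (rule linear_axis_expansion)
  ultimately show ?thesis
    by (simp add: vec_eq_iff cmat_def matrix_matrix_mult_def transpose_def matrix_def scaleR_conv_of_real[where 'a=complex])
qed

text \<open>Both determinants pick up the real factor b = det \<tau>'. The numerator gets b^2 and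
  the denominator |b|, so that the quotient transforms like a density.\<close>

lemma variation_density_compose:
  fixes h V :: "real^'n \<Rightarrow> complex^'n"
  assumes "h differentiable at (\<tau> u)" "V differentiable at (\<tau> u)" "(\<tau> has_derivative \<tau>') (at u)"
  shows "variation_density (\<lambda>x. h (\<tau> x)) (\<lambda>x. V (\<tau> x)) u = \<bar>det (matrix \<tau>')\<bar> * variation_density h V (\<tau> u)"
proof -
  have *: "Re (cnj (of_real b * D) * (of_real b * X)) / cmod (of_real b * D) = \<bar>b\<bar> * (Re (cnj D * X) / cmod D)"
    for b :: real and D X
  proof -
    have "cnj (of_real b * D) * (of_real b * X) = of_real (b\<^sup>2) * (cnj D * X)"
      by (simp add: power2_eq_square)
    then have "Re (cnj (of_real b * D) * (of_real b * X)) / cmod (of_real b * D) =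
        (b\<^sup>2 / \<bar>b\<bar>) * (Re (cnj D * X) / cmod D)"
      by (simp only: norm_mult norm_of_real times_divide_times_eq times_complex.sel Re_complex_of_real Im_complex_of_real mult_zero_left diff_zero)
    also have "b\<^sup>2 / \<bar>b\<bar> = \<bar>b\<bar>"
      by (cases "b = 0") (simp_all add: power2_eq_square abs_if)
    finally show ?thesis .
  qed
  show ?thesis
    unfolding variation_density_def jac_compose[of h, OF assms(1,3)] jac_compose[of V, OF assms(2,3)] ddet_mult_left det_mul det_cmat det_transpose
    by (rule *)
qed

text \<open>By symmetry of second derivatives, differentiating the k-th partial derivative in
  direction j is the same as differentiating row j in direction k; summed over the rows this gives
  the derivative of the determinant. The derivatives of \<open>b\<close> put a multiple of row k
  into row j, which counts only for j = k. As \<open>b\<close> is complex, tangent fields and their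
  multiples by \<i> are treated together.\<close>

lemma ddet_jac_tangential:
  fixes h :: "real^'n \<Rightarrow> complex^'n" and b :: "real^'n \<Rightarrow> complex"
  assumes U: "open U" "u \<in> U" and h: "ck_on (Suc (Suc 0)) U h" and b: "b differentiable at u"
  shows "ddet (jac h u) (jac (\<lambda>x. b x *s frechet_derivative h (at x) (axis k 1)) u) =
     frechet_derivative (\<lambda>x. b x * det (jac h x)) (at u) (axis k 1)"
proof -
  let ?J = "\<lambda>k x. frechet_derivative h (at x) (axis k 1)"
  let ?b' = "frechet_derivative b (at u)"
  have b': "(b has_derivative ?b') (at u)" using b frechet_derivative_works by blast
  have h1: "ck_on (Suc 0) U (?J j)" for j using h by simp
  have J': "(?J j has_derivative frechet_derivative (?J j) (at u)) (at u)" for j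
    by (rule ck_on_has_derivative[OF h1 U(2)])
  have sym: "frechet_derivative (?J k) (at u) (axis j 1) = frechet_derivative (?J j) (at u) (axis k 1)" for j
    by (rule symmetric_second_derivative[OF U h])
  have "((\<lambda>x. b x *s ?J k x) has_derivative (\<lambda>v. b u *s frechet_derivative (?J k) (at u) v + ?b' v *s ?J k u)) (at u)"
  proof (subst has_derivative_componentwise_within, rule ballI)
    fix i :: "complex^'n" assume "i \<in> Basis"
    have nth: "((\<lambda>x. ?J k x $ m) has_derivative (\<lambda>v. frechet_derivative (?J k) (at u) v $ m)) (at u)" for m
      by (rule bounded_linear.has_derivative[OF bounded_linear_vec_nth J'])
    show "((\<lambda>x. (b x *s ?J k x) \<bullet> i) has_derivative (\<lambda>v. (b u *s frechet_derivative (?J k) (at u) v + ?b' v *s ?J k u) \<bullet> i)) (at u)"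
      unfolding inner_vec_def
      by (auto intro!: derivative_eq_intros b' nth)
  qed
  then have jacW: "jac (\<lambda>x. b x *s ?J k x) u = (\<chi> j. ?b' (axis j 1) *s ?J k u) + (\<chi> j. b u *s (\<chi> j. frechet_derivative (?J j) (at u) (axis k 1)) $ j)"
    using sym by (simp add: jac_def frechet_derivative_eqI vec_eq_iff)
  have "det (\<chi> i. if i = j then ?b' (axis i 1) *s ?J k u else jac h u $ i) = (if j = k then ?b' (axis k 1) * det (jac h u) else 0)" for j
  proof -
    have "det (\<chi> i. if i = j then ?b' (axis i 1) *s ?J k u else jac h u $ i) =
      det (\<chi> i. if i = j then ?b' (axis j 1) *s ?J k u else jac h u $ i)"
      by (rule arg_cong[of _ _ det]) (simp add: vec_eq_iff)
    also have "\<dots> = ?b' (axis j 1) * det (\<chi> i. if i = j then ?J k u else jac h u $ i)"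
      by (rule det_row_mul)
    also have "\<dots> = (if j = k then ?b' (axis k 1) * det (jac h u) else 0)"
    proof (cases "j = k")
      case True
      have "(\<chi> i. if i = k then ?J k u else jac h u $ i) = jac h u"
        by (simp add: vec_eq_iff)
      then show ?thesis using True by simp
    next
      case False
      have "det (\<chi> i. if i = j then ?J k u else jac h u $ i) = 0"
        by (rule det_identical_rows[OF False]) (use False in \<open>simp add: row_def vec_eq_iff\<close>)
      then show ?thesis using False by simp
    qed
    finally show ?thesis .
  qed
  then have 1: "ddet (jac h u) (\<chi> j. ?b' (axis j 1) *s ?J k u) = ?b' (axis k 1) * det (jac h u)"
    unfolding ddet_def vec_lambda_beta by simp
  have D': "((\<lambda>x. det (jac h x)) has_derivative (\<lambda>v. ddet (jac h u) (\<chi> j. frechet_derivative (?J j) (at u) v))) (at u)"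
    by (rule det_has_derivative) (simp add: bounded_linear.has_derivative[OF bounded_linear_vec_nth J'])
  have "frechet_derivative (\<lambda>x. b x * det (jac h x)) (at u) = (\<lambda>v. b u * ddet (jac h u) (\<chi> j. frechet_derivative (?J j) (at u) v) + ?b' v * det (jac h u))"
    by (rule frechet_derivative_eqI[OF has_derivative_mult[OF b' D']])
  then show ?thesis
    unfolding jacW ddet_add ddet_scale 1 by simp
qed

section \<open>Parametrizations and Lagrangian frames\<close>

lemma local_parametrizationD:
  assumes "local_parametrization X W \<phi>"
  shows "open W" "smooth_on W \<phi>" "\<phi> ` W \<subseteq> X" "openin (top_of_set X) (\<phi> ` W)" "inj_on \<phi> W" "ck_on k W \<phi>"
    "continuous_on W \<phi>"
proof -
  show "open W" "smooth_on W \<phi>" "openin (top_of_set X) (\<phi> ` W)"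
    using assms unfolding local_parametrization_def by blast+
  then show "\<phi> ` W \<subseteq> X" "ck_on k W \<phi>" "continuous_on W \<phi>"
    by (auto dest: openin_imp_subset intro: smooth_on_openD smooth_on_continuous_on)
  obtain \<psi> where "homeomorphism W (\<phi> ` W) \<phi> \<psi>"
    using assms unfolding local_parametrization_def by blast
  then show "inj_on \<phi> W"
    by (intro inj_on_inverseI[of _ \<psi>]) (rule homeomorphism_apply1)
qed

lemma ck_on_comp_parametrization:
  fixes f :: "'a::euclidean_space \<Rightarrow> 'b::euclidean_space"
  assumes "smooth_on X f" "local_parametrization X W \<phi>"
  shows "ck_on k W (f \<circ> \<phi>)"
  unfolding o_def
  by (rule smooth_on_openD[OF local_parametrizationD(1)[OF assms(2)]])
    (rule smooth_on_compose[OF local_parametrizationD(2)[OF assms(2)] assms(1) local_parametrizationD(3)[OF assms(2)]])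

lemma frechet_derivative_cong_open:
  assumes "open U" "u \<in> U" "\<And>x. x \<in> U \<Longrightarrow> f x = g x"
  shows "frechet_derivative f (at u) = frechet_derivative g (at u)"
proof -
  have "(f has_derivative f') (at u) \<longleftrightarrow> (g has_derivative f') (at u)" for f'
    using has_derivative_transform_within_open[OF _ assms(1,2), of f f' UNIV g]
      has_derivative_transform_within_open[OF _ assms(1,2), of g f' UNIV f] assms(3) by auto
  then show ?thesis unfolding frechet_derivative_def by simp
qed

lemma jac_cong: "open U \<Longrightarrow> u \<in> U \<Longrightarrow> (\<And>x. x \<in> U \<Longrightarrow> f x = g x) \<Longrightarrow> jac f u = jac g u"
  unfolding jac_def by (metis frechet_derivative_cong_open)

lemma variation_density_cong:
  assumes "open U" "u \<in> U" "\<And>x. x \<in> U \<Longrightarrow> f x = g x" "\<And>x. x \<in> U \<Longrightarrow> V x = V' x"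
  shows "variation_density f V u = variation_density g V' u"
  unfolding variation_density_def using jac_cong[OF assms(1,2,3)] jac_cong[OF assms(1,2,4)] by simp

lemma variation_density_zero:
  assumes "open U" "u \<in> U" "\<And>x. x \<in> U \<Longrightarrow> V x = 0"
  shows "variation_density f V u = 0"
proof -
  have "jac V u = jac (\<lambda>x. 0) u" by (rule jac_cong[OF assms])
  also have "\<dots> = 0" by (simp add: jac_def vec_eq_iff)
  finally show ?thesis unfolding variation_density_def ddet_expand by simp
qed

lemma ck_on_jac: "open U \<Longrightarrow> ck_on (Suc k) U h \<Longrightarrow> ck_on k U (\<lambda>u. jac h u $ i $ j)"
  by (simp add: ck_on_nth)

lemma ck_on_metric:
  assumes "open U" "ck_on k U a" "ck_on k U b"
  shows "ck_on k U (\<lambda>x. metric p (a x) (b x))"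
  unfolding metric_def herm_form_sum
  by (intro ck_on_bounded_linear[OF bounded_linear_Re] ck_on_sum ck_on_mult ck_on_const ck_on_nth
      ck_on_bounded_linear[OF bounded_linear_cnj] assms)

lemma det_gram_lagrangian:
  fixes A :: "complex^('n::{finite,wellorder})^('n::_)"
  assumes "\<And>i j. Im (herm_form p (A $ i) (A $ j)) = 0"
  shows "\<bar>det (\<chi> i j. metric p (A $ i) (A $ j))\<bar> = (cmod (det A))\<^sup>2"
proof -
  define \<sigma> where "\<sigma> = (\<Prod>j\<in>(UNIV :: ('n::_) set). form_sign p j)"
  have \<sigma>: "\<bar>\<sigma>\<bar> = 1" using prod_form_sign[of p "UNIV :: ('n::_) set"] by (auto simp: \<sigma>_def)
  have "(\<chi> i j. herm_form p (A $ i) (A $ j)) = cmat (\<chi> i j. metric p (A $ i) (A $ j))"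
    using assms by (simp add: cmat_def vec_eq_iff complex_eq_iff metric_def)
  then have "complex_of_real (det (\<chi> i j. metric p (A $ i) (A $ j))) = of_real \<sigma> * (det A * cnj (det A))"
    using det_herm_gram[of p A] by (simp only: det_cmat \<sigma>_def)
  then have "cmod (complex_of_real (det (\<chi> i j. metric p (A $ i) (A $ j)))) = cmod (of_real \<sigma> * (det A * cnj (det A)))"
    by (rule arg_cong)
  then show ?thesis using \<sigma> by (simp add: norm_mult power2_eq_square)
qed

text \<open>Both sides say that the real Gram matrix is invertible: for a Lagrangian
  \<open>L\<close> its determinant is, up to sign, the squared modulus of the complex
  determinant.\<close>

lemma lagrangian_nondegenerate_iff:
  fixes L :: "real^('n::{finite,wellorder}) \<Rightarrow> complex^('n::_)"
  assumes L: "linear L" and lag: "\<And>v w. Im (herm_form p (L v) (L w)) = 0"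
  shows "(\<forall>v. (\<forall>w. metric p (L v) (L w) = 0) \<longrightarrow> v = 0) \<longleftrightarrow> det (\<chi> j. L (axis j 1)) \<noteq> 0"
proof -
  define g :: "real^('n::_)^('n::_)" where "g = transpose (\<chi> i j. metric p (L (axis i 1)) (L (axis j 1)))"
  have bil: "metric p (\<Sum>i\<in>UNIV. a i *\<^sub>R x i) y = (\<Sum>i\<in>UNIV. a i * metric p (x i) y)"
      "metric p y (\<Sum>i\<in>UNIV. a i *\<^sub>R x i) = (\<Sum>i\<in>UNIV. a i * metric p y (x i))"
    for a :: "('n::_) \<Rightarrow> real" and x :: "('n::_) \<Rightarrow> complex^('n::_)" and y
    unfolding metric_def herm_form_sum 
    by (simp_all add: sum_distrib_left sum_distrib_right Re_sum Re_divide_numeral) 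
      (subst sum.swap, simp add: algebra_simps sum_distrib_left sum.distrib sum_subtractf)+
  have gv: "(g *v v) $ j = metric p (L v) (L (axis j 1))" for v j
    unfolding linear_axis_expansion[OF L, of v] bil
    by (simp add: matrix_vector_mult_def transpose_def g_def mult.commute)
  have "(\<forall>w. metric p (L v) (L w) = 0) \<longleftrightarrow> g *v v = 0" for v
  proof
    assume "\<forall>w. metric p (L v) (L w) = 0"
    then show "g *v v = 0" by (simp add: vec_eq_iff gv)
  next
    assume "g *v v = 0"
    then have *: "metric p (L v) (L (axis j 1)) = 0" for j using gv[of v j] by simp
    show "\<forall>w. metric p (L v) (L w) = 0"
    proof
      fix w show "metric p (L v) (L w) = 0"
        unfolding linear_axis_expansion[OF L, of w] bil * by simp
    qed
  qed
  then have "(\<forall>v. (\<forall>w. metric p (L v) (L w) = 0) \<longrightarrow> v = 0) \<longleftrightarrow> (\<forall>v. g *v v = 0 \<longrightarrow> v = 0)"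
    by simp
  also have "\<dots> \<longleftrightarrow> invertible g"
    by (simp add: invertible_left_inverse matrix_left_invertible_ker)
  also have "\<dots> \<longleftrightarrow> det g \<noteq> 0" by (simp add: invertible_det_nz)
  also have "\<dots> \<longleftrightarrow> det (\<chi> j. L (axis j 1)) \<noteq> 0"
  proof -
    have "\<bar>det g\<bar> = (cmod (det (\<chi> j. L (axis j 1))))\<^sup>2"
      unfolding g_def det_transpose using det_gram_lagrangian[of p "\<chi> j. L (axis j 1)"] lag by simp
    then show ?thesis by auto
  qed
  finally show ?thesis .
qed

section \<open>Variation fields and the derivative of the volume\<close>

definition variation_field :: "(real \<Rightarrow> 'a \<Rightarrow> 'b::real_normed_vector) \<Rightarrow> 'a \<Rightarrow> 'b" where
  "variation_field F x = vector_derivative (\<lambda>t. F t x) (at 0)"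

lemma variation_field_ck:
  fixes H :: "real \<times> 'a::real_normed_vector \<Rightarrow> 'b::real_normed_vector"
  assumes "open U" "(0, y) \<in> U" "ck_on (Suc k) U H" "\<And>t. (t, y) \<in> U \<Longrightarrow> F t y = H (t, y)"
  shows "variation_field F y = frechet_derivative H (at (0, y)) (1, 0)"
proof -
  let ?H' = "frechet_derivative H (at (0, y))"
  have d: "(H has_derivative ?H') (at (0, y))" using ck_on_has_derivative[OF assms(3,2)] .
  have "((\<lambda>t. H (t, y)) has_derivative (\<lambda>h. ?H' (h, 0))) (at 0)"
    by (rule has_derivative_compose[of "\<lambda>t. (t, y)", OF _ d]) (auto intro!: derivative_eq_intros)
  moreover have "?H' (h, 0) = h *\<^sub>R ?H' (1, 0)" for h
    using linear_cmul[OF has_derivative_linear[OF d], of h "(1, 0)"] by simp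
  then have "(\<lambda>h. ?H' (h, 0)) = (\<lambda>h. h *\<^sub>R ?H' (1, 0))" by (rule ext)
  ultimately have "((\<lambda>t. H (t, y)) has_vector_derivative ?H' (1, 0)) (at 0)"
    unfolding has_vector_derivative_def by (rule has_derivative_eq_rhs)
  moreover have "open ((\<lambda>t. (t, y)) -` U)"
    by (rule open_vimage[OF assms(1)]) (intro continuous_intros)
  ultimately have "((\<lambda>t. F t y) has_vector_derivative ?H' (1, 0)) (at 0)"
    by (rule has_vector_derivative_transform_within_open) (use assms in auto)
  then show ?thesis unfolding variation_field_def by (rule vector_derivative_at)
qed

text \<open>As \<open>X\<close> need not be open, smoothness of the variation only means local
  extensions \<open>H\<close> to open sets. The \<open>t\<close>-derivative of \<open>H\<close>
  along \<open>t = 0\<close> is then an extension of the field.\<close>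

lemma smooth_on_variation_field:
  fixes F :: "real \<Rightarrow> 'a::euclidean_space \<Rightarrow> 'b::euclidean_space"
  assumes F: "smooth_on ({-\<delta><..<\<delta>} \<times> X) (\<lambda>(t, x). F t x)" and \<delta>: "\<delta> > 0"
  shows "smooth_on X (variation_field F)"
proof (rule smooth_on_extensionI)
  fix x assume x: "x \<in> X"
  have "(0, x) \<in> {-\<delta><..<\<delta>} \<times> X" using x \<delta> by simp
  then obtain U H where U: "open U" "(0, x) \<in> U" "\<forall>k. ck_on k U H"
    "\<forall>z\<in>{-\<delta><..<\<delta>} \<times> X. z \<in> U \<longrightarrow> H z = (\<lambda>(t, x). F t x) z"
    by (rule smooth_onE[OF F])
  \<comment> \<open>\<open>H\<close> agrees with \<open>F\<close> only for parameters in the given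
    interval.\<close>
  define U' where "U' = U \<inter> {-\<delta><..<\<delta>} \<times> UNIV"
  have U': "open U'" unfolding U'_def by (intro open_Int U open_Times) auto
  define W where "W = Pair 0 -` U'"
  have W: "open W" unfolding W_def by (rule open_vimage[OF U']) (intro continuous_intros)
  define V where "V y = frechet_derivative H (at (0, y)) (1, 0)" for y
  have "ck_on k W V" for k
    unfolding V_def
  proof (rule ck_on_compose[OF W U(1), of k "\<lambda>y. (0, y)"])
    show "ck_on k U (\<lambda>z. frechet_derivative H (at z) (1, 0))"
      using U(3)[rule_format, of "Suc k"] by simp
    show "ck_on k W (\<lambda>y. (0, y))" by (intro ck_on_Pair ck_on_const ck_on_ident W)
  qed (auto simp: W_def U'_def)
  moreover have "V y = variation_field F y" if "y \<in> X" "y \<in> W" for y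
  proof -
    have "(0, y) \<in> U'" using that by (simp add: W_def)
    then have "variation_field F y = frechet_derivative H (at (0, y)) (1, 0)"
      using that U(4)
      by (intro variation_field_ck[OF U' _ ck_on_subset[OF U(3)[rule_format, of "Suc 0"]]]) (auto simp: U'_def)
    then show ?thesis by (simp add: V_def)
  qed
  moreover have "x \<in> W" using U \<delta> by (simp add: W_def U'_def)
  ultimately show "\<exists>U g. open U \<and> x \<in> U \<and> (\<forall>k. ck_on k U g) \<and> (\<forall>y. y \<in> X \<longrightarrow> y \<in> U \<longrightarrow> g y = variation_field F y)"
    using W by (intro exI[of _ W] exI[of _ V]) simp
qed

text \<open>The closure of \<open>B\<close> is a compact subset of \<open>W\<close>, which permits
  differentiation under the integral. Pointwise the derivative is given by
  \<open>sqrt_det_metric_gram_derivative\<close>, which requires the Lagrangian condition at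
  \<open>t = 0\<close> only.\<close>

lemma volume_piece_derivative:
  fixes F :: "real \<Rightarrow> 'a::euclidean_space \<Rightarrow> complex^('n::{finite,wellorder})"
  assumes F: "smooth_on ({-\<delta><..<\<delta>} \<times> X) (\<lambda>(t, x). F t x)" and \<delta>: "\<delta> > 0"
    and f: "\<And>x. x \<in> X \<Longrightarrow> F 0 x = f x"
    and \<phi>: "local_parametrization X W \<phi>"
    and lag: "\<And>u i j. u \<in> W \<Longrightarrow> Im (herm_form p (jac (f \<circ> \<phi>) u $ i) (jac (f \<circ> \<phi>) u $ j)) = 0"
    and D: "\<And>u. u \<in> W \<Longrightarrow> det (jac (f \<circ> \<phi>) u) \<noteq> 0"
    and B: "B \<in> sets borel" "bounded B" "closure B \<subseteq> W"
  shows "((\<lambda>t. LINT u:B|lborel. sqrt \<bar>det (gram_matrix p (F t \<circ> \<phi>) u)\<bar>) has_real_derivative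
    (LINT u:B|lborel. variation_density (f \<circ> \<phi>) (variation_field F \<circ> \<phi>) u)) (at 0)"
proof -
  note W = local_parametrizationD(1)[OF \<phi>]
  define \<Omega>\<^sub>0 where "\<Omega>\<^sub>0 = {-\<delta><..<\<delta>} \<times> W"
  have \<Omega>\<^sub>0: "open \<Omega>\<^sub>0" unfolding \<Omega>\<^sub>0_def by (intro open_Times W) auto
  define H where "H z = F (fst z) (\<phi> (snd z))" for z
  have H: "ck_on k \<Omega>\<^sub>0 H" for k
  proof (rule smooth_on_openD[OF \<Omega>\<^sub>0])
    have s: "smooth_on \<Omega>\<^sub>0 (\<lambda>z. (fst z, \<phi> (snd z)))"
      by (intro smooth_on_Pair smooth_on_fst smooth_on_ident
          smooth_on_compose[OF smooth_on_snd[OF smooth_on_ident] local_parametrizationD(2)[OF \<phi>]])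
        (auto simp: \<Omega>\<^sub>0_def)
    have "smooth_on \<Omega>\<^sub>0 (\<lambda>z. (\<lambda>(t, x). F t x) (fst z, \<phi> (snd z)))"
      by (rule smooth_on_compose[OF s F]) (use local_parametrizationD(3)[OF \<phi>] in \<open>auto simp: \<Omega>\<^sub>0_def\<close>)
    then show "smooth_on \<Omega>\<^sub>0 H" by (simp add: H_def[abs_def])
  qed
  define J :: "real \<times> (real^('n::_)) \<Rightarrow> complex^('n::_)^('n::_)"
    where "J z = (\<chi> j. frechet_derivative H (at z) (0, axis j 1))" for z
  have J: "ck_on k \<Omega>\<^sub>0 (\<lambda>z. J z $ j)" for k j
    using H[of "Suc k"] by (simp add: J_def)
  have jacJ: "jac (F t \<circ> \<phi>) u = J (t, u)" if "(t, u) \<in> \<Omega>\<^sub>0" for t u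
  proof -
    have "((\<lambda>u. H (t, u)) has_derivative (\<lambda>v. frechet_derivative H (at (t, u)) (0, v))) (at u)"
      by (rule has_derivative_compose[of "\<lambda>u. (t, u)", OF _ ck_on_has_derivative[OF H that]])
        (auto intro!: derivative_eq_intros)
    then show ?thesis
      unfolding jac_def J_def by (simp add: frechet_derivative_eqI H_def o_def)
  qed
  have zero_in: "(0, u) \<in> \<Omega>\<^sub>0" if "u \<in> W" for u using that \<delta> by (simp add: \<Omega>\<^sub>0_def)
  have jacf: "jac (f \<circ> \<phi>) u = J (0, u)" if "u \<in> W" for u
  proof -
    have "jac (f \<circ> \<phi>) u = jac (F 0 \<circ> \<phi>) u"
      by (rule jac_cong[OF W that]) (use f local_parametrizationD(3)[OF \<phi>] in auto)
    then show ?thesis using jacJ[OF zero_in[OF that]] by simp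
  qed
  define w where "w z = det (\<chi> i j. metric p (J z $ i) (J z $ j))" for z
  have w: "ck_on k \<Omega>\<^sub>0 w" for k
    unfolding w_def by (intro ck_on_det \<Omega>\<^sub>0) (simp add: ck_on_metric[OF \<Omega>\<^sub>0 J J])
  \<comment> \<open>Away from the zeros of the Gram determinant \<open>sqrt \<bar>w\<bar>\<close> is
    continuously differentiable; the slice at \<open>t = 0\<close> belongs to this set since
    \<open>f\<close> has nonvanishing complex determinant.\<close>
  define \<Omega> where "\<Omega> = \<Omega>\<^sub>0 \<inter> w -` (- {0})"
  have \<Omega>: "open \<Omega>" unfolding \<Omega>_def
    by (rule continuous_open_preimage[OF _ \<Omega>\<^sub>0]) (use w[of 0] in auto)
  have in\<Omega>: "(0, u) \<in> \<Omega>" if "u \<in> W" for u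
  proof -
    have "\<bar>w (0, u)\<bar> = (cmod (det (J (0, u))))\<^sup>2"
      unfolding w_def by (rule det_gram_lagrangian) (use lag[OF that] jacf[OF that] in simp)
    then have "w (0, u) \<noteq> 0" using D[OF that] jacf[OF that] by auto
    then show ?thesis using zero_in[OF that] by (simp add: \<Omega>_def)
  qed
  define g where "g z = sqrt \<bar>w z\<bar>" for z
  have g: "ck_on (Suc 0) \<Omega> g"
    unfolding g_def
  proof (rule ck_on_compose[OF \<Omega>, of "- {0}" _ w])
    show "ck_on (Suc 0) \<Omega> w" by (rule ck_on_subset[OF w]) (auto simp: \<Omega>_def)
    show "ck_on (Suc 0) (- {0}) (\<lambda>y. sqrt \<bar>y :: real\<bar>)"
    proof (rule ck_on_real[OF _ sqrt_abs_has_derivative])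
      have "continuous_on (- {0}) (sgn :: real \<Rightarrow> real)"
        by (auto intro!: continuous_at_imp_continuous_on isCont_sgn)
      then show "ck_on 0 (- {0}) (\<lambda>x. sgn x / (2 * sqrt \<bar>x :: real\<bar>))"
        by (auto intro!: continuous_intros)
    qed auto
  qed (auto simp: \<Omega>_def)
  have der: "((\<lambda>t. LINT u:B|lborel. g (t, u)) has_real_derivative
     (LINT u:B|lborel. frechet_derivative g (at (0, u)) (1, 0))) (at 0)"
    by (rule set_integral_has_derivative[OF \<Omega> g, of "closure B"])
      (use B in\<Omega> closure_subset in \<open>auto simp: compact_closure\<close>)
  have "frechet_derivative g (at (0, u)) (1, 0) = variation_density (f \<circ> \<phi>) (variation_field F \<circ> \<phi>) u" if "u \<in> B" for u
  proof -
    have u: "u \<in> W" using that B closure_subset by blast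
    note z = zero_in[OF u]
    define A' :: "complex^('n::_)^('n::_)" where
      "A' = (\<chi> j. frechet_derivative (\<lambda>z. frechet_derivative H (at z) (0, axis j 1)) (at (0, u)) (1, 0))"
    have A': "((\<lambda>t. J (t, u) $ i $ j) has_vector_derivative A' $ i $ j) (at 0)" for i j
    proof -
      let ?P = "\<lambda>z. frechet_derivative H (at z) (0, axis i 1)"
      have P1: "ck_on (Suc 0) \<Omega>\<^sub>0 ?P" using H[of "Suc (Suc 0)"] by simp
      have d: "(?P has_derivative frechet_derivative ?P (at (0, u))) (at (0, u))"
        by (rule ck_on_has_derivative[OF P1 z])
      have "((\<lambda>t. ?P (t, u)) has_derivative (\<lambda>h. frechet_derivative ?P (at (0, u)) (h, 0))) (at 0)"
        by (rule has_derivative_compose[of "\<lambda>t. (t, u)", OF _ d]) (auto intro!: derivative_eq_intros)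
      moreover have "frechet_derivative ?P (at (0, u)) (h, 0) = h *\<^sub>R frechet_derivative ?P (at (0, u)) (1, 0)" for h
        using linear_cmul[OF has_derivative_linear[OF d], of h "(1, 0)"] by simp
      then have "(\<lambda>h. frechet_derivative ?P (at (0, u)) (h, 0)) = (\<lambda>h. h *\<^sub>R frechet_derivative ?P (at (0, u)) (1, 0))"
        by (rule ext)
      ultimately have "((\<lambda>t. ?P (t, u)) has_vector_derivative frechet_derivative ?P (at (0, u)) (1, 0)) (at 0)"
        unfolding has_vector_derivative_def by (rule has_derivative_eq_rhs)
      from bounded_linear.has_vector_derivative[OF bounded_linear_vec_nth this, of j]
      show ?thesis by (simp add: J_def A'_def)
    qed
    \<comment> \<open>The \<open>t\<close>-derivative of the Jacobian is the Jacobian of the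
      \<open>t\<close>-derivative, again by symmetry of second derivatives, now of \<open>H\<close>
      in the directions \<open>(1, 0)\<close> and \<open>(0, axis j 1)\<close>.\<close>
    have jacV: "jac (variation_field F \<circ> \<phi>) u = A'"
    proof -
      let ?V = "\<lambda>u. frechet_derivative H (at (0, u)) (1, 0)"
      let ?Q = "\<lambda>z. frechet_derivative H (at z) (1, 0)"
      have "jac (variation_field F \<circ> \<phi>) u = jac ?V u"
      proof (rule jac_cong[OF W u])
        fix y assume "y \<in> W"
        from zero_in[OF this] have "variation_field (\<lambda>t. F t \<circ> \<phi>) y = ?V y"
          by (rule variation_field_ck[OF \<Omega>\<^sub>0 _ H]) (simp add: H_def)
        then show "(variation_field F \<circ> \<phi>) y = ?V y"
          by (simp add: variation_field_def)
      qed
      also have "\<dots> = A'"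
      proof -
        have Q1: "ck_on (Suc 0) \<Omega>\<^sub>0 ?Q" using H[of "Suc (Suc 0)"] by simp
        have "(?V has_derivative (\<lambda>v. frechet_derivative ?Q (at (0, u)) (0, v))) (at u)"
          by (rule has_derivative_compose[of "\<lambda>u. (0, u)", OF _ ck_on_has_derivative[OF Q1 z]])
            (auto intro!: derivative_eq_intros)
        moreover have "frechet_derivative ?Q (at (0, u)) (0, axis j 1) = A' $ j" for j
          unfolding A'_def by (simp add: symmetric_second_derivative[OF \<Omega>\<^sub>0 z H])
        ultimately show ?thesis unfolding jac_def by (simp add: frechet_derivative_eqI vec_eq_iff)
      qed
      finally show ?thesis .
    qed
    have "((\<lambda>t. g (t, u)) has_real_derivative Re (cnj (det (J (0, u))) * ddet (J (0, u)) A') / cmod (det (J (0, u)))) (at 0)"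
      unfolding g_def w_def
      by (rule sqrt_det_metric_gram_derivative[OF A'])
        (use lag[OF u] D[OF u] jacf[OF u] in auto)
    moreover have "((\<lambda>t. g (t, u)) has_real_derivative frechet_derivative g (at (0, u)) (1, 0)) (at 0)"
      by (rule ck_on_slice_derivative[OF g in\<Omega>[OF u]])
    ultimately show ?thesis
      unfolding variation_density_def jacf[OF u] jacV by (metis DERIV_unique)
  qed
  then have "(LINT u:B|lborel. frechet_derivative g (at (0, u)) (1, 0)) =
     (LINT u:B|lborel. variation_density (f \<circ> \<phi>) (variation_field F \<circ> \<phi>) u)"
    by (intro set_lebesgue_integral_cong) (use B in auto)
  with der have der': "((\<lambda>t. LINT u:B|lborel. g (t, u)) has_real_derivative
     (LINT u:B|lborel. variation_density (f \<circ> \<phi>) (variation_field F \<circ> \<phi>) u)) (at 0)" by simp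
  show ?thesis
  proof (rule has_field_derivative_transform_within_open[OF der', of "{-\<delta><..<\<delta>}"])
    fix t assume t: "t \<in> {-\<delta><..<\<delta>}"
    show "(LINT u:B|lborel. g (t, u)) = (LINT u:B|lborel. sqrt \<bar>det (gram_matrix p (F t \<circ> \<phi>) u)\<bar>)"
    proof (intro set_lebesgue_integral_cong allI impI)
      fix u assume "u \<in> B"
      then have "(t, u) \<in> \<Omega>\<^sub>0" using t B closure_subset by (auto simp: \<Omega>\<^sub>0_def)
      from jacJ[OF this] have "J (t, u) $ i = frechet_derivative (F t \<circ> \<phi>) (at u) (axis i 1)" for i
        by (metis jac_nth)
      then show "g (t, u) = sqrt \<bar>det (gram_matrix p (F t \<circ> \<phi>) u)\<bar>"
        unfolding g_def w_def gram_matrix_def by simp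
    qed (use B in auto)
  qed (use \<delta> in auto)
qed

section \<open>Lagrangian immersions of constant phase\<close>

text \<open>The inverse in \<open>local_parametrization\<close> is only required to be continuous. A
  smooth inverse \<open>\<pi>\<close> makes every transition map into this chart smooth, without
  recourse to the inverse function theorem. Connectedness fixes the sign of nonvanishing real
  functions.\<close>

definition adapted_chart :: "'a::euclidean_space set \<Rightarrow> (real^'n) set \<Rightarrow> (real^'n \<Rightarrow> 'a) \<Rightarrow> ('a \<Rightarrow> real^'n) \<Rightarrow> bool" where
  "adapted_chart X W \<psi> \<pi> \<longleftrightarrow> local_parametrization X W \<psi> \<and> connected W \<and> smooth_on (\<psi> ` W) \<pi> \<and> (\<forall>w\<in>W. \<pi> (\<psi> w) = w)"

lemma integral_change_of_variables_real:
  fixes f :: "real^'n::{finite,wellorder} \<Rightarrow> real" and g :: "real^'n::_ \<Rightarrow> real^'n::_"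
  assumes S: "S \<in> sets lebesgue"
    and g: "\<And>x. x \<in> S \<Longrightarrow> (g has_derivative g' x) (at x within S)"
    and inj: "inj_on g S" and f: "f absolutely_integrable_on (g ` S)"
  shows "integral (g ` S) f = integral S (\<lambda>x. \<bar>det (matrix (g' x))\<bar> * f (g x))"
proof -
  have "(\<lambda>x. vec (f x) :: real^1) absolutely_integrable_on (g ` S)"
    using f by (simp add: absolutely_integrable_on_1_iff)
  from integral_change_of_variables[OF S g inj disjI1[OF this]]
  have "vec (integral (g ` S) f) = (vec (integral S (\<lambda>x. \<bar>det (matrix (g' x))\<bar> * f (g x))) :: real^1)"
    by (simp add: integral_on_1_eq)
  then show ?thesis by (simp add: vec_eq_iff)
qed

lemma continuous_on_variation_density:
  assumes "open W" "ck_on (Suc 0) W h" "ck_on (Suc 0) W V" "\<And>u. u \<in> W \<Longrightarrow> det (jac h u) \<noteq> 0"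
  shows "continuous_on W (variation_density h V)"
proof -
  have D: "continuous_on W (\<lambda>u. det (jac h u))"
    using ck_on_det[OF assms(1), of 0 "jac h"] ck_on_jac[OF assms(1,2)] by simp
  have "continuous_on W (\<lambda>u. ddet (jac h u) (jac V u))"
  proof -
    have "ck_on 0 W (\<lambda>u. ddet (jac h u) (jac V u))"
      unfolding ddet_expand by (intro ck_on_sum ck_on_mult ck_on_const ck_on_prod ck_on_jac assms)
    then show ?thesis by simp
  qed
  with D show ?thesis
    unfolding variation_density_def using assms(4) by (auto intro!: continuous_intros)
qed

text \<open>Cramer's rule. The coefficients are quotients of determinants, so they inherit the
  regularity of \<open>v\<close> and \<open>A\<close>.\<close>

lemma row_expansion:
  fixes A :: "complex^'n^'n"
  assumes "det A \<noteq> 0"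
  shows "v = (\<Sum>k\<in>UNIV. (det (\<chi> i. if i = k then v else A $ i) / det A) *s A $ k)"
proof -
  have dT: "det (transpose A) \<noteq> 0" using assms by simp
  define x where "x = (\<chi> k. det (\<chi> i j. if j = k then v $ i else transpose A $ i $ j) / det (transpose A))"
  have "transpose A *v x = v" using cramer[OF dT, of x v] by (simp add: x_def)
  then have "v = (\<Sum>k\<in>UNIV. x $ k *s A $ k)"
    by (simp add: matrix_mult_sum row_def column_def transpose_def vec_eq_iff)
  moreover have "x $ k = det (\<chi> i. if i = k then v else A $ i) / det A" for k
  proof -
    have "transpose (\<chi> i j. if j = k then v $ i else transpose A $ i $ j) = (\<chi> i. if i = k then v else A $ i)"
      by (simp add: transpose_def vec_eq_iff)
    then have "det (\<chi> i j. if j = k then v $ i else transpose A $ i $ j) = det (\<chi> i. if i = k then v else A $ i)"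
      by (subst det_transpose[symmetric]) (rule arg_cong[where f = det])
    then show ?thesis by (simp add: x_def)
  qed
  ultimately show ?thesis by simp
qed

text \<open>Since the determinant does not vanish, the partial derivatives of \<open>h\<close> form
  a complex basis and every field is a combination of them with complex coefficients
  \<open>a k\<close>. Each summand is handled by \<open>ddet_jac_tangential\<close>, and
  \<open>a k\<close> times the determinant is the determinant with row k replaced by the
  field.\<close>

lemma ddet_jac_divergence:
  fixes h V :: "real^'n \<Rightarrow> complex^'n"
  assumes W: "open W" "u \<in> W" and h: "\<And>k. ck_on k W h" and V: "\<And>k. ck_on k W V"
    and D: "\<And>u. u \<in> W \<Longrightarrow> det (jac h u) \<noteq> 0"
  shows "ddet (jac h u) (jac V u) =
    (\<Sum>k\<in>UNIV. frechet_derivative (\<lambda>x. det (\<chi> i. if i = k then V x else jac h x $ i)) (at u) (axis k 1))"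
proof -
  define P where "P k x = det (\<chi> i. if i = k then V x else jac h x $ i)" for k x
  define a where "a k x = P k x / det (jac h x)" for k x
  have P: "ck_on j W (P k)" for j k
    unfolding P_def
  proof (rule ck_on_det[OF W(1)])
    fix i l
    show "ck_on j W (\<lambda>x. (\<chi> i. if i = k then V x else jac h x $ i) $ i $ l)"
      by (cases "i = k") (simp_all add: ck_on_nth[OF W(1) V] ck_on_jac[OF W(1) h, simplified] del: ck_on.simps)
  qed
  have Dck: "ck_on j W (\<lambda>x. det (jac h x))" for j
    by (rule ck_on_det[OF W(1) ck_on_jac[OF W(1) h]])
  have a: "ck_on j W (a k)" for j k
    unfolding a_def divide_inverse
    by (intro ck_on_mult W P ck_on_compose[OF W(1) _ Dck ck_on_inverse]) (use D in auto)
  let ?S = "\<lambda>k x. a k x *s frechet_derivative h (at x) (axis k 1)"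
  have Vx: "V x = (\<Sum>k\<in>UNIV. ?S k x)" if "x \<in> W" for x
    using row_expansion[OF D[OF that], of "V x"] by (simp add: a_def P_def)
  have S: "ck_on (Suc 0) W (?S k)" for k
  proof -
    have "ck_on (Suc 0) W (\<lambda>x. \<chi> i. a k x * frechet_derivative h (at x) (axis k 1) $ i)"
      using h[of "Suc (Suc 0)"] by (intro ck_on_vec ck_on_mult W a ck_on_nth) (simp del: ck_on.simps(1) add: ck_on.simps(2)[of "Suc 0"])
    then show ?thesis by (simp add: vector_scalar_mult_def)
  qed
  have "jac V u = jac (\<lambda>x. \<Sum>k\<in>UNIV. ?S k x) u"
    by (rule jac_cong[OF W Vx])
  also have "\<dots> = (\<Sum>k\<in>UNIV. jac (?S k) u)"
  proof -
    have "((\<lambda>x. \<Sum>k\<in>UNIV. ?S k x) has_derivative (\<lambda>v. \<Sum>k\<in>UNIV. frechet_derivative (?S k) (at u) v)) (at u)"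
      by (rule has_derivative_sum) (rule ck_on_has_derivative[OF S W(2)])
    from frechet_derivative_eqI[OF this] show ?thesis by (simp add: jac_def vec_eq_iff)
  qed
  finally have "ddet (jac h u) (jac V u) = (\<Sum>k\<in>UNIV. ddet (jac h u) (jac (?S k) u))"
    by (simp add: ddet_sum)
  also have "\<dots> = (\<Sum>k\<in>UNIV. frechet_derivative (P k) (at u) (axis k 1))"
  proof (rule sum.cong[OF refl])
    fix k
    have "a k differentiable at u" using ck_on_has_derivative[OF a W(2)] differentiableI by blast
    then have "ddet (jac h u) (jac (?S k) u) = frechet_derivative (\<lambda>x. a k x * det (jac h x)) (at u) (axis k 1)"
      by (rule ddet_jac_tangential[OF W h])
    also have "frechet_derivative (\<lambda>x. a k x * det (jac h x)) (at u) = frechet_derivative (P k) (at u)"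
      by (rule frechet_derivative_cong_open[OF W]) (use D in \<open>simp add: a_def\<close>)
    finally show "ddet (jac h u) (jac (?S k) u) = frechet_derivative (P k) (at u) (axis k 1)" .
  qed
  finally show ?thesis by (simp add: P_def[abs_def])
qed

lemma ck_on_extend_by_zero:
  assumes "open W" "ck_on k W f" "compact C" "C \<subseteq> W" "\<And>x. x \<in> W \<Longrightarrow> x \<notin> C \<Longrightarrow> f x = 0"
  shows "ck_on k UNIV (\<lambda>x. if x \<in> W then f x else 0)"
proof (rule ck_on_local)
  fix x
  show "\<exists>V. open V \<and> x \<in> V \<and> ck_on k V (\<lambda>x. if x \<in> W then f x else 0)"
  proof (cases "x \<in> W")
    case True
    have "ck_on k W (\<lambda>x. if x \<in> W then f x else 0)" by (rule ck_on_cong[OF assms(1,2)]) simp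
    then show ?thesis using True assms(1) by blast
  next
    case False
    have o: "open (- C)" using assms(3) compact_imp_closed by blast
    have "ck_on k (- C) (\<lambda>x. if x \<in> W then f x else 0)"
      by (rule ck_on_cong[OF o ck_on_const[OF o, of k 0]]) (use assms(5) in auto)
    then show ?thesis using False o assms(4) by blast
  qed
qed

lemma integrable_compact_support:
  fixes f :: "'a::euclidean_space \<Rightarrow> real"
  assumes "continuous_on UNIV f" "compact C" "\<And>x. x \<notin> C \<Longrightarrow> f x = 0"
  shows "integrable lborel f"
proof -
  have "integrable lborel (\<lambda>x. indicator C x *\<^sub>R f x)"
    by (rule borel_integrable_compact[OF assms(2) continuous_on_subset[OF assms(1)]]) simp
  moreover have "(\<lambda>x. indicator C x *\<^sub>R f x) = f"
  proof
    fix x show "indicator C x *\<^sub>R f x = f x" using assms(3) by (cases "x \<in> C") auto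
  qed
  ultimately show ?thesis by (simp only:)
qed

lemma sgn_constant_on_connected:
  fixes \<rho> :: "'a::topological_space \<Rightarrow> real"
  assumes "connected W" "continuous_on W \<rho>" "\<And>x. x \<in> W \<Longrightarrow> \<rho> x \<noteq> 0"
  obtains s where "\<And>x. x \<in> W \<Longrightarrow> sgn (\<rho> x) = s"
proof (cases "W = {}")
  case False
  then obtain w where w: "w \<in> W" by blast
  have "sgn (\<rho> x) = sgn (\<rho> w)" if x: "x \<in> W" for x
  proof (rule ccontr)
    assume ne: "sgn (\<rho> x) \<noteq> sgn (\<rho> w)"
    have c: "connected (\<rho> ` W)" by (rule connected_continuous_image[OF assms(2,1)])
    have "\<rho> x < 0 \<and> 0 < \<rho> w \<or> \<rho> w < 0 \<and> 0 < \<rho> x"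
      using ne assms(3)[OF x] assms(3)[OF w] by (auto simp: sgn_if split: if_splits)
    then have "0 \<in> \<rho> ` W"
      using connectedD_interval[OF c, of "\<rho> x" "\<rho> w" 0] connectedD_interval[OF c, of "\<rho> w" "\<rho> x" 0] x w by auto
    then show False using assms(3) by auto
  qed
  then show ?thesis using that by blast
qed (use that in auto)

text \<open>When the phase of \<open>det (jac h)\<close> is constant, \<open>ddet_jac_divergence\<close> exhibits the density as a
  divergence with compact support.\<close>

lemma integral_variation_density_eq_0:
  fixes h V :: "real^'n \<Rightarrow> complex^'n"
  assumes W: "open W" "connected W" and h: "\<And>k. ck_on k W h" and V: "\<And>k. ck_on k W V"
    and D: "\<And>u. u \<in> W \<Longrightarrow> det (jac h u) \<noteq> 0" and \<theta>: "\<theta> \<noteq> 0" "\<And>u. u \<in> W \<Longrightarrow> Im (det (jac h u) / \<theta>) = 0"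
    and C: "compact C" "C \<subseteq> W" "\<And>x. x \<in> W \<Longrightarrow> x \<notin> C \<Longrightarrow> V x = 0"
  defines "e \<equiv> \<lambda>w. if w \<in> W then variation_density h V w else 0"
  shows "continuous_on UNIV e" "\<And>x. x \<notin> C \<Longrightarrow> e x = 0" "(LINT w|lborel. e w) = 0"
proof -
  have oC: "open (- C)" using C(1) compact_imp_closed by blast
  have z: "variation_density h V x = 0" if "x \<in> W" "x \<notin> C" for x
    by (rule variation_density_zero[of "W \<inter> - C"]) (use that W oC C(3) in auto)
  show e0: "e x = 0" if "x \<notin> C" for x using z that by (simp add: e_def)
  have "ck_on 0 W (variation_density h V)"
    using continuous_on_variation_density[OF W(1) h V D] by simp
  from ck_on_extend_by_zero[OF W(1) this C(1,2) z]
  show "continuous_on UNIV e" by (simp add: e_def)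
  define \<rho> where "\<rho> u = Re (det (jac h u) / \<theta>)" for u
  have D\<rho>: "det (jac h u) = of_real (\<rho> u) * \<theta>" if "u \<in> W" for u
  proof -
    have "det (jac h u) / \<theta> = of_real (\<rho> u)" using \<theta>(2)[OF that] by (simp add: complex_eq_iff \<rho>_def)
    then show ?thesis using \<theta>(1) by (simp add: field_simps)
  qed
  have Dck: "ck_on 0 W (\<lambda>x. det (jac h x))"
    by (rule ck_on_det[OF W(1) ck_on_jac[OF W(1) h]])
  have "continuous_on W \<rho>" unfolding \<rho>_def using Dck \<theta>(1) by (auto intro!: continuous_intros)
  moreover have "\<rho> u \<noteq> 0" if "u \<in> W" for u using D\<rho>[OF that] D[OF that] by auto
  ultimately obtain s where s: "\<And>x. x \<in> W \<Longrightarrow> sgn (\<rho> x) = s"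
    using sgn_constant_on_connected[OF W(2)] by blast
  \<comment> \<open>The constant value of cnj D / |D| on \<open>W\<close> for
    \<open>D = det (jac h)\<close>: the real factor \<open>\<rho>\<close> contributes only its sign
    \<open>s\<close>.\<close>
  define c where "c = of_real s * cnj \<theta> / of_real (cmod \<theta>)"
  define P where "P k x = (if x \<in> W then det (\<chi> i. if i = k then V x else jac h x $ i) else 0)" for k x
  have P0: "det (\<chi> i. if i = k then V x else jac h x $ i) = 0" if "V x = 0" for x k
    by (rule det_zero_row(2)[of k]) (use that in \<open>simp add: row_def vec_eq_iff\<close>)
  have P: "ck_on (Suc 0) UNIV (P k)" for k
    unfolding P_def
  proof (rule ck_on_extend_by_zero[OF W(1) _ C(1,2)])
    show "ck_on (Suc 0) W (\<lambda>x. det (\<chi> i. if i = k then V x else jac h x $ i))"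
    proof (rule ck_on_det[OF W(1)])
      fix i l
      show "ck_on (Suc 0) W (\<lambda>x. (\<chi> i. if i = k then V x else jac h x $ i) $ i $ l)"
        by (cases "i = k") (simp_all add: ck_on_nth[OF W(1) V] ck_on_jac[OF W(1) h, simplified] del: ck_on.simps)
    qed
  qed (use C(3) P0 in auto)
  define Q where "Q k x = Re (c * P k x)" for k x
  have Q: "ck_on (Suc 0) UNIV (Q k)" for k
    unfolding Q_def by (intro ck_on_bounded_linear[OF bounded_linear_Re] ck_on_mult ck_on_const P open_UNIV)
  have Q0: "Q k x = 0" if "x \<notin> C" for k x using that C(3) P0 by (simp add: Q_def P_def)
  have Q': "(\<Sum>k\<in>UNIV. frechet_derivative (Q k) (at u) (axis k 1)) = e u" for u
  proof (cases "u \<in> W")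
    case True
    have "frechet_derivative (Q k) (at u) v = Re (c * frechet_derivative (\<lambda>x. det (\<chi> i. if i = k then V x else jac h x $ i)) (at u) v)" for k v
    proof -
      have "frechet_derivative (Q k) (at u) = (\<lambda>v. Re (c * frechet_derivative (P k) (at u) v))"
        unfolding Q_def
        by (rule frechet_derivative_eqI, rule bounded_linear.has_derivative[OF bounded_linear_Re],
            rule has_derivative_mult_right, rule ck_on_has_derivative[OF P]) simp
      moreover have "frechet_derivative (P k) (at u) = frechet_derivative (\<lambda>x. det (\<chi> i. if i = k then V x else jac h x $ i)) (at u)"
        by (rule frechet_derivative_cong_open[OF W(1) True]) (simp add: P_def)
      ultimately show ?thesis by simp
    qed
    then have "(\<Sum>k\<in>UNIV. frechet_derivative (Q k) (at u) (axis k 1)) = Re (c * ddet (jac h u) (jac V u))"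
      by (simp add: ddet_jac_divergence[OF W(1) True h V D] sum_distrib_left Re_sum)
    also have "\<dots> = variation_density h V u"
    proof -
      let ?X = "ddet (jac h u) (jac V u)"
      have "variation_density h V u = Re (of_real (\<rho> u) * cnj \<theta> * ?X) / (\<bar>\<rho> u\<bar> * cmod \<theta>)"
        unfolding variation_density_def D\<rho>[OF True] by (simp add: norm_mult)
      also have "Re (of_real (\<rho> u) * cnj \<theta> * ?X) = \<rho> u * Re (cnj \<theta> * ?X)"
        by (simp only: mult.assoc times_complex.sel Re_complex_of_real Im_complex_of_real mult_zero_left diff_zero)
      also have "\<rho> u * Re (cnj \<theta> * ?X) / (\<bar>\<rho> u\<bar> * cmod \<theta>) = (\<rho> u / \<bar>\<rho> u\<bar>) * Re (cnj \<theta> * ?X) / cmod \<theta>"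
        by simp
      also have "\<rho> u / \<bar>\<rho> u\<bar> = s" using s[OF True] by (simp add: sgn_real_def abs_if split: if_splits)
      also have "s * Re (cnj \<theta> * ?X) / cmod \<theta> = Re (c * ?X)"
        unfolding c_def by (simp add: Re_divide_of_real algebra_simps add_divide_distrib diff_divide_distrib)
      finally show ?thesis by simp
    qed
    finally show ?thesis using True by (simp add: e_def)
  next
    case False
    have "frechet_derivative (Q k) (at u) = frechet_derivative (\<lambda>x. 0) (at u)" for k
      by (rule frechet_derivative_cong_open[OF oC]) (use False C(2) Q0 in auto)
    then show ?thesis using False by (simp add: e_def)
  qed
  have "integrable lborel (\<lambda>u. frechet_derivative (Q k) (at u) (axis k 1))" for k
  proof (rule integrable_compact_support[OF ck_on_frechet_continuous[OF Q] C(1)])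
    fix x assume "x \<notin> C"
    then have "frechet_derivative (Q k) (at x) = frechet_derivative (\<lambda>x. 0) (at x)"
      by (intro frechet_derivative_cong_open[OF oC]) (use Q0 in auto)
    then show "frechet_derivative (Q k) (at x) (axis k 1) = 0" by simp
  qed
  then have "(LINT u|lborel. (\<Sum>k\<in>UNIV. frechet_derivative (Q k) (at u) (axis k 1))) =
     (\<Sum>k\<in>UNIV. (LINT u|lborel. frechet_derivative (Q k) (at u) (axis k 1)))"
    by (intro Bochner_Integration.integral_sum)
  also have "\<dots> = 0"
    using integral_directional_derivative_eq_0[OF Q C(1) Q0] by simp
  finally show "(LINT w|lborel. e w) = 0" unfolding Q' .
qed

section \<open>From arbitrary volume decompositions to one chart\<close>

text \<open>On the overlap of the two charts the transition map \<tau> = \<pi> \<circ> \<phi> is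
  smooth and injective, and the change of variables formula matches
  \<open>variation_density_compose\<close>. The rest of the piece does not meet the support of the
  field.\<close>

lemma integral_variation_density_piece:
  fixes f V :: "'a::euclidean_space \<Rightarrow> complex^('n::{finite,wellorder})" and W :: "(real^('n::_)) set"
  assumes f: "smooth_on X f" and V: "smooth_on X V"
    and \<psi>: "adapted_chart X W \<psi> \<pi>"
    and C: "compact C" "C \<subseteq> W" "\<And>x. x \<in> X \<Longrightarrow> x \<notin> \<psi> ` C \<Longrightarrow> V x = 0"
    and D: "\<And>W \<phi> u. local_parametrization X W \<phi> \<Longrightarrow> u \<in> W \<Longrightarrow> det (jac (f \<circ> \<phi>) u) \<noteq> 0"
    and \<phi>: "local_parametrization X W' \<phi>" and B: "B \<in> sets borel" "bounded B" "closure B \<subseteq> W'"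
  defines "e \<equiv> \<lambda>w. if w \<in> W then variation_density (f \<circ> \<psi>) (V \<circ> \<psi>) w else 0"
  assumes e: "continuous_on UNIV e" "\<And>x. x \<notin> C \<Longrightarrow> e x = 0"
  defines "T \<equiv> {w \<in> W. \<psi> w \<in> \<phi> ` B}"
  shows "T \<in> sets lebesgue" "(LINT u:B|lborel. variation_density (f \<circ> \<phi>) (V \<circ> \<phi>) u) = integral T e"
proof -
  have lp: "local_parametrization X W \<psi>" and sm\<pi>: "smooth_on (\<psi> ` W) \<pi>" and \<pi>: "\<And>w. w \<in> W \<Longrightarrow> \<pi> (\<psi> w) = w"
    using \<psi> unfolding adapted_chart_def by auto
  note W = local_parametrizationD[OF lp] and W' = local_parametrizationD[OF \<phi>]
  define O' where "O' = W' \<inter> \<phi> -` (\<psi> ` W)"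
  have O': "open O'"
  proof -
    have "openin (top_of_set W') O'" unfolding O'_def
      by (rule continuous_openin_preimage[OF W'(7) _ W(4)]) (use W'(3) in auto)
    then show ?thesis using W'(1) openin_open_trans by blast
  qed
  define \<tau> where "\<tau> = (\<lambda>u. \<pi> (\<phi> u))"
  have \<tau>W: "\<tau> u \<in> W" "\<psi> (\<tau> u) = \<phi> u" if "u \<in> O'" for u
    using that \<pi> by (auto simp: O'_def \<tau>_def)
  have \<tau>: "ck_on k O' \<tau>" for k
    unfolding \<tau>_def
    by (rule smooth_on_openD[OF O'], rule smooth_on_compose[OF smooth_on_subset[OF W'(2)] sm\<pi>]) (auto simp: O'_def)
  have \<tau>': "(\<tau> has_derivative frechet_derivative \<tau> (at u)) (at u)" if "u \<in> O'" for u
    by (rule ck_on_has_derivative[OF \<tau> that])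
  have inj: "inj_on \<tau> O'"
  proof (rule inj_onI)
    fix u v assume "u \<in> O'" "v \<in> O'" "\<tau> u = \<tau> v"
    then have "\<phi> u = \<phi> v" using \<tau>W(2) by metis
    then show "u = v" using W'(5) \<open>u \<in> O'\<close> \<open>v \<in> O'\<close> by (auto simp: O'_def inj_on_def)
  qed
  define S where "S = B \<inter> O'"
  have S: "S \<in> sets lebesgue" using B(1) O' unfolding S_def by auto
  have T: "T = \<tau> ` S"
  proof
    show "T \<subseteq> \<tau> ` S"
    proof
      fix w assume "w \<in> T"
      then obtain u where u: "u \<in> B" "\<psi> w = \<phi> u" "w \<in> W" by (auto simp: T_def)
      then have "u \<in> W'" using B(3) closure_subset by blast
      then have "u \<in> O'" using u by (auto simp: O'_def) (metis imageI)
      moreover have "\<tau> u = w" using u \<pi>[of w] by (simp add: \<tau>_def flip: u(2))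
      ultimately show "w \<in> \<tau> ` S" using u by (auto simp: S_def)
    qed
    show "\<tau> ` S \<subseteq> T" using \<tau>W by (auto simp: S_def T_def)
  qed
  \<comment> \<open>As a differentiable image \<open>T\<close> is shown to be Lebesgue measurable,
    not Borel; this is why the transported integral is a gauge integral.\<close>
  show "T \<in> sets lebesgue" unfolding T
  proof (rule differentiable_image_in_sets_lebesgue[OF S])
    show "\<tau> differentiable_on S"
      unfolding differentiable_on_def S_def using \<tau>' differentiableI differentiable_at_withinI by blast
  qed simp
  then have e_int: "e absolutely_integrable_on T"
  proof -
    have "integrable lborel e" by (rule integrable_compact_support[OF e(1) C(1) e(2)])
    then have "integrable lebesgue e" by (rule integrable_completion[THEN iffD2, rotated]) (use e(1) in \<open>simp add: borel_measurable_continuous_onI\<close>)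
    then have "set_integrable lebesgue UNIV e" by (simp add: set_integrable_def)
    then show ?thesis by (rule set_integrable_subset) (use \<open>T \<in> sets lebesgue\<close> in auto)
  qed
  let ?d = "variation_density (f \<circ> \<phi>) (V \<circ> \<phi>)"
  have d_in: "?d u = \<bar>det (matrix (frechet_derivative \<tau> (at u)))\<bar> * e (\<tau> u)" if u: "u \<in> O'" for u
  proof -
    have "?d u = variation_density (\<lambda>x. (f \<circ> \<psi>) (\<tau> x)) (\<lambda>x. (V \<circ> \<psi>) (\<tau> x)) u"
      by (rule variation_density_cong[OF O' u]) (use \<tau>W(2) in auto)
    also have "\<dots> = \<bar>det (matrix (frechet_derivative \<tau> (at u)))\<bar> * variation_density (f \<circ> \<psi>) (V \<circ> \<psi>) (\<tau> u)"
      by (rule variation_density_compose[OF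
            differentiableI[OF ck_on_has_derivative[OF ck_on_comp_parametrization[OF f lp] \<tau>W(1)[OF u]]]
            differentiableI[OF ck_on_has_derivative[OF ck_on_comp_parametrization[OF V lp] \<tau>W(1)[OF u]]] \<tau>'[OF u]])
    finally show ?thesis using \<tau>W(1)[OF u] by (simp add: e_def)
  qed
  \<comment> \<open>Outside the overlap the point avoids the compact set \<open>\<psi>\<close>
    followed by \<open>C\<close>, whose complement is open; so the field vanishes near the point and
    its Jacobian vanishes too.\<close>
  have d_out: "?d u = 0" if u: "u \<in> W'" "u \<notin> O'" for u
  proof -
    have "compact (\<psi> ` C)" by (rule compact_continuous_image[OF continuous_on_subset[OF W(7) C(2)] C(1)])
    then have "open (- (\<psi> ` C))" using compact_imp_closed by blast
    then have "open (W' \<inter> \<phi> -` (- (\<psi> ` C)))"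
      using W'(1,7) by (intro continuous_open_preimage)
    moreover have "u \<in> W' \<inter> \<phi> -` (- (\<psi> ` C))" using u C(2) by (auto simp: O'_def)
    ultimately show ?thesis
      by (rule variation_density_zero) (use W'(3) C(3) in auto)
  qed
  have d_cont: "continuous_on W' ?d"
    by (rule continuous_on_variation_density[OF W'(1) ck_on_comp_parametrization[OF f \<phi>] ck_on_comp_parametrization[OF V \<phi>] D[OF \<phi>]])
  have "set_integrable lborel B ?d"
    by (rule set_integrable_on_compact[of "closure B"])
      (use B closure_subset continuous_on_subset[OF d_cont B(3)] in \<open>auto simp: compact_closure\<close>)
  then have "(LINT u:B|lborel. ?d u) = integral B ?d" by (rule set_borel_integral_eq_integral)
  also have "\<dots> = integral UNIV (\<lambda>u. if u \<in> B then ?d u else 0)"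
    by (simp only: Henstock_Kurzweil_Integration.integral_restrict_UNIV)
  also have "(\<lambda>u. if u \<in> B then ?d u else 0) = (\<lambda>u. if u \<in> S then ?d u else 0)"
  proof
    fix u
    have "u \<in> W'" if "u \<in> B" using that B(3) closure_subset by blast
    then show "(if u \<in> B then ?d u else 0) = (if u \<in> S then ?d u else 0)"
      using d_out[of u] by (auto simp: S_def)
  qed
  also have "integral UNIV \<dots> = integral S ?d"
    by (simp only: Henstock_Kurzweil_Integration.integral_restrict_UNIV)
  also have "\<dots> = integral S (\<lambda>u. \<bar>det (matrix (frechet_derivative \<tau> (at u)))\<bar> * e (\<tau> u))"
    by (rule Henstock_Kurzweil_Integration.integral_cong) (simp add: d_in S_def)
  also have "\<dots> = integral (\<tau> ` S) e"
  proof (rule integral_change_of_variables_real[symmetric, OF S])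
    show "(\<tau> has_derivative frechet_derivative \<tau> (at u)) (at u within S)" if "u \<in> S" for u
      using \<tau>'[of u] that by (auto simp: S_def intro: has_derivative_at_withinI)
    show "inj_on \<tau> S" using inj by (rule inj_on_subset) (simp add: S_def)
    show "e absolutely_integrable_on \<tau> ` S" using e_int unfolding T .
  qed
  finally show "(LINT u:B|lborel. ?d u) = integral T e" unfolding T .
qed

text \<open>No single piece need contribute 0. Carried into the chart of the support, however, the
  pieces become disjoint sets \<open>T i\<close> that exhaust the support of \<open>e\<close> up to
  points where \<open>e\<close> is 0, so their sum is the full integral of a divergence.\<close>

lemma first_variation_local_eq_0:
  fixes f V :: "'a::euclidean_space \<Rightarrow> complex^('n::{finite,wellorder})" and W :: "(real^('n::_)) set"
  assumes f: "smooth_on X f" and V: "smooth_on X V"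
    and \<psi>: "adapted_chart X W \<psi> \<pi>"
    and C: "compact C" "C \<subseteq> W" "\<And>x. x \<in> X \<Longrightarrow> x \<notin> \<psi> ` C \<Longrightarrow> V x = 0"
    and D: "\<And>W \<phi> u. local_parametrization X W \<phi> \<Longrightarrow> u \<in> W \<Longrightarrow> det (jac (f \<circ> \<phi>) u) \<noteq> 0"
    and \<theta>: "\<theta> \<noteq> 0" "\<And>W \<phi> u. local_parametrization X W \<phi> \<Longrightarrow> u \<in> W \<Longrightarrow> Im (det (jac (f \<circ> \<phi>) u) / \<theta>) = 0"
    and K: "compact K" "\<And>x. x \<in> X \<Longrightarrow> x \<notin> K \<Longrightarrow> V x = 0"
    and dec: "volume_decomposition X K N W' \<phi> B"
  shows "(\<Sum>i<N. LINT u:B i|lborel. variation_density (f \<circ> \<phi> i) (V \<circ> \<phi> i) u) = 0"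
proof -
  have lp: "local_parametrization X W \<psi>" and conn: "connected W"
    using \<psi> unfolding adapted_chart_def by auto
  note W = local_parametrizationD[OF lp]
  have decD: "local_parametrization X (W' i) (\<phi> i)" "B i \<in> sets borel" "bounded (B i)" "closure (B i) \<subseteq> W' i" if "i < N" for i
    using dec that unfolding volume_decomposition_def by auto
  have disj: "disjoint_family_on (\<lambda>i. \<phi> i ` B i) {..<N}" and un: "(\<Union>i<N. \<phi> i ` B i) = K"
    using dec unfolding volume_decomposition_def by auto
  define e where "e w = (if w \<in> W then variation_density (f \<circ> \<psi>) (V \<circ> \<psi>) w else 0)" for w
  have VC: "(V \<circ> \<psi>) x = 0" if "x \<in> W" "x \<notin> C" for x
  proof -
    have "\<psi> x \<notin> \<psi> ` C" using W(5) C(2) that by (auto simp: inj_on_def)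
    then show ?thesis using C(3) W(3) that by auto
  qed
  have h: "\<And>k. ck_on k W (f \<circ> \<psi>)" and v: "\<And>k. ck_on k W (V \<circ> \<psi>)"
    using ck_on_comp_parametrization[OF f lp] ck_on_comp_parametrization[OF V lp] by blast+
  have d: "\<And>u. u \<in> W \<Longrightarrow> det (jac (f \<circ> \<psi>) u) \<noteq> 0" and t: "\<And>u. u \<in> W \<Longrightarrow> Im (det (jac (f \<circ> \<psi>) u) / \<theta>) = 0"
    using D[OF lp] \<theta>(2)[OF lp] by blast+
  note rl = integral_variation_density_eq_0[OF W(1) conn h v _ \<theta>(1) _ C(1,2)]
  have e1: "continuous_on UNIV e" unfolding e_def[abs_def] by (rule rl(1)) (fact d t VC)+
  have e2: "e x = 0" if "x \<notin> C" for x unfolding e_def by (rule rl(2)) (fact d t VC that)+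
  have e3: "(LINT w|lborel. e w) = 0" unfolding e_def by (rule rl(3)) (fact d t VC)+
  note e = e1 e2 e3
  define T where "T i = {w \<in> W. \<psi> w \<in> \<phi> i ` B i}" for i
  have piece: "T i \<in> sets lebesgue" "(LINT u:B i|lborel. variation_density (f \<circ> \<phi> i) (V \<circ> \<phi> i) u) = integral (T i) e"
    if i: "i < N" for i
    unfolding T_def e_def[abs_def]
    by (rule integral_variation_density_piece[OF f V \<psi> C(1,2)],
        (fact C(3) D decD[OF i] e1[unfolded e_def[abs_def]] e2[unfolded e_def])+)+
  have T: "T i \<in> sets lebesgue" if "i < N" for i
    using piece(1) that by blast
  \<comment> \<open>The complement of \<open>K\<close> is open, so the field vanishes in a
    neighbourhood of \<open>\<psi> w\<close> in \<open>X\<close>, and with it the derivative that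
    enters the density.\<close>
  have eK: "e w = 0" if "w \<notin> (\<Union>i<N. T i)" for w
  proof (cases "w \<in> W")
    case True
    have "\<psi> w \<notin> K" using that True by (auto simp: T_def simp flip: un)
    moreover have o: "open (W \<inter> \<psi> -` (- K))"
      using K(1) compact_imp_closed W(1,7) by (intro continuous_open_preimage) auto
    ultimately have "variation_density (f \<circ> \<psi>) (V \<circ> \<psi>) w = 0"
      by (intro variation_density_zero[OF o]) (use True K(2) W(3) in auto)
    then show ?thesis by (simp add: e_def)
  qed (simp add: e_def)
  have e_int: "integrable lborel e" by (rule integrable_compact_support[OF e(1) C(1) e(2)])
  then have e_leb: "integrable lebesgue e"
    by (rule integrable_completion[THEN iffD2, rotated]) (use e(1) in \<open>simp add: borel_measurable_continuous_onI\<close>)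
  have e_T: "(\<lambda>w. if w \<in> T i then e w else 0) integrable_on UNIV" if "i < N" for i
  proof -
    have "set_integrable lebesgue UNIV e" using e_leb by (simp add: set_integrable_def)
    then have "set_integrable lebesgue (T i) e" by (rule set_integrable_subset) (use T[OF that] in auto)
    then show ?thesis by (simp add: integrable_restrict_UNIV set_lebesgue_integral_eq_integral(1))
  qed
  have "(\<Sum>i<N. LINT u:B i|lborel. variation_density (f \<circ> \<phi> i) (V \<circ> \<phi> i) u) = (\<Sum>i<N. integral (T i) e)"
    using piece(2) by (intro sum.cong) auto
  also have "\<dots> = (\<Sum>i<N. integral UNIV (\<lambda>w. if w \<in> T i then e w else 0))"
    by (simp only: Henstock_Kurzweil_Integration.integral_restrict_UNIV)
  also have "\<dots> = integral UNIV (\<lambda>w. \<Sum>i<N. if w \<in> T i then e w else 0)"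
    by (rule Henstock_Kurzweil_Integration.integral_sum[symmetric]) (use e_T in auto)
  also have "(\<lambda>w. \<Sum>i<N. if w \<in> T i then e w else 0) = e"
  proof
    fix w
    show "(\<Sum>i<N. if w \<in> T i then e w else 0) = e w"
    proof (cases "\<exists>i<N. w \<in> T i")
      case True
      then obtain i where i: "i < N" "w \<in> T i" by blast
      have "w \<in> T j \<longleftrightarrow> j = i" if "j < N" for j
      proof
        assume "w \<in> T j"
        then have "\<phi> i ` B i \<inter> \<phi> j ` B j \<noteq> {}" using i by (auto simp: T_def)
        then show "j = i" using disj i that unfolding disjoint_family_on_def by (metis lessThan_iff)
      qed (use i in simp)
      then have "(\<Sum>j<N. if w \<in> T j then e w else 0) = (\<Sum>j<N. if j = i then e w else 0)"
        by (intro sum.cong) auto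
      then show ?thesis using i by simp
    next
      case False
      then show ?thesis using eK[of w] by auto
    qed
  qed
  also have "integral UNIV e = 0"
  proof -
    have "set_integrable lborel UNIV e" using e_int by (simp add: set_integrable_def)
    from set_borel_integral_eq_integral(2)[OF this] show ?thesis
      using e(3) by (simp add: set_lebesgue_integral_def)
  qed
  finally show ?thesis .
qed

text \<open>The derivative of the volume is linear in the variation field, and a partition of unity
  subordinate to adapted charts reduces it to fields supported in one chart.\<close>

lemma minimal_of_constant_phase:
  fixes f :: "'a::euclidean_space \<Rightarrow> complex^('n::{finite,wellorder})"
  assumes charts: "\<And>x. x \<in> X \<Longrightarrow> \<exists>(W::(real^('n::_)) set) \<psi> \<pi>. adapted_chart X W \<psi> \<pi> \<and> x \<in> \<psi> ` W"
    and nd: "nondegenerate_immersion p X f" and lag: "lagrangian_immersion p X f"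
    and \<theta>: "\<theta> \<noteq> 0" "\<And>(W::(real^('n::_)) set) \<phi> u. local_parametrization X W \<phi> \<Longrightarrow> u \<in> W \<Longrightarrow> Im (det (jac (f \<circ> \<phi>) u) / \<theta>) = 0"
  shows "minimal_immersion p X f"
  unfolding minimal_immersion_def
proof (intro conjI allI impI nd)
  fix K \<delta> F N W and \<phi> :: "nat \<Rightarrow> real^('n::_) \<Rightarrow> 'a" and B
  assume "compact K \<and> K \<subseteq> X \<and> supported_variation X f K \<delta> F"
  then have K: "compact K" "K \<subseteq> X" and \<delta>: "\<delta> > 0" and F: "smooth_on ({-\<delta><..<\<delta>} \<times> X) (\<lambda>(t, x). F t x)"
    and F0: "\<And>x. x \<in> X \<Longrightarrow> F 0 x = f x" and FK: "\<And>t x. t \<in> {-\<delta><..<\<delta>} \<Longrightarrow> x \<in> X - K \<Longrightarrow> F t x = f x"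
    unfolding supported_variation_def by auto
  assume dec: "volume_decomposition X K N W \<phi> B"
  have f: "smooth_on X f" using nd unfolding nondegenerate_immersion_def immersion_on_def by blast
  have L: "linear (frechet_derivative (f \<circ> \<phi>) (at u))" if "local_parametrization X W \<phi>" "u \<in> W" for W \<phi> and u :: "real^('n::_)"
    using ck_on_has_derivative[OF ck_on_comp_parametrization[OF f that(1)] that(2)] has_derivative_linear by blast
  have lag': "Im (herm_form p (frechet_derivative (f \<circ> \<phi>) (at u) v) (frechet_derivative (f \<circ> \<phi>) (at u) w)) = 0"
    if "local_parametrization X W \<phi>" "u \<in> W" for W \<phi> and u v w :: "real^('n::_)"
    using lag that unfolding lagrangian_immersion_def symplectic_form_def by simp
  have D: "det (jac (f \<circ> \<phi>) u) \<noteq> 0" if "local_parametrization X W \<phi>" "u \<in> W" for W \<phi> and u :: "real^('n::_)"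
    using lagrangian_nondegenerate_iff[OF L[OF that] lag'[OF that]] nd that
    unfolding nondegenerate_immersion_def jac_def by simp
  define V where "V = variation_field F"
  have V: "smooth_on X V" unfolding V_def by (rule smooth_on_variation_field[OF F \<delta>])
  have VK: "V x = 0" if "x \<in> X" "x \<notin> K" for x
  proof -
    have "((\<lambda>t. F t x) has_vector_derivative 0) (at 0)"
      by (rule has_vector_derivative_transform_within_open[of "\<lambda>t. f x" _ _ "{-\<delta><..<\<delta>}"]) (use FK that \<delta> in auto)
    then show ?thesis unfolding V_def variation_field_def by (rule vector_derivative_at)
  qed
  have decD: "local_parametrization X (W i) (\<phi> i)" "B i \<in> sets borel" "bounded (B i)" "closure (B i) \<subseteq> W i" if "i < N" for i
    using dec that unfolding volume_decomposition_def by auto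
  have "((\<lambda>t. volume p (F t) N \<phi> B) has_real_derivative
     (\<Sum>i<N. LINT u:B i|lborel. variation_density (f \<circ> \<phi> i) (V \<circ> \<phi> i) u)) (at 0)"
    unfolding volume_def V_def
  proof (rule DERIV_sum)
    fix i assume "i \<in> {..<N}"
    then have i: "i < N" by simp
    show "((\<lambda>t. LINT u:B i|lborel. sqrt \<bar>det (gram_matrix p (F t \<circ> \<phi> i) u)\<bar>) has_real_derivative
      (LINT u:B i|lborel. variation_density (f \<circ> \<phi> i) (variation_field F \<circ> \<phi> i) u)) (at 0)"
      by (rule volume_piece_derivative[OF F \<delta> F0 decD(1)[OF i] _ D[OF decD(1)[OF i]] decD(2-4)[OF i]])
        (use lag'[OF decD(1)[OF i]] in simp_all)
  qed
  moreover have "(\<Sum>i<N. LINT u:B i|lborel. variation_density (f \<circ> \<phi> i) (V \<circ> \<phi> i) u) = 0"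
  proof -
    \<comment> \<open>Closed balls, so that intersecting with \<open>K\<close> gives compact sets
      inside the charts.\<close>
    have "\<forall>x\<in>K. \<exists>\<rho> (W::(real^('n::_)) set) \<psi> \<pi>. \<rho> > 0 \<and> adapted_chart X W \<psi> \<pi> \<and> cball x \<rho> \<inter> X \<subseteq> \<psi> ` W"
    proof
      fix x assume "x \<in> K"
      then obtain W :: "(real^('n::_)) set" and \<psi> \<pi> where c: "adapted_chart X W \<psi> \<pi>" "x \<in> \<psi> ` W"
        using charts K by blast
      then have "openin (top_of_set X) (\<psi> ` W)" unfolding adapted_chart_def by (blast dest: local_parametrizationD(4))
      then obtain \<rho> where "\<rho> > 0" "cball x \<rho> \<inter> X \<subseteq> \<psi> ` W"
        using c(2) unfolding openin_contains_cball by blast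
      then show "\<exists>\<rho> (W::(real^('n::_)) set) \<psi> \<pi>. \<rho> > 0 \<and> adapted_chart X W \<psi> \<pi> \<and> cball x \<rho> \<inter> X \<subseteq> \<psi> ` W"
        using c(1) by blast
    qed
    from bchoice[OF this] obtain \<rho> where \<rho>: "\<forall>x\<in>K. \<exists>(W::(real^('n::_)) set) \<psi> \<pi>. \<rho> x > 0 \<and> adapted_chart X W \<psi> \<pi> \<and> cball x (\<rho> x) \<inter> X \<subseteq> \<psi> ` W"
      by blast
    have "K \<subseteq> (\<Union>x\<in>K. ball x (\<rho> x))" using \<rho> by force
    then obtain T where T: "T \<subseteq> K" "finite T" "K \<subseteq> (\<Union>x\<in>T. ball x (\<rho> x))"
      using compactE_image[OF K(1), of K "\<lambda>x. ball x (\<rho> x)"] by blast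
    define \<sigma> where "\<sigma> y = (\<Sum>x\<in>T. bump x (\<rho> x) y)" for y
    have \<sigma>ck: "ck_on k UNIV \<sigma>" for k unfolding \<sigma>_def by (intro ck_on_sum ck_on_bump open_UNIV)
    have \<sigma>pos: "\<sigma> y > 0" if yK: "y \<in> K" for y
    proof -
      obtain x where x: "x \<in> T" "dist x y < \<rho> x" using T(3) yK by auto
      then have "bump x (\<rho> x) y > 0" using \<rho> T(1) bump_pos_iff by blast
      then show ?thesis unfolding \<sigma>_def using x(1) T(2) bump_nonneg by (intro sum_pos2) auto
    qed
    \<comment> \<open>Dividing by \<open>\<sigma>\<close> makes the bumps add up to 1 on
      \<open>K\<close>. The result is smooth: near \<open>K\<close> one has \<open>\<sigma>\<close>
      positive and the quotient is 0 off \<open>K\<close> along with \<open>V\<close>, while away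
      from \<open>K\<close> the field is identically 0.\<close>
    define V' where "V' y = (if y \<in> K then inverse (\<sigma> y) *\<^sub>R V y else 0)" for y
    have V'K: "V' y = 0" if "y \<notin> K" for y using that by (simp add: V'_def)
    have V': "smooth_on X V'"
    proof (rule smooth_on_local)
      fix y assume y: "y \<in> X"
      show "\<exists>U. open U \<and> y \<in> U \<and> smooth_on (X \<inter> U) V'"
      proof (cases "y \<in> K")
        case True
        define U where "U = \<sigma> -` {0<..}"
        have U: "open U" unfolding U_def using \<sigma>ck[of 0] by (intro open_vimage) auto
        have "smooth_on (X \<inter> U) (\<lambda>y. inverse (\<sigma> y) *\<^sub>R V y)"
          by (intro smooth_on_scaleR smooth_on_inverse smooth_on_subset[OF V] smooth_onI[OF open_UNIV \<sigma>ck])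
            (auto simp: U_def)
        then have "smooth_on (X \<inter> U) V'"
          by (rule smooth_on_cong) (use VK in \<open>auto simp: V'_def\<close>)
        then show ?thesis using U \<sigma>pos[OF True] by (intro exI[of _ U]) (auto simp: U_def)
      next
        case False
        have "smooth_on (X \<inter> - K) V'"
          by (rule smooth_on_cong[OF smooth_on_const[of _ 0]]) (simp add: V'_def)
        then show ?thesis using K(1) compact_imp_closed False by (intro exI[of _ "- K"]) auto
      qed
    qed
    define Vx where "Vx x y = bump x (\<rho> x) y *\<^sub>R V' y" for x y
    have Vx: "smooth_on X (Vx x)" for x
      unfolding Vx_def by (intro smooth_on_scaleR V' smooth_onI[OF open_UNIV ck_on_bump]) auto
    have V_sum: "V y = (\<Sum>x\<in>T. Vx x y)" if "y \<in> X" for y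
    proof (cases "y \<in> K")
      case True
      have "(\<Sum>x\<in>T. Vx x y) = \<sigma> y *\<^sub>R V' y" unfolding Vx_def \<sigma>_def by (simp add: scaleR_sum_left)
      then show ?thesis using \<sigma>pos[OF True] True by (simp add: V'_def)
    next
      case False
      then show ?thesis using VK[OF that] by (simp add: Vx_def V'_def)
    qed
    have zero: "(\<Sum>i<N. LINT u:B i|lborel. variation_density (f \<circ> \<phi> i) (Vx x \<circ> \<phi> i) u) = 0" if x: "x \<in> T" for x
    proof -
      obtain W0 :: "(real^('n::_)) set" and \<psi> \<pi> where c: "\<rho> x > 0" "adapted_chart X W0 \<psi> \<pi>" "cball x (\<rho> x) \<inter> X \<subseteq> \<psi> ` W0"
        using \<rho> x T(1) by blast
      have lp0: "local_parametrization X W0 \<psi>" and \<pi>s: "smooth_on (\<psi> ` W0) \<pi>" and \<pi>: "\<And>w. w \<in> W0 \<Longrightarrow> \<pi> (\<psi> w) = w"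
        using c(2) unfolding adapted_chart_def by auto
      \<comment> \<open>The support in the chart: it is compact because \<open>\<pi>\<close> is
        continuous on the image and the closed ball meets \<open>K\<close> inside that
        image.\<close>
      define C where "C = \<pi> ` (K \<inter> cball x (\<rho> x))"
      have KW: "K \<inter> cball x (\<rho> x) \<subseteq> \<psi> ` W0" using c(3) K(2) by blast
      have C1: "compact C" unfolding C_def
        by (intro compact_continuous_image continuous_on_subset[OF smooth_on_continuous_on[OF \<pi>s] KW] compact_Int_closed K(1) closed_cball)
      have C2: "C \<subseteq> W0"
      proof
        fix z assume "z \<in> C"
        then obtain y where y: "y \<in> K \<inter> cball x (\<rho> x)" "z = \<pi> y" unfolding C_def by blast
        then obtain w where "w \<in> W0" "y = \<psi> w" using KW by blast
        then show "z \<in> W0" using \<pi> y(2) by simp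
      qed
      have C3: "Vx x y = 0" if y: "y \<in> X" "y \<notin> \<psi> ` C" for y
      proof (rule ccontr)
        assume ne: "Vx x y \<noteq> 0"
        then have "y \<in> K" using V'K by (auto simp: Vx_def)
        moreover have "y \<in> cball x (\<rho> x)" using ne bump_eq_0[OF c(1), of x y] by (force simp: Vx_def)
        ultimately have yy: "y \<in> K \<inter> cball x (\<rho> x)" by blast
        then obtain w where w: "w \<in> W0" "y = \<psi> w" using KW by blast
        have "\<pi> y \<in> C" using yy unfolding C_def by blast
        then have "\<psi> (\<pi> y) \<in> \<psi> ` C" by blast
        then show False using y(2) w \<pi> by simp
      qed
      have C4: "Vx x y = 0" if "y \<in> X" "y \<notin> K" for y using V'K[OF that(2)] by (simp add: Vx_def)
      show ?thesis
        by (rule first_variation_local_eq_0[OF f Vx c(2) C1 C2 C3 D \<theta> K(1) C4 dec])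
    qed
    have "(LINT u:B i|lborel. variation_density (f \<circ> \<phi> i) (V \<circ> \<phi> i) u) =
      (\<Sum>x\<in>T. LINT u:B i|lborel. variation_density (f \<circ> \<phi> i) (Vx x \<circ> \<phi> i) u)" if i: "i < N" for i
    proof -
      note lp = decD(1)[OF i] and Wi = local_parametrizationD[OF decD(1)[OF i]]
      have BW: "B i \<subseteq> W i" using decD(4)[OF i] closure_subset by blast
      have int: "set_integrable lborel (B i) (variation_density (f \<circ> \<phi> i) (Vx x \<circ> \<phi> i))" for x
      proof (rule set_integrable_on_compact[of "closure (B i)"])
        have "continuous_on (W i) (variation_density (f \<circ> \<phi> i) (Vx x \<circ> \<phi> i))"
          by (rule continuous_on_variation_density[OF Wi(1) ck_on_comp_parametrization[OF f lp] ck_on_comp_parametrization[OF Vx lp] D[OF lp]])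
        then show "continuous_on (closure (B i)) (variation_density (f \<circ> \<phi> i) (Vx x \<circ> \<phi> i))"
          using decD(4)[OF i] continuous_on_subset by blast
      qed (use decD[OF i] closure_subset in \<open>auto simp: compact_closure\<close>)
      have dens: "variation_density (f \<circ> \<phi> i) (V \<circ> \<phi> i) u = (\<Sum>x\<in>T. variation_density (f \<circ> \<phi> i) (Vx x \<circ> \<phi> i) u)" if u: "u \<in> W i" for u
      proof -
        have "jac (V \<circ> \<phi> i) u = jac (\<lambda>u. \<Sum>x\<in>T. (Vx x \<circ> \<phi> i) u) u"
          by (rule jac_cong[OF Wi(1) u]) (use V_sum Wi(3) in auto)
        also have "\<dots> = (\<Sum>x\<in>T. jac (Vx x \<circ> \<phi> i) u)"
        proof -
          have "((\<lambda>u. \<Sum>x\<in>T. (Vx x \<circ> \<phi> i) u) has_derivative (\<lambda>v. \<Sum>x\<in>T. frechet_derivative (Vx x \<circ> \<phi> i) (at u) v)) (at u)"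
            by (rule has_derivative_sum) (rule ck_on_has_derivative[OF ck_on_comp_parametrization[OF Vx lp] u])
          from frechet_derivative_eqI[OF this] show ?thesis by (simp add: jac_def vec_eq_iff)
        qed
        finally show ?thesis
          unfolding variation_density_def by (simp only: ddet_sum[OF T(2)] sum_distrib_left Re_sum sum_divide_distrib)
      qed
      have "(LINT u:B i|lborel. variation_density (f \<circ> \<phi> i) (V \<circ> \<phi> i) u) =
        (LINT u:B i|lborel. \<Sum>x\<in>T. variation_density (f \<circ> \<phi> i) (Vx x \<circ> \<phi> i) u)"
        by (rule set_lebesgue_integral_cong) (use decD(2)[OF i] dens BW in auto)
      also have "\<dots> = (\<Sum>x\<in>T. LINT u:B i|lborel. variation_density (f \<circ> \<phi> i) (Vx x \<circ> \<phi> i) u)"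
        unfolding set_lebesgue_integral_def scaleR_sum_right
        by (rule Bochner_Integration.integral_sum) (use int in \<open>simp add: set_integrable_def\<close>)
      finally show ?thesis .
    qed
    then have "(\<Sum>i<N. LINT u:B i|lborel. variation_density (f \<circ> \<phi> i) (V \<circ> \<phi> i) u) =
      (\<Sum>i<N. \<Sum>x\<in>T. LINT u:B i|lborel. variation_density (f \<circ> \<phi> i) (Vx x \<circ> \<phi> i) u)"
      by (intro sum.cong) auto
    also have "\<dots> = (\<Sum>x\<in>T. \<Sum>i<N. LINT u:B i|lborel. variation_density (f \<circ> \<phi> i) (Vx x \<circ> \<phi> i) u)"
      by (rule sum.swap)
    also have "\<dots> = 0" using zero by simp
    finally show ?thesis .
  qed
  ultimately show "((\<lambda>t. volume p (F t) N \<phi> B) has_real_derivative 0) (at 0)" by simp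
qed

section \<open>Minimality forces a stationary phase\<close>

lemma integral_positive_on_cball:
  fixes g :: "'a::euclidean_space \<Rightarrow> real"
  assumes "\<rho> > 0" and g: "continuous_on (cball a \<rho>) g" and nn: "\<And>x. x \<in> cball a \<rho> \<Longrightarrow> g x \<ge> 0" and pos: "\<And>x. x \<in> ball a \<rho> \<Longrightarrow> g x > 0"
  shows "(LINT x:cball a \<rho>|lborel. g x) \<noteq> 0"
proof
  assume 0: "(LINT x:cball a \<rho>|lborel. g x) = 0"
  have "integrable lborel (\<lambda>x. indicator (cball a \<rho>) x *\<^sub>R g x)"
    by (rule borel_integrable_compact) (use g in auto)
  moreover have "AE x in lborel. 0 \<le> indicator (cball a \<rho>) x *\<^sub>R g x"
  proof (rule AE_I2)
    fix x show "0 \<le> indicator (cball a \<rho>) x *\<^sub>R g x" using nn[of x] by (cases "x \<in> cball a \<rho>") auto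
  qed
  ultimately have "AE x in lborel. indicator (cball a \<rho>) x *\<^sub>R g x = 0"
    using 0 unfolding set_lebesgue_integral_def by (simp add: integral_nonneg_eq_0_iff_AE)
  from AE_E3[OF this] obtain N where N: "\<And>x. x \<in> space lborel - N \<Longrightarrow> indicator (cball a \<rho>) x *\<^sub>R g x = 0" "N \<in> null_sets lborel"
    by blast
  have "N \<in> null_sets lebesgue" using N(2) by (rule null_sets_completionI)
  then have "negligible N" by (simp add: negligible_iff_null_sets)
  moreover have "ball a \<rho> \<subseteq> N"
  proof
    fix x assume "x \<in> ball a \<rho>"
    then have "indicator (cball a \<rho>) x *\<^sub>R g x \<noteq> 0" using pos[of x] by (auto simp: indicator_def)
    then show "x \<in> N" using N(1)[of x] by auto
  qed
  ultimately have "negligible (ball a \<rho>)" by (rule negligible_subset)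
  then show False using open_not_negligible[of "ball a \<rho>"] assms(1) by auto
qed

text \<open>The test variation is \<open>\<i> b \<partial>\<^sub>j h\<close> with a bump function \<open>b\<close>: its density is
  \<open>- b Im (cnj D \<partial>\<^sub>j D) / \<bar>D\<bar>\<close> for \<open>D = det (jac h)\<close>.\<close>

lemma phase_stationary_of_minimal:
  fixes f :: "'a::euclidean_space \<Rightarrow> complex^('n::{finite,wellorder})" and W :: "(real^('n::_)) set"
  assumes \<psi>: "adapted_chart X W \<psi> \<pi>" and min: "minimal_immersion p X f" and lag: "lagrangian_immersion p X f"
    and u0: "u\<^sub>0 \<in> W"
  shows "Im (cnj (det (jac (f \<circ> \<psi>) u\<^sub>0)) * frechet_derivative (\<lambda>u. det (jac (f \<circ> \<psi>) u)) (at u\<^sub>0) v) = 0"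
proof -
  have lp: "local_parametrization X W \<psi>" and sm\<pi>: "smooth_on (\<psi> ` W) \<pi>" and \<pi>: "\<And>w. w \<in> W \<Longrightarrow> \<pi> (\<psi> w) = w"
    using \<psi> unfolding adapted_chart_def by auto
  note W = local_parametrizationD[OF lp]
  have nd: "nondegenerate_immersion p X f" using min unfolding minimal_immersion_def by blast
  have f: "smooth_on X f" using nd unfolding nondegenerate_immersion_def immersion_on_def by blast
  define h where "h = f \<circ> \<psi>"
  have h: "ck_on k W h" for k unfolding h_def by (rule ck_on_comp_parametrization[OF f lp])
  have L: "linear (frechet_derivative h (at u))" if "u \<in> W" for u
    using ck_on_has_derivative[OF h that] has_derivative_linear by blast
  have lag': "Im (herm_form p (frechet_derivative h (at u) v) (frechet_derivative h (at u) w)) = 0"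
    if "u \<in> W" for u v w
    using lag lp that unfolding lagrangian_immersion_def symplectic_form_def h_def by simp
  have D0: "det (jac h u) \<noteq> 0" if "u \<in> W" for u
    using lagrangian_nondegenerate_iff[OF L[OF that] lag'[OF that]] nd lp that
    unfolding nondegenerate_immersion_def jac_def h_def by simp
  define D where "D u = det (jac h u)" for u
  have D: "ck_on k W D" for k unfolding D_def by (rule ck_on_det[OF W(1) ck_on_jac[OF W(1) h]])
  have axis_case: "Im (cnj (D u\<^sub>0) * frechet_derivative D (at u\<^sub>0) (axis j 1)) = 0" for j
  proof (rule ccontr)
    define m where "m u = Im (cnj (D u) * frechet_derivative D (at u) (axis j 1))" for u
    assume "\<not> ?thesis"
    then have m0: "m u\<^sub>0 \<noteq> 0" by (simp add: m_def)
    \<comment> \<open>The sign that makes \<open>s * m\<close> positive at \<open>u\<^sub>0\<close>,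
      hence on a small closed ball; the integrand is then of one sign.\<close>
    define s where "s = sgn (m u\<^sub>0)"
    have s: "s \<noteq> 0" "s * m u\<^sub>0 > 0" using m0 by (auto simp: s_def sgn_if)
    have cD: "continuous_on W D" using D[of 0] by simp
    have cm: "continuous_on W m" unfolding m_def
      by (intro continuous_intros cD ck_on_frechet_continuous[OF D])
    have "open (W \<inter> (\<lambda>u. s * m u) -` {0<..})"
      by (rule continuous_open_preimage[OF _ W(1)]) (auto intro!: continuous_intros cm)
    moreover have "u\<^sub>0 \<in> W \<inter> (\<lambda>u. s * m u) -` {0<..}" using u0 s by simp
    ultimately obtain \<rho> where \<rho>: "\<rho> > 0" "cball u\<^sub>0 \<rho> \<subseteq> W \<inter> (\<lambda>u. s * m u) -` {0<..}"
      unfolding open_contains_cball by blast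
    let ?C = "cball u\<^sub>0 \<rho>"
    have mC: "s * m u > 0" if "u \<in> ?C" for u using \<rho> that by auto
    have CW: "?C \<subseteq> W" using \<rho> by auto
    define b where "b = bump u\<^sub>0 \<rho>"
    define V0 where "V0 w = (\<i> * of_real (b w)) *s frechet_derivative h (at w) (axis j 1)" for w
    have ib: "ck_on k UNIV (\<lambda>w. \<i> * complex_of_real (b w))" for k
      unfolding b_def by (intro ck_on_mult ck_on_const ck_on_bounded_linear[OF bounded_linear_of_real] ck_on_bump open_UNIV)
    have V0: "ck_on k W V0" for k
    proof -
      have "ck_on k W (\<lambda>w. \<chi> l. (\<i> * of_real (b w)) * frechet_derivative h (at w) (axis j 1) $ l)"
        using h[of "Suc k"] by (intro ck_on_vec ck_on_mult ck_on_nth W ck_on_subset[OF ib]) auto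
      then show ?thesis by (simp add: V0_def[abs_def] vector_scalar_mult_def)
    qed
    have V00: "V0 w = 0" if "w \<notin> ?C" for w
      using that bump_eq_0[OF \<rho>(1), of u\<^sub>0 w] by (simp add: V0_def b_def)
    define K where "K = \<psi> ` ?C"
    have K: "compact K" "K \<subseteq> X" "K \<subseteq> \<psi> ` W"
      unfolding K_def using CW W(3) compact_continuous_image[OF continuous_on_subset[OF W(7) CW]] by auto
    \<comment> \<open>The field lives in the chart; it is moved to \<open>X\<close> by
      \<open>\<pi>\<close> and extended by 0. Both descriptions agree on the part of the chart
      outside \<open>K\<close> because the bump vanishes there.\<close>
    define Vx where "Vx x = (if x \<in> K then V0 (\<pi> x) else 0)" for x
    have Vx_\<psi>: "Vx (\<psi> w) = V0 w" if "w \<in> W" for w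
    proof (cases "w \<in> ?C")
      case True
      then have "\<psi> w \<in> K" unfolding K_def by blast
      then show ?thesis using \<pi>[OF that] by (simp add: Vx_def)
    next
      case False
      have "\<psi> w \<notin> K"
      proof
        assume "\<psi> w \<in> K"
        then obtain w' where w': "w' \<in> ?C" "\<psi> w = \<psi> w'" unfolding K_def by blast
        have "w = w'" by (rule inj_onD[OF W(5) w'(2) that]) (use w'(1) CW in blast)
        then show False using w'(1) False by blast
      qed
      then show ?thesis using V00[OF False] by (simp add: Vx_def)
    qed
    have Vx: "smooth_on X Vx"
    proof (rule smooth_on_local)
      fix x assume x: "x \<in> X"
      show "\<exists>U. open U \<and> x \<in> U \<and> smooth_on (X \<inter> U) Vx"
      proof (cases "x \<in> \<psi> ` W")
        case True
        obtain U where U: "open U" "\<psi> ` W = X \<inter> U" using W(4) unfolding openin_open by blast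
        have "smooth_on (\<psi> ` W) (\<lambda>x. V0 (\<pi> x))"
          by (rule smooth_on_compose[OF sm\<pi> smooth_onI[OF W(1) V0]]) (use \<pi> in auto)
        then have "smooth_on (\<psi> ` W) Vx"
          by (rule smooth_on_cong) (use Vx_\<psi> \<pi> in auto)
        then show ?thesis using U True by auto
      next
        case False
        have "smooth_on (X \<inter> - K) Vx"
          by (rule smooth_on_cong[OF smooth_on_const[of _ 0]]) (simp add: Vx_def)
        then show ?thesis using K compact_imp_closed False by (intro exI[of _ "- K"]) auto
      qed
    qed
    define F where "F t x = f x + t *\<^sub>R Vx x" for t x
    have F: "smooth_on ({-1<..<1} \<times> X) (\<lambda>(t, x). F t x)"
    proof -
      have "smooth_on ({-1<..<1} \<times> X) (\<lambda>z. f (snd z) + fst z *\<^sub>R Vx (snd z))"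
        by (intro smooth_on_add smooth_on_scaleR smooth_on_fst smooth_on_ident
            smooth_on_compose[OF smooth_on_snd[OF smooth_on_ident] f] smooth_on_compose[OF smooth_on_snd[OF smooth_on_ident] Vx]) auto
      then show ?thesis by (simp add: F_def case_prod_beta')
    qed
    have sv: "supported_variation X f K 1 F"
      unfolding supported_variation_def by (intro conjI F) (auto simp: F_def Vx_def)
    \<comment> \<open>The ball alone is an admissible decomposition of its image \<open>K\<close>,
      so minimality becomes a statement about one integral in this chart.\<close>
    have vd: "volume_decomposition X K 1 (\<lambda>_. W) (\<lambda>_. \<psi>) (\<lambda>_. ?C)"
      unfolding volume_decomposition_def using lp CW by (auto simp: K_def disjoint_family_on_def)
    have "((\<lambda>t. volume p (F t) 1 (\<lambda>_. \<psi>) (\<lambda>_. ?C)) has_real_derivative 0) (at 0)"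
      using min K(1,2) sv vd unfolding minimal_immersion_def by blast
    then have 1: "((\<lambda>t. LINT u:?C|lborel. sqrt \<bar>det (gram_matrix p (F t \<circ> \<psi>) u)\<bar>) has_real_derivative 0) (at 0)"
      unfolding volume_def by simp
    have 2: "((\<lambda>t. LINT u:?C|lborel. sqrt \<bar>det (gram_matrix p (F t \<circ> \<psi>) u)\<bar>) has_real_derivative
       (LINT u:?C|lborel. variation_density (f \<circ> \<psi>) (variation_field F \<circ> \<psi>) u)) (at 0)"
    proof (rule volume_piece_derivative[OF F _ _ lp])
      show "F 0 x = f x" for x by (simp add: F_def)
      show "Im (herm_form p (jac (f \<circ> \<psi>) u $ i) (jac (f \<circ> \<psi>) u $ k)) = 0" if "u \<in> W" for u i k
        using lag'[OF that] by (simp add: h_def)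
      show "det (jac (f \<circ> \<psi>) u) \<noteq> 0" if "u \<in> W" for u
        using D0[OF that] by (simp add: h_def)
    qed (use CW in auto)
    have "variation_field F x = Vx x" for x
    proof -
      have "((\<lambda>t. F t x) has_vector_derivative Vx x) (at 0)"
        unfolding F_def by (auto intro!: derivative_eq_intros)
      then show ?thesis unfolding variation_field_def by (rule vector_derivative_at)
    qed
    then have vf: "variation_field F = Vx" by (rule ext)
    have dens: "variation_density h (Vx \<circ> \<psi>) u = - (b u * m u / cmod (D u))" if u: "u \<in> W" for u
    proof -
      have "variation_density h (Vx \<circ> \<psi>) u = variation_density h V0 u"
        by (rule variation_density_cong[OF W(1) u]) (use Vx_\<psi> in auto)
      also have "ddet (jac h u) (jac V0 u) = frechet_derivative (\<lambda>x. (\<i> * of_real (b x)) * D x) (at u) (axis j 1)"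
        unfolding V0_def[abs_def] D_def
        by (rule ddet_jac_tangential[OF W(1) u h differentiableI[OF ck_on_has_derivative[OF ib UNIV_I]]])
      then have "variation_density h V0 u = Re (cnj (D u) * frechet_derivative (\<lambda>x. (\<i> * of_real (b x)) * D x) (at u) (axis j 1)) / cmod (D u)"
        by (simp add: variation_density_def D_def)
      also have "frechet_derivative (\<lambda>x. (\<i> * of_real (b x)) * D x) (at u) (axis j 1) =
         \<i> * (of_real (b u) * frechet_derivative D (at u) (axis j 1) + of_real (frechet_derivative b (at u) (axis j 1)) * D u)"
      proof -
        have bd: "(b has_derivative frechet_derivative b (at u)) (at u)"
          unfolding b_def by (rule ck_on_has_derivative[OF ck_on_bump]) simp
        have "((\<lambda>x. (\<i> * of_real (b x)) * D x) has_derivative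
           (\<lambda>v. \<i> * of_real (b u) * frechet_derivative D (at u) v + (\<i> * of_real (frechet_derivative b (at u) v)) * D u)) (at u)"
          by (rule has_derivative_mult[OF has_derivative_mult_right[OF bounded_linear.has_derivative[OF bounded_linear_of_real bd]] ck_on_has_derivative[OF D u]])
        from frechet_derivative_eqI[OF this] show ?thesis by (simp add: algebra_simps)
      qed
      \<comment> \<open>The term with the derivative of \<open>b\<close> is \<i> |D|^2 times a real
        number and has real part 0, which is what the factor \<i> in the field achieves.\<close>
      also have "Re (cnj (D u) * (\<i> * (of_real (b u) * frechet_derivative D (at u) (axis j 1) + of_real (frechet_derivative b (at u) (axis j 1)) * D u))) = - (b u * m u)"
        by (simp add: m_def algebra_simps)
      finally show ?thesis by (simp only: minus_divide_left)
    qed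
    have "(LINT u:?C|lborel. variation_density h (Vx \<circ> \<psi>) u) = 0"
      using DERIV_unique[OF 1 2] unfolding vf h_def by simp
    then have "(LINT u:?C|lborel. - (b u * m u / cmod (D u))) = 0"
      by (subst (asm) set_lebesgue_integral_cong[where g = "\<lambda>u. - (b u * m u / cmod (D u))"]) (use dens CW in auto)
    then have "s * (LINT u:?C|lborel. - (b u * m u / cmod (D u))) = 0" by simp
    then have "(LINT u:?C|lborel. s * - (b u * m u / cmod (D u))) = 0"
      by (simp only: set_integral_mult_right)
    then have "- (LINT u:?C|lborel. b u * (s * m u) / cmod (D u)) = 0"
      by (simp only: set_lebesgue_integral_def integral_minus[symmetric]) (simp add: algebra_simps)
    moreover have "(LINT u:?C|lborel. b u * (s * m u) / cmod (D u)) \<noteq> 0"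
    proof (rule integral_positive_on_cball[OF \<rho>(1)])
      have "continuous_on ?C b" using ck_on_bump[of 0 u\<^sub>0 \<rho>] continuous_on_subset unfolding b_def by auto
      then show "continuous_on ?C (\<lambda>u. b u * (s * m u) / cmod (D u))"
        using D0 CW continuous_on_subset[OF cm CW] continuous_on_subset[OF cD CW]
        by (intro continuous_intros) (auto simp: D_def)
      show "0 \<le> b u * (s * m u) / cmod (D u)" if "u \<in> ?C" for u
        using mC[OF that] bump_nonneg[of u\<^sub>0 \<rho> u] by (simp add: b_def)
      show "0 < b u * (s * m u) / cmod (D u)" if "u \<in> ball u\<^sub>0 \<rho>" for u
      proof -
        have uC: "u \<in> ?C" using that by simp
        have "D u \<noteq> 0" using D0[of u] uC CW by (auto simp: D_def)
        moreover have "b u > 0" using that bump_pos_iff[OF \<rho>(1), of u\<^sub>0 u] by (simp add: b_def)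
        ultimately show ?thesis using mC[OF uC] using mult_pos_pos[of "b u" "s * m u"] by simp
      qed
    qed
    ultimately show False by simp
  qed
  have lin: "linear (frechet_derivative D (at u\<^sub>0))"
    using ck_on_has_derivative[OF D u0] has_derivative_linear by blast
  \<comment> \<open>The condition is real linear in the direction, so the coordinate directions
    suffice.\<close>
  have "Im (cnj (D u\<^sub>0) * frechet_derivative D (at u\<^sub>0) v) = (\<Sum>i\<in>UNIV. v $ i * Im (cnj (D u\<^sub>0) * frechet_derivative D (at u\<^sub>0) (axis i 1)))"
    by (subst linear_axis_expansion[OF lin]) (simp only: sum_distrib_left Im_sum mult_scaleR_right scaleR_complex.sel)
  then show ?thesis using axis_case by (simp add: D_def[abs_def] h_def)
qed

section \<open>Invariance under isometries\<close>

lemma affine_isometryE: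
  assumes "affine_isometry p \<Phi>"
  obtains A b where "bounded_linear A" "linear A" "\<And>z w. metric p (A z) (A w) = metric p z w" "\<And>z. \<Phi> z = A z + b"
  using assms unfolding affine_isometry_def by (metis linear_conv_bounded_linear)

lemma frechet_affine_isometry:
  assumes "bounded_linear A" "\<And>z. \<Phi> z = A z + b" "g differentiable at u"
  shows "frechet_derivative (\<lambda>x. \<Phi> (g x)) (at u) = (\<lambda>v. A (frechet_derivative g (at u) v))"
proof (rule frechet_derivative_eqI)
  have "((\<lambda>x. A (g x) + b) has_derivative (\<lambda>v. A (frechet_derivative g (at u) v) + 0)) (at u)"
    by (rule has_derivative_add[OF bounded_linear.has_derivative[OF assms(1) assms(3)[unfolded frechet_derivative_works]] has_derivative_const])
  then show "((\<lambda>x. \<Phi> (g x)) has_derivative (\<lambda>v. A (frechet_derivative g (at u) v))) (at u)"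
    by (simp add: assms(2))
qed

lemma smooth_on_affine:
  fixes A :: "'b::euclidean_space \<Rightarrow> 'c::euclidean_space"
  assumes "bounded_linear A" "\<And>z. \<Phi> z = A z + b" "smooth_on S g"
  shows "smooth_on S (\<lambda>x. \<Phi> (g x))"
  unfolding assms(2) by (intro smooth_on_add smooth_on_bounded_linear[OF assms(1)] assms(3) smooth_on_const)

text \<open>Injectivity of the new differential is read off from non-degeneracy as well: a vector
  mapped to 0 would be orthogonal to all others.\<close>

lemma nondegenerate_immersion_isometry:
  fixes f :: "'a::euclidean_space \<Rightarrow> complex^('n::{finite,wellorder})"
  assumes f: "nondegenerate_immersion p X f" and \<Phi>: "affine_isometry p \<Phi>"
  shows "nondegenerate_immersion p X (\<lambda>x. \<Phi> (f x))"
proof -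
  obtain A b where A: "bounded_linear A" "linear A" "\<And>z w. metric p (A z) (A w) = metric p z w" "\<And>z. \<Phi> z = A z + b"
    using affine_isometryE[OF \<Phi>] by blast
  have sf: "smooth_on X f" using f unfolding nondegenerate_immersion_def immersion_on_def by blast
  have fd: "frechet_derivative ((\<lambda>x. \<Phi> (f x)) \<circ> \<phi>) (at u) = (\<lambda>v. A (frechet_derivative (f \<circ> \<phi>) (at u) v))"
    if "local_parametrization X W \<phi>" "u \<in> W" for W \<phi> and u :: "real^('n::_)"
    using frechet_affine_isometry[OF A(1,4) differentiableI[OF ck_on_has_derivative[OF ck_on_comp_parametrization[OF sf that(1)] that(2)]]]
    by (simp add: o_def)
  have nd: "v = 0" if "local_parametrization X W \<phi>" "u \<in> W"
    "\<forall>w. metric p (A (frechet_derivative (f \<circ> \<phi>) (at u) v)) (A (frechet_derivative (f \<circ> \<phi>) (at u) w)) = 0" for W \<phi> and u v :: "real^('n::_)"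
    using f that unfolding nondegenerate_immersion_def A(3) by blast
  show ?thesis
    unfolding nondegenerate_immersion_def immersion_on_def
  proof (intro conjI allI impI ballI)
    show "smooth_on X (\<lambda>x. \<Phi> (f x))" by (rule smooth_on_affine[OF A(1,4) sf])
    fix W :: "(real^('n::_)) set" and \<phi> u
    assume lp: "local_parametrization X W \<phi>" and u: "u \<in> W"
    have lin: "linear (frechet_derivative (f \<circ> \<phi>) (at u))"
      using ck_on_has_derivative[OF ck_on_comp_parametrization[OF sf lp] u] has_derivative_linear by blast
    have linA: "linear (\<lambda>v. A (frechet_derivative (f \<circ> \<phi>) (at u) v))"
      using linear_compose[OF lin A(2)] by (simp add: o_def)
    show "inj (frechet_derivative ((\<lambda>x. \<Phi> (f x)) \<circ> \<phi>) (at u))"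
      unfolding fd[OF lp u] linear_injective_0[OF linA]
    proof (intro allI impI)
      fix v assume "A (frechet_derivative (f \<circ> \<phi>) (at u) v) = 0"
      then have "\<forall>w. metric p (A (frechet_derivative (f \<circ> \<phi>) (at u) v)) (A (frechet_derivative (f \<circ> \<phi>) (at u) w)) = 0"
        by (simp add: metric_def herm_form_sum)
      then show "v = 0" by (rule nd[OF lp u])
    qed
    fix v assume "\<forall>w. metric p (frechet_derivative ((\<lambda>x. \<Phi> (f x)) \<circ> \<phi>) (at u) v) (frechet_derivative ((\<lambda>x. \<Phi> (f x)) \<circ> \<phi>) (at u) w) = 0"
    then show "v = 0" unfolding fd[OF lp u] by (rule nd[OF lp u])
  qed
qed

text \<open>Composition with \<open>\<Phi>\<close> turns a variation of \<open>f\<close> into one of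
  the composed map. A real isometry preserves the Gram matrices, so both variations have the same
  volume for every \<open>t\<close>.\<close>

lemma minimal_immersion_isometry:
  fixes f :: "'a::euclidean_space \<Rightarrow> complex^('n::{finite,wellorder})"
  assumes f: "nondegenerate_immersion p X f" and \<Phi>: "affine_isometry p \<Phi>"
    and min: "minimal_immersion p X (\<lambda>x. \<Phi> (f x))"
  shows "minimal_immersion p X f"
  unfolding minimal_immersion_def
proof (intro conjI allI impI f)
  obtain A b where A: "bounded_linear A" "linear A" "\<And>z w. metric p (A z) (A w) = metric p z w" "\<And>z. \<Phi> z = A z + b"
    using affine_isometryE[OF \<Phi>] by blast
  fix K \<delta> F N W and \<phi> :: "nat \<Rightarrow> real^('n::_) \<Rightarrow> 'a" and B
  assume "compact K \<and> K \<subseteq> X \<and> supported_variation X f K \<delta> F"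
  then have K: "compact K" "K \<subseteq> X" and sv: "supported_variation X f K \<delta> F" by auto
  assume dec: "volume_decomposition X K N W \<phi> B"
  have \<delta>: "\<delta> > 0" and F: "smooth_on ({-\<delta><..<\<delta>} \<times> X) (\<lambda>(t, x). F t x)"
    using sv unfolding supported_variation_def by auto
  have "smooth_on ({-\<delta><..<\<delta>} \<times> X) (\<lambda>z. \<Phi> ((\<lambda>(t, x). F t x) z))"
    by (rule smooth_on_affine[OF A(1,4) F])
  then have "supported_variation X (\<lambda>x. \<Phi> (f x)) K \<delta> (\<lambda>t x. \<Phi> (F t x))"
    using sv unfolding supported_variation_def by (simp add: case_prod_beta')
  then have der: "((\<lambda>t. volume p (\<lambda>x. \<Phi> (F t x)) N \<phi> B) has_real_derivative 0) (at 0)"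
    using min K dec unfolding minimal_immersion_def by blast
  show "((\<lambda>t. volume p (F t) N \<phi> B) has_real_derivative 0) (at 0)"
  proof (rule has_field_derivative_transform_within_open[OF der, of "{-\<delta><..<\<delta>}"])
    fix t assume t: "t \<in> {-\<delta><..<\<delta>}"
    have Ft: "smooth_on X (F t)"
    proof -
      have "smooth_on X (\<lambda>x. (t, x))" by (intro smooth_on_Pair smooth_on_const smooth_on_ident)
      moreover have "(\<lambda>x. (t, x)) ` X \<subseteq> {-\<delta><..<\<delta>} \<times> X" using t by auto
      ultimately have "smooth_on X (\<lambda>x. (\<lambda>(t, x). F t x) (t, x))" by (rule smooth_on_compose[OF _ F])
      then show ?thesis by simp
    qed
    show "volume p (\<lambda>x. \<Phi> (F t x)) N \<phi> B = volume p (F t) N \<phi> B"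
      unfolding volume_def
    proof (intro sum.cong refl set_lebesgue_integral_cong allI impI)
      fix i assume "i \<in> {..<N}"
      then have i: "local_parametrization X (W i) (\<phi> i)" "closure (B i) \<subseteq> W i" "B i \<in> sets borel"
        using dec unfolding volume_decomposition_def by auto
      then show "B i \<in> sets lborel" by simp
      fix u assume "u \<in> B i"
      then have u: "u \<in> W i" using i(2) closure_subset by blast
      have "frechet_derivative ((\<lambda>x. \<Phi> (F t x)) \<circ> \<phi> i) (at u) = (\<lambda>v. A (frechet_derivative (F t \<circ> \<phi> i) (at u) v))"
        using frechet_affine_isometry[OF A(1,4) differentiableI[OF ck_on_has_derivative[OF ck_on_comp_parametrization[OF Ft i(1)] u]]]
        by (simp add: o_def)
      then show "sqrt \<bar>det (gram_matrix p ((\<lambda>x. \<Phi> (F t x)) \<circ> \<phi> i) u)\<bar> = sqrt \<bar>det (gram_matrix p (F t \<circ> \<phi> i) u)\<bar>"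
        by (simp add: gram_matrix_def A(3))
    qed
  qed (use \<delta> in auto)
qed

section \<open>Matrix exponentials\<close>

lemma sums_vec:
  fixes f :: "nat \<Rightarrow> 'a::real_normed_vector^'n"
  assumes "\<And>i. (\<lambda>k. f k $ i) sums (s $ i)"
  shows "f sums s"
  unfolding sums_def by (rule vec_tendstoI) (use assms in \<open>simp add: sums_def\<close>)

definition matpow :: "complex^'n^'n \<Rightarrow> nat \<Rightarrow> complex^'n^'n" where
  "matpow A k = ((**) A ^^ k) (mat 1)"

lemma matpow_0 [simp]: "matpow A 0 = mat 1" and matpow_Suc: "matpow A (Suc k) = A ** matpow A k"
  by (simp_all add: matpow_def)

lemma matpow_commute: "matpow A k ** A = A ** matpow A k"
  by (induction k) (simp_all add: matpow_Suc matrix_mul_assoc[symmetric])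

lemma matpow_scaleR: "matpow (s *\<^sub>R A) k = s ^ k *\<^sub>R matpow A k"
proof (induction k)
  case (Suc k)
  then show ?case
    by (simp add: matpow_Suc matrix_matrix_mult_def vec_eq_iff scaleR_sum_right algebra_simps)
qed simp

text \<open>The sum of the moduli of all entries serves as a submultiplicative bound, so the
  exponential series can be compared with a scalar one, entry by entry.\<close>

lemma matpow_bound: "cmod (matpow A k $ i $ j) \<le> (\<Sum>i\<in>UNIV. \<Sum>j\<in>UNIV. cmod (A $ i $ j)) ^ k"
proof (induction k arbitrary: i)
  case 0
  then show ?case by (simp add: mat_def)
next
  case (Suc k)
  let ?c = "\<Sum>i\<in>UNIV. \<Sum>j\<in>UNIV. cmod (A $ i $ j)"
  have "cmod (matpow A (Suc k) $ i $ j) \<le> (\<Sum>l\<in>UNIV. cmod (A $ i $ l) * cmod (matpow A k $ l $ j))"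
    unfolding matpow_Suc matrix_matrix_mult_def by (simp add: norm_mult[symmetric] norm_sum)
  also have "\<dots> \<le> (\<Sum>l\<in>UNIV. cmod (A $ i $ l) * ?c ^ k)"
    by (intro sum_mono mult_left_mono Suc.IH) auto
  also have "\<dots> = (\<Sum>l\<in>UNIV. cmod (A $ i $ l)) * ?c ^ k" by (simp add: sum_distrib_right)
  also have "\<dots> \<le> ?c * ?c ^ k"
    by (intro mult_right_mono member_le_sum zero_le_power sum_nonneg) (auto intro: sum_nonneg)
  finally show ?case by simp
qed

text \<open>An entry of the exponential of z A, as a power series in a complex variable; in this
  form the termwise differentiation of power series applies.\<close>

definition matrix_exp_series :: "complex^'n^'n \<Rightarrow> 'n \<Rightarrow> 'n \<Rightarrow> complex \<Rightarrow> complex" where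
  "matrix_exp_series A i j z = (\<Sum>k. (matpow A k $ i $ j / fact k) * z ^ k)"

lemma matrix_exp_series_summable: "summable (\<lambda>k. (matpow A k $ i $ j / fact k) * z ^ k)"
proof (rule summable_comparison_test')
  let ?c = "\<Sum>i\<in>UNIV. \<Sum>j\<in>UNIV. cmod (A $ i $ j)"
  show "summable (\<lambda>k. (?c * cmod z) ^ k /\<^sub>R fact k)" by (rule summable_exp_generic)
  fix k
  have "norm (matpow A k $ i $ j / fact k * z ^ k) = cmod (matpow A k $ i $ j) * cmod z ^ k / fact k"
    by (simp add: norm_mult norm_divide norm_power)
  also have "\<dots> \<le> ?c ^ k * cmod z ^ k / fact k"
    by (intro divide_right_mono mult_right_mono matpow_bound) auto
  finally show "norm (matpow A k $ i $ j / fact k * z ^ k) \<le> (?c * cmod z) ^ k /\<^sub>R fact k"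
    by (simp add: power_mult_distrib divide_inverse mult.commute)
qed

lemma matrix_exp_sums:
  "(\<lambda>k. matpow (s *\<^sub>R A) k /\<^sub>R fact k) sums (\<chi> i j. matrix_exp_series A i j (of_real s))"
proof (rule sums_vec, rule sums_vec)
  fix i j
  have "(\<lambda>k. (matpow A k $ i $ j / fact k) * of_real s ^ k) sums matrix_exp_series A i j (of_real s)"
    unfolding matrix_exp_series_def by (rule summable_sums[OF matrix_exp_series_summable])
  then show "(\<lambda>k. (matpow (s *\<^sub>R A) k /\<^sub>R fact k) $ i $ j) sums ((\<chi> i j. matrix_exp_series A i j (of_real s)) $ i $ j)"
    by (simp add: matpow_scaleR scaleR_conv_of_real[where 'a=complex] field_simps)
qed

lemma matrix_exp_entry: "matrix_exp (s *\<^sub>R A) = (\<chi> i j. matrix_exp_series A i j (of_real s))"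
  unfolding matrix_exp_def matpow_def[symmetric] by (rule sums_unique[OF matrix_exp_sums, symmetric])

lemma matrix_exp_series_0: "matrix_exp_series A i j 0 = mat 1 $ i $ j"
  unfolding matrix_exp_series_def powser_zero by simp

lemma matrix_exp_zero: "matrix_exp (0 *\<^sub>R A) = mat 1"
  unfolding matrix_exp_entry by (simp add: matrix_exp_series_0 vec_eq_iff)

lemma matrix_exp_series_derivative:
  "(matrix_exp_series A i j has_field_derivative (\<Sum>l\<in>UNIV. A $ i $ l * matrix_exp_series A l j z)) (at z)"
proof -
  let ?c = "\<lambda>k. matpow A k $ i $ j / fact k"
  have "(matrix_exp_series A i j has_field_derivative (\<Sum>k. diffs ?c k * z ^ k)) (at z)"
    unfolding matrix_exp_series_def[abs_def] by (rule termdiffs_strong_converges_everywhere[OF matrix_exp_series_summable])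
  moreover have "diffs ?c k * z ^ k = (\<Sum>l\<in>UNIV. A $ i $ l * ((matpow A k $ l $ j / fact k) * z ^ k))" for k
  proof -
    have "diffs ?c k = (\<Sum>l\<in>UNIV. A $ i $ l * matpow A k $ l $ j) / fact k"
      by (simp add: diffs_def matpow_Suc matrix_matrix_mult_def del: of_nat_Suc)
    then show ?thesis by (simp add: sum_distrib_right sum_divide_distrib mult.assoc)
  qed
  moreover have "(\<Sum>k. \<Sum>l\<in>UNIV. A $ i $ l * ((matpow A k $ l $ j / fact k) * z ^ k)) = (\<Sum>l\<in>UNIV. A $ i $ l * matrix_exp_series A l j z)"
    unfolding matrix_exp_series_def
    by (subst suminf_sum, rule summable_mult[OF matrix_exp_series_summable]) (simp only: suminf_mult[OF matrix_exp_series_summable])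
  ultimately show ?thesis by (simp only:)
qed

lemma matrix_exp_has_vector_derivative:
  "((\<lambda>s. matrix_exp (s *\<^sub>R A) $ i $ j) has_vector_derivative (A ** matrix_exp (s *\<^sub>R A)) $ i $ j) (at s)"
proof -
  have "((\<lambda>s. matrix_exp_series A i j (of_real s)) has_vector_derivative 1 * (\<Sum>l\<in>UNIV. A $ i $ l * matrix_exp_series A l j (of_real s))) (at s)"
    by (rule field_vector_diff_chain_at[of of_real 1 s "matrix_exp_series A i j", unfolded o_def])
      (auto intro!: matrix_exp_series_derivative derivative_eq_intros)
  then show ?thesis by (simp add: matrix_exp_entry matrix_matrix_mult_def)
qed

lemma matrix_exp_commute: "matrix_exp (s *\<^sub>R A) ** A = A ** matrix_exp (s *\<^sub>R A)"
proof -
  let ?T = "\<lambda>k. matpow (s *\<^sub>R A) k /\<^sub>R fact k"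
  have R: "bounded_linear (\<lambda>X. X ** A)" and L: "bounded_linear (\<lambda>X. A ** X)"
    unfolding linear_conv_bounded_linear[symmetric]
    by (auto intro!: linearI simp: matrix_matrix_mult_def vec_eq_iff sum.distrib[symmetric] scaleR_sum_right algebra_simps)
  have eq: "?T k ** A = A ** ?T k" for k
    using matpow_commute[of A k] 
    by (simp add: matpow_scaleR linear_cmul[OF bounded_linear.linear[OF R]] linear_cmul[OF bounded_linear.linear[OF L]])
  have "(\<lambda>k. ?T k ** A) sums (matrix_exp (s *\<^sub>R A) ** A)"
    unfolding matrix_exp_entry by (rule bounded_linear.sums[OF R matrix_exp_sums])
  moreover have "(\<lambda>k. A ** ?T k) sums (A ** matrix_exp (s *\<^sub>R A))"
    unfolding matrix_exp_entry by (rule bounded_linear.sums[OF L matrix_exp_sums])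
  ultimately show ?thesis unfolding eq by (rule sums_unique2)
qed

text \<open>Jacobi's formula at the identity: replacing row k of the identity by row k of
  \<open>A\<close> leaves the determinant \<open>A $ k $ k\<close>.\<close>

lemma ddet_mat_1: "ddet (mat 1) A = trace (A :: complex^'n^'n)"
proof -
  have "det (\<chi> i. if i = k then A $ i else mat 1 $ i) = A $ k $ k" for k
  proof -
    have "(\<Sum>i\<in>UNIV. A $ k $ i *s row i (mat 1)) = A $ k"
      by (simp add: vec_eq_iff row_def mat_def if_distrib cong: if_cong)
    moreover have "row i (mat 1) = (mat 1 :: complex^'n^'n) $ i" for i by (simp add: row_def vec_eq_iff)
    ultimately have "det (\<chi> i. if i = k then A $ k else mat 1 $ i) = A $ k $ k"
      using cramer_lemma_transpose[of k "A $ k" "mat 1"] by (simp only: det_I mult_1_right)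
    moreover have "(\<chi> i. if i = k then A $ i else mat 1 $ i) = (\<chi> i. if i = k then A $ k else mat 1 $ i)"
      by (simp add: vec_eq_iff)
    ultimately show ?thesis by simp
  qed
  then show ?thesis by (simp add: ddet_def trace_def)
qed

text \<open>Liouville's formula. The determinant solves y' = tr A y, so its product with exp(- s tr
  A) is constant, and it equals 1 at s = 0.\<close>

lemma det_matrix_exp: "det (matrix_exp (s *\<^sub>R A)) = exp (of_real s * trace A)"
proof -
  let ?E = "\<lambda>s. matrix_exp (s *\<^sub>R A)"
  have "((\<lambda>s. det (?E s)) has_derivative (\<lambda>v. ddet (?E s) (\<chi> i. of_real v *s (A ** ?E s) $ i))) (at s)" for s
    by (rule det_has_derivative)
      (use matrix_exp_has_vector_derivative in \<open>simp add: has_vector_derivative_def scaleR_conv_of_real\<close>)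
  moreover have "ddet (?E s) (A ** ?E s) = trace A * det (?E s)" for s
    using ddet_mult_right[of "mat 1" "?E s" A] by (simp add: ddet_mat_1)
  ultimately have d: "((\<lambda>s. det (?E s)) has_vector_derivative trace A * det (?E s)) (at s)" for s
    by (simp add: has_vector_derivative_def ddet_scale scaleR_conv_of_real)
  have e: "((\<lambda>s. exp (- (of_real s * trace A))) has_vector_derivative - trace A * exp (- (of_real s * trace A))) (at s)" for s :: real
    by (rule has_vector_derivative_real_field) (auto intro!: derivative_eq_intros)
  have z: "((\<lambda>s. det (?E s) * exp (- (of_real s * trace A))) has_vector_derivative 0) (at s within UNIV)" for s
    using has_vector_derivative_mult[OF d e, of s] by (simp add: algebra_simps)
  have "\<exists>c. \<forall>s. det (?E s) * exp (- (of_real s * trace A)) = c"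
    by (rule has_vector_derivative_zero_constant[OF convex_UNIV z]) auto
  then obtain c where c: "\<And>s. det (?E s) * exp (- (of_real s * trace A)) = c" by blast
  have "c = 1" using c[of 0] by (simp add: matrix_exp_zero[simplified])
  then have "det (?E s) * exp (- (of_real s * trace A)) * exp (of_real s * trace A) = exp (of_real s * trace A)"
    using c[of s] by simp
  then show ?thesis by (simp add: mult.assoc exp_add[symmetric])
qed

section \<open>The one-parameter group generated by \<i> M\<close>

definition imat :: "real^'n^'n \<Rightarrow> complex^'n^'n" where
  "imat M = (\<chi> j k. \<i> * of_real (M $ j $ k))"

lemma quadric_immersion_eq:
  "quadric_immersion M r (s, x) = r s *\<^sub>R (matrix_exp (s *\<^sub>R imat M) *v complex_vec x)"
proof -
  have "(\<chi> j k. \<i> * of_real (M $ j $ k) * of_real s) = s *\<^sub>R imat M"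
    by (simp add: imat_def vec_eq_iff scaleR_conv_of_real[where 'a=complex])
  then show ?thesis by (simp add: quadric_immersion_def)
qed

lemma trace_imat: "trace (imat M) = \<i> * of_real (trace M)"
  by (simp add: trace_def imat_def sum_distrib_left)

lemma real_form_commute: "real_form p x y = real_form p y x"
  by (simp add: real_form_sum mult.commute)

lemma real_form_axis: "real_form p x (axis i 1) = form_sign p i * x $ i"
proof -
  have "form_sign p j * (x $ j * axis i 1 $ j) = (if j = i then form_sign p i * x $ i else 0)" for j
    by (simp add: axis_def)
  then show ?thesis by (simp add: real_form_sum)
qed

lemma self_adjoint_entries:
  assumes "self_adjoint p M"
  shows "form_sign p i * M $ i $ j = form_sign p j * M $ j $ i"
proof -
  have "(M *v axis b 1) $ a = M $ a $ b" for a b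
    by (simp add: matrix_vector_mult_basis column_def)
  moreover have "real_form p (M *v axis j 1) (axis i 1) = real_form p (axis j 1) (M *v axis i 1)"
    using assms unfolding self_adjoint_def by blast
  ultimately show ?thesis
    by (simp add: real_form_axis real_form_commute[of p "axis j 1"])
qed

text \<open>\<open>M\<close> is real and self-adjoint, so \<i> M is skew for the Hermitian form: the
  second argument turns \<i> into its conjugate.\<close>

lemma herm_form_imat:
  assumes "self_adjoint p M"
  shows "herm_form p (imat M *v z) w + herm_form p z (imat M *v w) = 0"
proof -
  have "herm_form p (imat M *v z) w = (\<Sum>i\<in>UNIV. \<Sum>j\<in>UNIV. \<i> * of_real (form_sign p i * M $ i $ j) * (z $ j * cnj (w $ i)))"
    unfolding herm_form_sum by (simp add: matrix_vector_mult_def imat_def sum_distrib_left sum_distrib_right algebra_simps)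
  also have "\<dots> = (\<Sum>i\<in>UNIV. \<Sum>j\<in>UNIV. \<i> * of_real (form_sign p j * M $ j $ i) * (z $ j * cnj (w $ i)))"
    by (simp only: self_adjoint_entries[OF assms])
  also have "\<dots> = (\<Sum>j\<in>UNIV. \<Sum>i\<in>UNIV. \<i> * of_real (form_sign p j * M $ j $ i) * (z $ j * cnj (w $ i)))"
    by (rule sum.swap)
  also have "\<dots> = - herm_form p z (imat M *v w)"
    unfolding herm_form_sum by (simp add: matrix_vector_mult_def imat_def sum_distrib_left sum_distrib_right algebra_simps sum_negf[symmetric])
  finally show ?thesis by simp
qed

lemma matrix_exp_mult_derivative:
  "((\<lambda>s. (matrix_exp (s *\<^sub>R A) *v z) $ i) has_vector_derivative (A *v (matrix_exp (s *\<^sub>R A) *v z)) $ i) (at s)"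
proof -
  have "((\<lambda>s. \<Sum>j\<in>UNIV. matrix_exp (s *\<^sub>R A) $ i $ j * z $ j) has_vector_derivative (\<Sum>j\<in>UNIV. (A ** matrix_exp (s *\<^sub>R A)) $ i $ j * z $ j)) (at s)"
    by (intro has_vector_derivative_sum has_vector_derivative_mult_left matrix_exp_has_vector_derivative)
  then show ?thesis by (simp add: matrix_vector_mul_assoc) (simp add: matrix_vector_mult_def)
qed

text \<open>By skewness of the generator the \<open>s\<close>-derivative of the left side is 0, so
  the exponentials are pseudo-unitary.\<close>

lemma herm_form_matrix_exp:
  assumes "self_adjoint p M"
  shows "herm_form p (matrix_exp (s *\<^sub>R imat M) *v z) (matrix_exp (s *\<^sub>R imat M) *v w) = herm_form p z w"
proof -
  let ?A = "imat M"
  let ?E = "\<lambda>s. matrix_exp (s *\<^sub>R ?A)"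
  have "((\<lambda>s. herm_form p (?E s *v z) (?E s *v w)) has_vector_derivative
     herm_form p (?A *v (?E s *v z)) (?E s *v w) + herm_form p (?E s *v z) (?A *v (?E s *v w))) (at s within UNIV)" for s
  proof -
    have "((\<lambda>s. herm_form p (?E s *v z) (?E s *v w)) has_vector_derivative
       (\<Sum>j\<in>UNIV. of_real (form_sign p j) * ((?E s *v z) $ j * cnj ((?A *v (?E s *v w)) $ j) + (?A *v (?E s *v z)) $ j * cnj ((?E s *v w) $ j)))) (at s within UNIV)"
      unfolding herm_form_sum
      by (intro has_vector_derivative_sum has_vector_derivative_mult_right has_vector_derivative_mult
          bounded_linear.has_vector_derivative[OF bounded_linear_cnj] matrix_exp_mult_derivative)
    then show ?thesis by (simp add: herm_form_sum sum.distrib algebra_simps)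
  qed
  then have z: "((\<lambda>s. herm_form p (?E s *v z) (?E s *v w)) has_vector_derivative 0) (at s within UNIV)" for s
    unfolding herm_form_imat[OF assms] .
  have "\<exists>c. \<forall>s. herm_form p (?E s *v z) (?E s *v w) = c"
    by (rule has_vector_derivative_zero_constant[OF convex_UNIV z]) auto
  then obtain c where c: "\<And>s. herm_form p (?E s *v z) (?E s *v w) = c" by blast
  show ?thesis using c[of s] c[of 0] by (simp add: matrix_exp_zero[simplified])
qed

lemma ck_on_matrix_exp: "ck_on k UNIV (\<lambda>s. matrix_exp (s *\<^sub>R A) $ i $ j)"
proof (induction k arbitrary: i j)
  case 0
  have "isCont (\<lambda>s. matrix_exp (s *\<^sub>R A) $ i $ j) s" for s
    using matrix_exp_has_vector_derivative has_vector_derivative_continuous by blast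
  then show ?case by (auto intro!: continuous_at_imp_continuous_on)
next
  case (Suc k)
  show ?case
  proof (rule ck_on_SucI[OF open_UNIV])
    show "((\<lambda>s. matrix_exp (s *\<^sub>R A) $ i $ j) has_derivative (\<lambda>v. v *\<^sub>R (A ** matrix_exp (s *\<^sub>R A)) $ i $ j)) (at s)" for s
      using matrix_exp_has_vector_derivative by (simp add: has_vector_derivative_def)
    show "ck_on k UNIV (\<lambda>s. v *\<^sub>R (A ** matrix_exp (s *\<^sub>R A)) $ i $ j)" for v
      unfolding matrix_matrix_mult_def vec_lambda_beta
      by (intro ck_on_scaleR ck_on_const ck_on_sum ck_on_mult Suc.IH open_UNIV)
  qed
qed

section \<open>The phase of a Lagrangian catenoid\<close>

lemma complex_vec_nth [simp]: "complex_vec x $ j = of_real (x $ j)"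
  by (simp add: complex_vec_def)

lemma det_complex_vec_rows: "det (\<chi> j. complex_vec (a j)) = of_real (det (\<chi> j. a j))"
  using det_cmat[of "\<chi> j. a j"] by (simp add: cmat_def complex_vec_def)

lemma det_rows_orthogonal:
  fixes a :: "'n::finite \<Rightarrow> real^'n"
  assumes "\<eta> \<noteq> 0" "\<And>j. \<eta> \<bullet> a j = 0"
  shows "det (\<chi> j. a j) = 0"
proof (rule ccontr)
  assume "det (\<chi> j. a j) \<noteq> 0"
  then have "\<forall>x. (\<chi> j. a j) *v x = 0 \<longrightarrow> x = 0"
    by (simp add: invertible_det_nz[symmetric] invertible_left_inverse matrix_left_invertible_ker)
  moreover have "(\<chi> j. a j) *v \<eta> = 0"
    using assms(2) by (simp add: vec_eq_iff matrix_vector_mult_def inner_vec_def mult.commute)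
  ultimately show False using assms(1) by blast
qed

lemma det_row_replaced:
  fixes a :: "real^'n"
  shows "det (\<chi> j. if j = k then complex_vec a else g *s complex_vec (b j)) =
    g ^ (CARD('n) - 1) * of_real (det (\<chi> j. if j = k then a else b j))"
proof -
  have "(\<chi> j. if j = k then complex_vec a else g *s complex_vec (b j)) =
      (\<chi> j. (if j = k then 1 else g) *s complex_vec (if j = k then a else b j))"
    by (simp add: vec_eq_iff)
  then have "det (\<chi> j. if j = k then complex_vec a else g *s complex_vec (b j)) =
     (\<Prod>j\<in>UNIV. if j = k then 1 else g) * of_real (det (\<chi> j. if j = k then a else b j))"
    by (simp only: det_rows_mul det_complex_vec_rows)
  moreover have "(\<Prod>j\<in>UNIV. if j = k then 1 else g) = (\<Prod>j\<in>UNIV - {k}. g)"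
    by (rule prod.mono_neutral_cong_right) auto
  ultimately show ?thesis by (simp add: card_Diff_singleton)
qed

text \<open>All the vectors \<open>y j\<close> and \<open>z\<close> lie in the hyperplane orthogonal to \<open>\<eta>\<close>, so at most the component
  along \<open>n\<close> contributes.\<close>

lemma det_rank_one_phase:
  fixes s :: "'n::finite \<Rightarrow> real" and y :: "'n \<Rightarrow> real^'n"
  assumes \<eta>: "\<eta> \<noteq> 0" "\<And>j. \<eta> \<bullet> y j = 0" "\<eta> \<bullet> z = 0"
  shows "\<exists>\<rho>::real. det (\<chi> j. of_real (s j) *s (\<kappa> *s complex_vec n + \<beta> *s complex_vec z) + g *s complex_vec (y j))
     = of_real \<rho> * \<kappa> * g ^ (CARD('n) - 1)"
proof (cases "\<forall>j. s j = 0")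
  case True
  have "det (\<chi> j. g *s complex_vec (y j)) = 0"
    using det_rows_orthogonal[OF \<eta>(1,2)] by (simp add: det_rows_mul det_complex_vec_rows)
  then show ?thesis using True by (intro exI[of _ 0]) simp
next
  case False
  then obtain k where k: "s k \<noteq> 0" by blast
  let ?Z = "\<kappa> *s complex_vec n + \<beta> *s complex_vec z"
  \<comment> \<open>Row elimination with pivot \<open>s k\<close>: subtracting a multiple of row k
    from row j leaves \<open>g *s complex_vec (m j)\<close>. The real matrix \<open>C\<close> undoes
    this and so contributes a real factor only.\<close>
  define m where "m j = y j - (s j / s k) *\<^sub>R y k" for j
  define R where "R = (\<chi> j. of_real (s j) *s ?Z + g *s complex_vec (y j))"
  define R' where "R' = (\<chi> j. if j = k then of_real (s k) *s ?Z + g *s complex_vec (y k) else g *s complex_vec (m j))"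
  define C :: "real^'n^'n" where "C = (\<chi> i j. if j = i then 1 else if j = k then s i / s k else 0)"
  have "R = cmat C ** R'"
  proof (simp only: vec_eq_iff, intro allI)
    fix i l
    have "(cmat C ** R') $ i $ l = (\<Sum>j\<in>UNIV. (if j = i then R' $ i $ l else 0) + (if j = k then (if i = k then 0 else of_real (s i / s k) * R' $ k $ l) else 0))"
      unfolding matrix_matrix_mult_def vec_lambda_beta by (rule sum.cong) (auto simp: cmat_def C_def)
    also have "\<dots> = R' $ i $ l + (if i = k then 0 else of_real (s i / s k) * R' $ k $ l)"
      by (simp add: sum.distrib)
    also have "\<dots> = R $ i $ l"
      using k by (simp add: R_def R'_def m_def field_simps)
    finally show "R $ i $ l = (cmat C ** R') $ i $ l" by simp
  qed
  then have "det R = of_real (det C) * det R'" by (simp add: det_mul det_cmat)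
  also have "det R' = of_real (s k) * \<kappa> * det (\<chi> j. if j = k then complex_vec n else g *s complex_vec (m j))
     + (of_real (s k) * \<beta> * det (\<chi> j. if j = k then complex_vec z else g *s complex_vec (m j))
     + g * det (\<chi> j. if j = k then complex_vec (y k) else g *s complex_vec (m j)))"
  proof -
    have "R' = (\<chi> j. if j = k then (of_real (s k) * \<kappa>) *s complex_vec n + ((of_real (s k) * \<beta>) *s complex_vec z + g *s complex_vec (y k)) else g *s complex_vec (m j))"
      by (simp add: R'_def vec_eq_iff algebra_simps)
    then show ?thesis by (simp only: det_row_add det_row_mul)
  qed
  \<comment> \<open>With \<open>z\<close> in row k, and likewise with \<open>y k\<close> below, all
    rows are complex multiples of real vectors orthogonal to \<open>\<eta>\<close>. Only the row
    along \<open>n\<close> survives, with a factor \<open>g\<close> from each of the other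
    rows.\<close>
  also have "det (\<chi> j. if j = k then complex_vec z else g *s complex_vec (m j)) = 0"
    unfolding det_row_replaced using det_rows_orthogonal[OF \<eta>(1), of "\<lambda>j. if j = k then z else m j"] \<eta>
    by (simp add: m_def inner_diff_right)
  also have "det (\<chi> j. if j = k then complex_vec (y k) else g *s complex_vec (m j)) = 0"
    unfolding det_row_replaced using det_rows_orthogonal[OF \<eta>(1), of "\<lambda>j. if j = k then y k else m j"] \<eta>
    by (simp add: m_def inner_diff_right)
  finally have "det R = of_real (det C * s k * det (\<chi> j. if j = k then n else m j)) * \<kappa> * g ^ (CARD('n) - 1)"
    by (simp add: det_row_replaced)
  then show ?thesis unfolding R_def by blast
qed

text \<open>Represents the form by the Euclidean inner product, so that orthogonality for the form
  can be fed into statements about Euclidean hyperplanes.\<close>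

definition form_dual :: "nat \<Rightarrow> real^('n::{finite,wellorder}) \<Rightarrow> real^('n::_)" where
  "form_dual p x = (\<chi> j. form_sign p j * x $ j)"

lemma inner_form_dual: "form_dual p x \<bullet> y = real_form p x y"
  by (simp add: form_dual_def inner_vec_def real_form_sum mult.assoc)

lemma form_dual_eq_0: "form_dual p x = 0 \<longleftrightarrow> x = 0"
  by (auto simp: form_dual_def vec_eq_iff form_sign_def)

lemma real_form_0 [simp]: "real_form p 0 x = 0" "real_form p x 0 = 0"
  by (simp_all add: real_form_sum)

lemma real_form_linear:
  "real_form p (x + y) z = real_form p x z + real_form p y z"
  "real_form p (a *\<^sub>R x) z = a * real_form p x z"
  "real_form p x (y + z) = real_form p x y + real_form p x z"
  "real_form p x (a *\<^sub>R z) = a * real_form p x z"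
  "real_form p (x - y) z = real_form p x z - real_form p y z"
  "real_form p x (y - z) = real_form p x y - real_form p x z"
  by (simp_all add: real_form_sum sum.distrib sum_subtractf sum_distrib_left algebra_simps)

lemma herm_form_linear:
  "herm_form p (x + y) z = herm_form p x z + herm_form p y z"
  "herm_form p (a *s x) z = a * herm_form p x z"
  "herm_form p x (y + z) = herm_form p x y + herm_form p x z"
  "herm_form p x (a *s z) = cnj a * herm_form p x z"
  by (simp_all add: herm_form_sum sum.distrib sum_distrib_left algebra_simps)

lemma herm_form_complex_vec: "herm_form p (complex_vec x) (complex_vec y) = of_real (real_form p x y)"
  by (simp add: herm_form_sum real_form_sum)

lemma real_form_has_derivative:
  assumes "(a has_derivative a') (at u)" "(b has_derivative b') (at u)"
  shows "((\<lambda>u. real_form p (a u) (b u)) has_derivative (\<lambda>v. real_form p (a u) (b' v) + real_form p (a' v) (b u))) (at u)"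
proof -
  have "((\<lambda>u. a u $ j) has_derivative (\<lambda>v. a' v $ j)) (at u)" "((\<lambda>u. b u $ j) has_derivative (\<lambda>v. b' v $ j)) (at u)" for j
    using assms by (auto intro: bounded_linear.has_derivative[OF bounded_linear_vec_nth])
  then have "((\<lambda>u. real_form p (a u) (b u)) has_derivative
     (\<lambda>v. \<Sum>j\<in>UNIV. form_sign p j * (a u $ j * b' v $ j + a' v $ j * b u $ j))) (at u)"
    unfolding real_form_sum by (intro has_derivative_sum has_derivative_mult_right has_derivative_mult)
  then show ?thesis by (simp add: real_form_sum sum.distrib algebra_simps)
qed

lemma has_derivative_vec_components:
  assumes "\<And>j. ((\<lambda>u. y u $ j) has_derivative (\<lambda>v. y' v $ j)) (at u)"
  shows "((y :: 'a::real_normed_vector \<Rightarrow> 'b::euclidean_space^'n) has_derivative y') (at u)"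
proof (subst has_derivative_componentwise_within, rule ballI)
  fix i :: "'b^'n" assume "i \<in> Basis"
  show "((\<lambda>x. y x \<bullet> i) has_derivative (\<lambda>x. y' x \<bullet> i)) (at u)"
    unfolding inner_vec_def by (intro has_derivative_sum has_derivative_inner_left assms)
qed

text \<open>Near \<open>u\<^sub>0\<close> one has \<open>F = \<gamma> y\<close> with differentiable \<open>\<gamma>\<close> and real \<open>y\<close>, where \<open>\<epsilon> \<gamma>\<^sup>2\<close> is the
  complex bilinear square of \<open>F\<close>. The determinant is a real multiple of \<open>\<gamma>' \<gamma> ^ (n - 1)\<close>, which is the
  derivative of \<open>\<gamma> ^ n / n\<close> and hence real.\<close>

lemma catenoid_phase:
  fixes F :: "real^('n::{finite,wellorder}) \<Rightarrow> complex^('n::_)"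
  assumes W: "open W" and F: "ck_on (Suc 0) W F" and \<epsilon>: "\<epsilon> = 1 \<or> \<epsilon> = -1" and c0: "c\<^sub>0 \<noteq> 0"
    and cat: "\<And>u. u \<in> W \<Longrightarrow> F u \<in> lagrangian_catenoid p \<epsilon> c\<^sub>0" and u0: "u\<^sub>0 \<in> W"
  shows "Im (herm_form p (frechet_derivative F (at u\<^sub>0) v) (frechet_derivative F (at u\<^sub>0) w)) = 0"
    "Im (det (jac F u\<^sub>0)) = 0"
proof -
  let ?N = "CARD('n)"
  have N: "?N > 0" by simp
  have Fd: "(F has_derivative frechet_derivative F (at u\<^sub>0)) (at u\<^sub>0)" by (rule ck_on_has_derivative[OF F u0])
  have Fnth: "((\<lambda>u. F u $ j) has_derivative (\<lambda>v. frechet_derivative F (at u\<^sub>0) v $ j)) (at u\<^sub>0)" for j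
    by (rule bounded_linear.has_derivative[OF bounded_linear_vec_nth Fd])
  define Q where "Q z = (\<Sum>j\<in>UNIV. of_real (form_sign p j) * (z $ j * z $ j))" for z :: "complex^('n::_)"
  have Q_cat: "Q (\<gamma> *s complex_vec x) = \<gamma>\<^sup>2 * of_real (real_form p x x)" for \<gamma> x
    by (simp add: Q_def real_form_sum sum_distrib_left power2_eq_square algebra_simps)
  have cat': "\<exists>\<gamma> x. F u = \<gamma> *s complex_vec x \<and> real_form p x x = \<epsilon> \<and> Im (\<gamma> ^ ?N) = c\<^sub>0" if "u \<in> W" for u
    using cat[OF that] unfolding lagrangian_catenoid_def pseudo_sphere_def by auto
  obtain \<gamma>\<^sub>0 x\<^sub>0 where g0: "F u\<^sub>0 = \<gamma>\<^sub>0 *s complex_vec x\<^sub>0" "real_form p x\<^sub>0 x\<^sub>0 = \<epsilon>" "Im (\<gamma>\<^sub>0 ^ ?N) = c\<^sub>0"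
    using cat'[OF u0] by blast
  have g0nz: "\<gamma>\<^sub>0 \<noteq> 0" using g0(3) c0 N by (auto simp: zero_power)
  have enz: "\<epsilon> \<noteq> 0" and e2: "\<epsilon> * \<epsilon> = 1" using \<epsilon> by auto
  \<comment> \<open>Normalised to be 1 at \<open>u\<^sub>0\<close>; nearby it stays in the right
    half plane, where \<open>csqrt\<close> is holomorphic.\<close>
  define G where "G u = Q (F u) / (of_real \<epsilon> * \<gamma>\<^sub>0\<^sup>2)" for u
  have G0: "G u\<^sub>0 = 1" using g0 g0nz enz by (simp add: G_def Q_cat)
  have "continuous_on W G"
  proof -
    have "continuous_on W F" using ck_on_Suc_imp[OF F] by simp
    then show ?thesis unfolding G_def Q_def using g0nz enz by (intro continuous_intros) auto
  qed
  then have oW1: "open (W \<inter> G -` {z. Re z > 0})"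
    by (intro continuous_open_preimage W open_halfspace_Re_gt)
  define W1 where "W1 = W \<inter> G -` {z. Re z > 0}"
  have W1: "open W1" "u\<^sub>0 \<in> W1" "W1 \<subseteq> W" using oW1 u0 G0 by (auto simp: W1_def)
  define \<gamma> where "\<gamma> u = \<gamma>\<^sub>0 * csqrt (G u)" for u
  define y where "y u = (\<chi> j. Re (F u $ j / \<gamma> u))" for u
  \<comment> \<open>The root \<open>\<gamma>\<close> agrees with the coefficient from the catenoid
    only up to a sign that may depend on the point. For odd n this sign survives in \<gamma>^n,
    hence the square of the imaginary part.\<close>
  have on_W1: "F u = \<gamma> u *s complex_vec (y u) \<and> real_form p (y u) (y u) = \<epsilon> \<and> (Im (\<gamma> u ^ ?N))\<^sup>2 = c\<^sub>0\<^sup>2 \<and> \<gamma> u \<noteq> 0" if uW1: "u \<in> W1" for u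
  proof -
    obtain g x where gx: "F u = g *s complex_vec x" "real_form p x x = \<epsilon>" "Im (g ^ ?N) = c\<^sub>0"
      using cat'[of u] uW1 W1(3) by blast
    have gnz: "g \<noteq> 0" using gx(3) c0 N by (auto simp: zero_power)
    have "(\<gamma> u)\<^sup>2 = \<gamma>\<^sub>0\<^sup>2 * G u" by (simp add: \<gamma>_def power_mult_distrib)
    also have "\<dots> = g\<^sup>2" using g0nz enz by (simp add: G_def gx Q_cat)
    finally have "\<gamma> u = g \<or> \<gamma> u = - g" by (simp add: power2_eq_iff)
    then obtain \<sigma> :: real where \<sigma>: "\<sigma> = 1 \<or> \<sigma> = -1" "\<gamma> u = of_real \<sigma> * g" by (metis minus_mult_minus mult_minus1 of_real_1 of_real_minus mult_1)
    have ss: "\<sigma> * \<sigma> = 1" using \<sigma> by auto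
    have "y u = \<sigma> *\<^sub>R x"
      using \<sigma> gnz by (auto simp: y_def gx vec_eq_iff)
    moreover have "F u = \<gamma> u *s complex_vec (\<sigma> *\<^sub>R x)" using \<sigma> by (auto simp: gx vec_eq_iff)
    moreover have "real_form p (\<sigma> *\<^sub>R x) (\<sigma> *\<^sub>R x) = \<epsilon>" using \<sigma> by (auto simp: real_form_linear gx)
    moreover have "(Im (\<gamma> u ^ ?N))\<^sup>2 = c\<^sub>0\<^sup>2"
    proof -
      have "\<gamma> u ^ ?N = of_real (\<sigma> ^ ?N) * g ^ ?N" by (simp add: \<sigma>(2) power_mult_distrib)
      then have "Im (\<gamma> u ^ ?N) = \<sigma> ^ ?N * c\<^sub>0" using gx(3) by simp
      moreover have "(\<sigma> ^ ?N)\<^sup>2 = 1" using ss by (simp add: power2_eq_square power_mult_distrib[symmetric])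
      ultimately show ?thesis by (simp add: power_mult_distrib)
    qed
    moreover have "\<gamma> u \<noteq> 0" using \<sigma> gnz by auto
    ultimately show ?thesis by simp
  qed
  have gam0: "\<gamma> u\<^sub>0 = \<gamma>\<^sub>0" by (simp add: \<gamma>_def G0)
  have "\<exists>\<gamma>'. (\<gamma> has_derivative \<gamma>') (at u\<^sub>0)"
  proof -
    have "\<exists>G'. (G has_derivative G') (at u\<^sub>0)"
    proof -
      have "(\<lambda>u. \<Sum>j\<in>UNIV. of_real (form_sign p j) * (F u $ j * F u $ j)) differentiable (at u\<^sub>0)"
        by (intro differentiable_sum ballI differentiable_mult differentiable_const differentiableI[OF Fnth]) auto
      then have "(\<lambda>u. (\<Sum>j\<in>UNIV. of_real (form_sign p j) * (F u $ j * F u $ j)) * inverse (of_real \<epsilon> * \<gamma>\<^sub>0\<^sup>2)) differentiable (at u\<^sub>0)"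
        by (intro differentiable_mult differentiable_const)
      then show ?thesis unfolding G_def Q_def divide_inverse differentiable_def .
    qed
    then obtain G' where G': "(G has_derivative G') (at u\<^sub>0)" by blast
    have "(csqrt has_field_derivative inverse (2 * csqrt (G u\<^sub>0))) (at (G u\<^sub>0))"
      by (rule has_field_derivative_csqrt) (simp add: G0)
    then have "(csqrt has_derivative (*) (inverse (2 * csqrt (G u\<^sub>0)))) (at (G u\<^sub>0))"
      by (simp add: has_field_derivative_def)
    from has_derivative_mult_right[OF has_derivative_compose[OF G' this], of \<gamma>\<^sub>0]
    show ?thesis unfolding \<gamma>_def by blast
  qed
  then obtain \<gamma>' where \<gamma>': "(\<gamma> has_derivative \<gamma>') (at u\<^sub>0)" by blast
  have "\<exists>y'. (y has_derivative y') (at u\<^sub>0)"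
  proof -
    have "\<exists>D. ((\<lambda>u. y u $ j) has_derivative D) (at u\<^sub>0)" for j
    proof -
      have "\<gamma> u\<^sub>0 \<noteq> 0" using on_W1[OF W1(2)] by blast
      from bounded_linear.has_derivative[OF bounded_linear_Re has_derivative_divide[OF Fnth[of j] \<gamma>' this]]
      show ?thesis unfolding y_def by auto
    qed
    then obtain Dj where "\<And>j. ((\<lambda>u. y u $ j) has_derivative Dj j) (at u\<^sub>0)" by metis
    then have "(y has_derivative (\<lambda>v. \<chi> j. Dj j v)) (at u\<^sub>0)" by (intro has_derivative_vec_components) simp
    then show ?thesis by blast
  qed
  then obtain y' where y': "(y has_derivative y') (at u\<^sub>0)" by blast
  note y0 = on_W1[OF W1(2)]
  have F': "frechet_derivative F (at u\<^sub>0) v = \<gamma>' v *s complex_vec (y u\<^sub>0) + \<gamma>\<^sub>0 *s complex_vec (y' v)" for v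
  proof -
    have "frechet_derivative F (at u\<^sub>0) v $ j = \<gamma>' v * of_real (y u\<^sub>0 $ j) + \<gamma>\<^sub>0 * of_real (y' v $ j)" for j
    proof -
      have "((\<lambda>u. \<gamma> u * of_real (y u $ j)) has_derivative (\<lambda>v. \<gamma> u\<^sub>0 * of_real (y' v $ j) + \<gamma>' v * of_real (y u\<^sub>0 $ j))) (at u\<^sub>0)"
        by (intro has_derivative_mult \<gamma>' bounded_linear.has_derivative[OF bounded_linear_of_real]
            bounded_linear.has_derivative[OF bounded_linear_vec_nth] y')
      then have "((\<lambda>u. F u $ j) has_derivative (\<lambda>v. \<gamma> u\<^sub>0 * of_real (y' v $ j) + \<gamma>' v * of_real (y u\<^sub>0 $ j))) (at u\<^sub>0)"
        by (rule has_derivative_transform_within_open[OF _ W1(1,2)]) (use on_W1 in \<open>simp add: vec_eq_iff\<close>)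
      from has_derivative_unique[OF Fnth this] show ?thesis by (simp add: gam0 fun_eq_iff)
    qed
    then show ?thesis by (simp add: vec_eq_iff)
  qed
  have orth: "real_form p (y u\<^sub>0) (y' v) = 0" for v
  proof -
    have "((\<lambda>u. real_form p (y u) (y u)) has_derivative (\<lambda>v. real_form p (y u\<^sub>0) (y' v) + real_form p (y' v) (y u\<^sub>0))) (at u\<^sub>0)"
      by (rule real_form_has_derivative[OF y' y'])
    moreover have "((\<lambda>u. real_form p (y u) (y u)) has_derivative (\<lambda>v. 0)) (at u\<^sub>0)"
      by (rule has_derivative_transform_within_open[OF has_derivative_const W1(1,2)]) (use on_W1 in auto)
    ultimately have "(\<lambda>v. real_form p (y u\<^sub>0) (y' v) + real_form p (y' v) (y u\<^sub>0)) = (\<lambda>v. 0)"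
      by (rule has_derivative_unique)
    from fun_cong[OF this, of v] show ?thesis using real_form_commute[of p "y' v" "y u\<^sub>0"] by simp
  qed
  \<comment> \<open>Differentiating the constant \<open>(Im (\<gamma> u ^ n))\<^sup>2\<close>
    produces the factor \<open>Im (\<gamma>\<^sub>0 ^ n) = c\<^sub>0\<close>; it can be cancelled as
    \<open>c\<^sub>0\<close> is not 0.\<close>
  have im: "Im (\<gamma>\<^sub>0 ^ (?N - 1) * \<gamma>' v) = 0" for v
  proof -
    have "((\<lambda>u. \<gamma> u ^ ?N) has_derivative (\<lambda>v. of_nat ?N * \<gamma>' v * \<gamma> u\<^sub>0 ^ (?N - 1))) (at u\<^sub>0)"
      by (rule has_derivative_power[OF \<gamma>'])
    then have "((\<lambda>u. (Im (\<gamma> u ^ ?N))\<^sup>2) has_derivative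
       (\<lambda>v. of_nat 2 * Im (of_nat ?N * \<gamma>' v * \<gamma> u\<^sub>0 ^ (?N - 1)) * (Im (\<gamma> u\<^sub>0 ^ ?N)) ^ (2 - 1))) (at u\<^sub>0)"
      by (rule has_derivative_power[OF bounded_linear.has_derivative[OF bounded_linear_Im]])
    moreover have "((\<lambda>u. (Im (\<gamma> u ^ ?N))\<^sup>2) has_derivative (\<lambda>v. 0)) (at u\<^sub>0)"
      by (rule has_derivative_transform_within_open[OF has_derivative_const W1(1,2)]) (use on_W1 in auto)
    ultimately have "(\<lambda>v. of_nat 2 * Im (of_nat ?N * \<gamma>' v * \<gamma> u\<^sub>0 ^ (?N - 1)) * (Im (\<gamma> u\<^sub>0 ^ ?N)) ^ (2 - 1)) = (\<lambda>v. 0)"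
      by (rule has_derivative_unique)
    from fun_cong[OF this, of v] have "Im (of_nat ?N * (\<gamma>\<^sub>0 ^ (?N - 1) * \<gamma>' v)) = 0"
      using g0(3) c0 by (simp only: gam0) (simp add: mult.commute mult.left_commute)
    then show ?thesis using N by simp
  qed
  \<comment> \<open>The common complex direction of all values of \<open>\<gamma>'\<close>:
    multiplied by \<gamma>^(n - 1) they are real. This puts the rows of the Jacobian into the shape
    of \<open>det_rank_one_phase\<close>, and the remaining powers cancel.\<close>
  define \<kappa> where "\<kappa> = inverse (\<gamma>\<^sub>0 ^ (?N - 1))"
  define t where "t v = Re (\<gamma>\<^sub>0 ^ (?N - 1) * \<gamma>' v)" for v
  have \<gamma>'t: "\<gamma>' v = of_real (t v) * \<kappa>" for v
  proof -
    have "\<gamma>\<^sub>0 ^ (?N - 1) * \<gamma>' v = of_real (t v)" using im[of v] by (simp add: complex_eq_iff t_def)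
    then show ?thesis using g0nz by (simp add: \<kappa>_def field_simps)
  qed
  have "herm_form p (frechet_derivative F (at u\<^sub>0) v) (frechet_derivative F (at u\<^sub>0) w) =
     of_real (t v * t w * \<epsilon>) * (\<kappa> * cnj \<kappa>) + of_real (real_form p (y' v) (y' w)) * (\<gamma>\<^sub>0 * cnj \<gamma>\<^sub>0)"
    using y0 orth[of v] orth[of w] real_form_commute[of p "y' v" "y u\<^sub>0"]
    by (simp add: F' herm_form_linear herm_form_complex_vec \<gamma>'t)
  then show "Im (herm_form p (frechet_derivative F (at u\<^sub>0) v) (frechet_derivative F (at u\<^sub>0) w)) = 0"
    by (simp add: complex_mult_cnj)
  have "\<exists>\<rho>::real. det (\<chi> j. of_real (t (axis j 1)) *s (\<kappa> *s complex_vec (y u\<^sub>0) + 0 *s complex_vec 0) + \<gamma>\<^sub>0 *s complex_vec (y' (axis j 1)))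
      = of_real \<rho> * \<kappa> * \<gamma>\<^sub>0 ^ (?N - 1)"
  proof (rule det_rank_one_phase)
    show "form_dual p (y u\<^sub>0) \<noteq> 0" using y0 enz by (auto simp: form_dual_eq_0)
  qed (simp_all add: inner_form_dual orth)
  moreover have "jac F u\<^sub>0 = (\<chi> j. of_real (t (axis j 1)) *s (\<kappa> *s complex_vec (y u\<^sub>0) + 0 *s complex_vec 0) + \<gamma>\<^sub>0 *s complex_vec (y' (axis j 1)))"
    by (simp add: jac_def F' \<gamma>'t vec_eq_iff)
  moreover have "\<kappa> * \<gamma>\<^sub>0 ^ (?N - 1) = 1" using g0nz by (simp add: \<kappa>_def)
  ultimately show "Im (det (jac F u\<^sub>0)) = 0" by (auto simp: mult.assoc)
qed

section \<open>Non-degenerate quadrics\<close>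

lemma submanifold_chart:
  fixes S :: "'a::euclidean_space set"
  assumes "submanifold k S" "x \<in> S"
  obtains U V T :: "'a set" and \<Phi> \<Psi> :: "'a \<Rightarrow> 'a" where "open U" "x \<in> U" "open V" "homeomorphism U V \<Phi> \<Psi>" "smooth_on U \<Phi>" "smooth_on V \<Psi>"
    "subspace T" "dim T = k" "\<forall>y\<in>U. y \<in> S \<longleftrightarrow> \<Phi> y \<in> T" "\<forall>t\<in>V. \<Psi> t \<in> S \<longleftrightarrow> t \<in> T"
proof -
  from bspec[OF assms(1)[unfolded submanifold_def] assms(2)]
  obtain U V T :: "'a set" and \<Phi> \<Psi> :: "'a \<Rightarrow> 'a" where *: "open U" "x \<in> U" "open V" "homeomorphism U V \<Phi> \<Psi>" "smooth_on U \<Phi>" "smooth_on V \<Psi>"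
    "subspace T" "dim T = k" "\<Phi> ` (S \<inter> U) = T \<inter> V"
    by blast
  have 1: "y \<in> S \<longleftrightarrow> \<Phi> y \<in> T" if y: "y \<in> U" for y
  proof
    assume "y \<in> S" then show "\<Phi> y \<in> T" using *(9) y by blast
  next
    assume "\<Phi> y \<in> T"
    moreover have "\<Phi> y \<in> V" using *(4) y by (auto simp: homeomorphism_def)
    ultimately have "\<Phi> y \<in> \<Phi> ` (S \<inter> U)" using *(9) by blast
    then obtain y' where y': "y' \<in> S" "y' \<in> U" "\<Phi> y = \<Phi> y'" by blast
    have "y = \<Psi> (\<Phi> y')" using homeomorphism_apply1[OF *(4) y] unfolding y'(3) by (rule sym)
    also have "\<dots> = y'" by (rule homeomorphism_apply1[OF *(4) y'(2)])
    finally show "y \<in> S" using y'(1) by (simp only:)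
  qed
  have 2: "\<Psi> t \<in> S \<longleftrightarrow> t \<in> T" if t: "t \<in> V" for t
  proof -
    have "\<Psi> t \<in> U" using *(4) t by (auto simp: homeomorphism_def)
    from 1[OF this] homeomorphism_apply2[OF *(4) t] show ?thesis by simp
  qed
  show ?thesis by (rule that[OF *(1-8)]) (use 1 2 in auto)
qed

lemma left_inverse_derivative:
  assumes "open V" "t \<in> V" "(\<Psi> has_derivative \<Psi>') (at t)" "(\<Phi> has_derivative \<Phi>') (at (\<Psi> t))" "\<And>t. t \<in> V \<Longrightarrow> \<Phi> (\<Psi> t) = t"
  shows "\<Phi>' (\<Psi>' v) = v"
proof -
  have "((\<lambda>t. \<Phi> (\<Psi> t)) has_derivative (\<lambda>v. \<Phi>' (\<Psi>' v))) (at t)"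
    by (rule has_derivative_compose[OF assms(3,4)])
  moreover have "((\<lambda>t. \<Phi> (\<Psi> t)) has_derivative (\<lambda>v. v)) (at t)"
    by (rule has_derivative_transform_within_open[OF has_derivative_ident assms(1,2)]) (simp add: assms(5))
  ultimately have "(\<lambda>v. \<Phi>' (\<Psi>' v)) = (\<lambda>v. v)" by (rule has_derivative_unique)
  then show ?thesis by (rule fun_cong)
qed

locale quadric_data =
  fixes p :: nat and M :: "real^('n::{finite,wellorder})^('n::_)" and c :: real
  assumes inv: "invertible M" and sa: "self_adjoint p M" and nd: "nondegenerate_hypersurface p (quadric p M c)"
begin

abbreviation "S \<equiv> quadric p M c"

text \<open>The kernel of the differential of \<open>real_form p x (M *v x)\<close>, by
  self-adjointness; its normal is \<open>M *v x\<close>.\<close>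

definition tangent_hyperplane :: "real^('n::_) \<Rightarrow> (real^('n::_)) set" where
  "tangent_hyperplane x = {v. real_form p v (M *v x) = 0}"

lemma M_inj: "M *v x = 0 \<Longrightarrow> x = 0"
  using inv by (simp add: invertible_left_inverse matrix_left_invertible_ker)

lemma quadricD:
  assumes "x \<in> S"
  shows "real_form p x (M *v x) = c" "x \<noteq> 0" "M *v x \<noteq> 0"
proof -
  show 1: "real_form p x (M *v x) = c" using assms by (simp add: quadric_def)
  show "x \<noteq> 0"
  proof
    assume "x = 0"
    then show False using 1 assms by (simp add: quadric_def)
  qed
  then show "M *v x \<noteq> 0" using M_inj by blast
qed

lemma self_adj: "real_form p (M *v x) y = real_form p x (M *v y)"
  using sa unfolding self_adjoint_def by blast

lemma tangent_hyperplane_eq: "tangent_hyperplane x = {v. form_dual p (M *v x) \<bullet> v = 0}"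
  by (auto simp: tangent_hyperplane_def inner_form_dual real_form_commute)

lemma subspace_tangent_hyperplane: "subspace (tangent_hyperplane x)"
  unfolding tangent_hyperplane_eq by (rule subspace_hyperplane)

lemma dim_tangent_hyperplane: "x \<in> S \<Longrightarrow> dim (tangent_hyperplane x) = CARD('n) - 1"
  unfolding tangent_hyperplane_eq using quadricD by (subst dim_hyperplane) (auto simp: form_dual_eq_0)

lemma derivative_in_tangent_hyperplane:
  assumes "open W" "t \<in> W" "(g has_derivative g') (at t)" "\<And>t. t \<in> W \<Longrightarrow> g t \<in> S"
  shows "g' v \<in> tangent_hyperplane (g t)"
proof -
  have Mg: "((\<lambda>t. M *v g t) has_derivative (\<lambda>v. M *v g' v)) (at t)"
    by (rule bounded_linear.has_derivative[OF matrix_vector_mul_bounded_linear assms(3)])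
  have "((\<lambda>t. real_form p (g t) (M *v g t)) has_derivative (\<lambda>v. real_form p (g t) (M *v g' v) + real_form p (g' v) (M *v g t))) (at t)"
    by (rule real_form_has_derivative[OF assms(3) Mg])
  moreover have "((\<lambda>t. real_form p (g t) (M *v g t)) has_derivative (\<lambda>v. 0)) (at t)"
    by (rule has_derivative_transform_within_open[OF has_derivative_const assms(1,2)]) (use assms(4) quadricD(1) in auto)
  ultimately have "(\<lambda>v. real_form p (g t) (M *v g' v) + real_form p (g' v) (M *v g t)) = (\<lambda>v. 0)"
    by (rule has_derivative_unique)
  from fun_cong[OF this, of v] show ?thesis
    using self_adj[of "g t" "g' v"] real_form_commute[of p "M *v g t" "g' v"] by (simp add: tangent_hyperplane_def)
qed

lemma tangent_space_subset: "tangent_space S x \<subseteq> tangent_hyperplane x"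
proof
  fix v assume "v \<in> tangent_space S x"
  then obtain \<gamma> \<delta> where g: "\<delta> > 0" "\<gamma> ` {-\<delta><..<\<delta>} \<subseteq> S" "\<gamma> 0 = x" "(\<gamma> has_vector_derivative v) (at (0::real))"
    unfolding tangent_space_def by blast
  have "(1::real) *\<^sub>R v \<in> tangent_hyperplane (\<gamma> 0)"
    by (rule derivative_in_tangent_hyperplane[of "{-\<delta><..<\<delta>}" 0 \<gamma> "\<lambda>h. h *\<^sub>R v"])
      (use g in \<open>auto simp: has_vector_derivative_def\<close>)
  then show "v \<in> tangent_hyperplane x" using g by simp
qed

lemma submanifold_S: "submanifold (CARD('n) - 1) S"
  using nd unfolding nondegenerate_hypersurface_def by blast

text \<open>A null \<open>M *v x\<close> would be tangent and orthogonal to every tangent vector,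
  against non-degeneracy. This argument requires the space of velocities of curves to be all of
  \<open>tangent_hyperplane x\<close>; straight lines in a submanifold chart supply enough
  curves.\<close>

lemma normal_nonnull:
  assumes x: "x \<in> S"
  shows "real_form p (M *v x) (M *v x) \<noteq> 0"
proof
  assume null: "real_form p (M *v x) (M *v x) = 0"
  obtain U V T :: "(real^('n::_)) set" and \<Phi> \<Psi> :: "real^('n::_) \<Rightarrow> real^('n::_)" where c: "open U" "x \<in> U" "open V" "homeomorphism U V \<Phi> \<Psi>" "smooth_on U \<Phi>" "smooth_on V \<Psi>"
    "subspace T" "dim T = CARD('n) - 1" "\<forall>y\<in>U. y \<in> S \<longleftrightarrow> \<Phi> y \<in> T" "\<forall>t\<in>V. \<Psi> t \<in> S \<longleftrightarrow> t \<in> T"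
    by (rule submanifold_chart[OF submanifold_S x])
  define t0 where "t0 = \<Phi> x"
  have t0: "t0 \<in> V" "t0 \<in> T" "\<Psi> t0 = x"
    using c x homeomorphism_apply1[OF c(4,2)] by (auto simp: t0_def homeomorphism_def)
  have \<Psi>: "ck_on k V \<Psi>" for k by (rule smooth_on_openD[OF c(3,6)])
  have \<Phi>: "ck_on k U \<Phi>" for k by (rule smooth_on_openD[OF c(1,5)])
  let ?D = "frechet_derivative \<Psi> (at t0)"
  have D: "(\<Psi> has_derivative ?D) (at t0)" by (rule ck_on_has_derivative[OF \<Psi> t0(1)])
  have D': "(\<Phi> has_derivative frechet_derivative \<Phi> (at (\<Psi> t0))) (at (\<Psi> t0))"
    by (rule ck_on_has_derivative[OF \<Phi>]) (simp add: t0 c)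
  have "frechet_derivative \<Phi> (at (\<Psi> t0)) (?D v) = v" for v
    by (rule left_inverse_derivative[OF c(3) t0(1) D D']) (rule homeomorphism_apply2[OF c(4)])
  then have inj: "inj ?D" by (metis injI)
  have lin: "linear ?D" using D has_derivative_linear by blast
  have tan: "?D t \<in> tangent_space S x" if t: "t \<in> T" for t
  proof -
    define L where "L = (\<lambda>\<tau>::real. t0 + \<tau> *\<^sub>R t)"
    have "open (L -` V)" by (rule open_vimage[OF c(3)]) (auto simp: L_def intro!: continuous_intros)
    moreover have "0 \<in> L -` V" using t0 by (simp add: L_def)
    ultimately obtain \<delta> where \<delta>: "\<delta> > 0" "ball 0 \<delta> \<subseteq> L -` V" unfolding open_contains_ball by blast
    have ball: "ball 0 \<delta> = {-\<delta><..<\<delta>}" by (simp add: ball_eq_greaterThanLessThan)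
    have L: "smooth_on {-\<delta><..<\<delta>} L" unfolding L_def
      by (intro smooth_on_add smooth_on_scaleR smooth_on_const smooth_on_ident)
    have 1: "smooth_on {-\<delta><..<\<delta>} (\<lambda>\<tau>. \<Psi> (L \<tau>))"
      by (rule smooth_on_compose[OF L c(6)]) (use \<delta>(2) ball in auto)
    have 2: "(\<lambda>\<tau>. \<Psi> (L \<tau>)) ` {-\<delta><..<\<delta>} \<subseteq> S"
    proof
      fix z assume "z \<in> (\<lambda>\<tau>. \<Psi> (L \<tau>)) ` {-\<delta><..<\<delta>}"
      then obtain \<tau> where \<tau>: "\<tau> \<in> {-\<delta><..<\<delta>}" "z = \<Psi> (L \<tau>)" by blast
      have "L \<tau> \<in> V" using \<tau> \<delta>(2) ball by auto
      moreover have "L \<tau> \<in> T" unfolding L_def by (intro subspace_add subspace_scale c(7) t t0)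
      ultimately show "z \<in> S" using c(10) \<tau> by blast
    qed
    have 3: "((\<lambda>\<tau>. \<Psi> (L \<tau>)) has_vector_derivative ?D t) (at 0)"
    proof -
      have "((\<lambda>\<tau>. \<Psi> (L \<tau>)) has_derivative (\<lambda>h. ?D (h *\<^sub>R t))) (at 0)"
        by (rule has_derivative_compose[of L "\<lambda>h. h *\<^sub>R t"]) (use D in \<open>auto simp: L_def intro!: derivative_eq_intros\<close>)
      then show ?thesis by (simp add: has_vector_derivative_def linear_cmul[OF lin])
    qed
    have 4: "\<Psi> (L 0) = x" using t0 by (simp add: L_def)
    show ?thesis unfolding tangent_space_def
      using \<delta>(1) 1 2 3 4 by blast
  qed
  have sub: "?D ` T \<subseteq> tangent_hyperplane x" using tan tangent_space_subset by blast
  have "dim (?D ` T) = dim T" by (rule dim_image_eq[OF lin]) (use inj in \<open>auto intro: inj_on_subset\<close>)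
  \<comment> \<open>An injective image of \<open>T\<close> inside the hyperplane, both of dimension
    n - 1.\<close>
  then have DT: "?D ` T = tangent_hyperplane x"
    by (intro subspace_dim_equal linear_subspace_image[OF lin c(7)] subspace_tangent_hyperplane sub)
      (simp add: c(8) dim_tangent_hyperplane[OF x])
  have "tangent_hyperplane x \<subseteq> tangent_space S x"
    unfolding DT[symmetric] by (rule image_subsetI) (rule tan)
  with tangent_space_subset have eq: "tangent_space S x = tangent_hyperplane x" by (rule subset_antisym)
  have "M *v x \<in> tangent_space S x" unfolding eq using null by (simp add: tangent_hyperplane_def)
  moreover have "\<forall>w\<in>tangent_space S x. real_form p (M *v x) w = 0"
    unfolding eq by (auto simp: tangent_hyperplane_def real_form_commute)
  ultimately have "M *v x = 0" using nd x unfolding nondegenerate_hypersurface_def by blast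
  then show False using quadricD(3)[OF x] by blast
qed

text \<open>A submanifold chart straightens the quadric to a subspace \<open>T\<close> of dimension
  n - 1. A linear isomorphism of R^n with the product of R and \<open>T\<close> makes it a
  parametrization of \<open>I \<times> S\<close>. The inverse \<open>\<pi>\<close> is smooth since
  it is defined on an open subset of the ambient space, and a ball as domain is connected.\<close>

lemma adapted_charts_exist:
  fixes I :: "real set"
  assumes I: "open I" and z: "z \<in> I \<times> S"
  shows "\<exists>(W::(real^('n::_)) set) \<psi> \<pi>. adapted_chart (I \<times> S) W \<psi> \<pi> \<and> z \<in> \<psi> ` W"
proof -
  obtain s0 x where z': "z = (s0, x)" "s0 \<in> I" "x \<in> S" using z by auto
  obtain U V T :: "(real^('n::_)) set" and \<Phi> \<Psi> :: "real^('n::_) \<Rightarrow> real^('n::_)" where c: "open U" "x \<in> U" "open V" "homeomorphism U V \<Phi> \<Psi>" "smooth_on U \<Phi>" "smooth_on V \<Psi>"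
    "subspace T" "dim T = CARD('n) - 1" "\<forall>y\<in>U. y \<in> S \<longleftrightarrow> \<Phi> y \<in> T" "\<forall>t\<in>V. \<Psi> t \<in> S \<longleftrightarrow> t \<in> T"
    by (rule submanifold_chart[OF submanifold_S z'(3)])
  have sT: "subspace ((UNIV::real set) \<times> T)" using c(7) by (intro subspace_Times) auto
  have "dim ((UNIV::real set) \<times> T) = dim (UNIV :: (real^('n::_)) set)"
    using c(7,8) by (subst dim_Times) auto
  then obtain g f where fg: "linear f" "linear g" "f ` (UNIV :: (real^('n::_)) set) = (UNIV::real set) \<times> T"
     "g ` ((UNIV::real set) \<times> T) = (UNIV :: (real^('n::_)) set)" "\<And>u. g (f u) = u" "\<And>w. w \<in> UNIV \<times> T \<Longrightarrow> f (g w) = w"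
    by (metis UNIV_I isometries_subspaces[OF subspace_UNIV sT])
  have bf: "bounded_linear f" and bg: "bounded_linear g" using fg(1,2)[unfolded linear_conv_bounded_linear] by blast+
  have cf: "continuous_on A f" for A using bf linear_continuous_on by blast
  define u0 where "u0 = g (s0, \<Phi> x)"
  have \<Phi>x: "\<Phi> x \<in> V" "\<Phi> x \<in> T" using c z' by (auto simp: homeomorphism_def)
  have "open (f -` (I \<times> V))" by (rule open_vimage[OF open_Times[OF I c(3)] cf])
  moreover have "u0 \<in> f -` (I \<times> V)" using fg(6)[of "(s0, \<Phi> x)"] \<Phi>x z' by (simp add: u0_def)
  ultimately obtain \<rho> where \<rho>: "\<rho> > 0" "ball u0 \<rho> \<subseteq> f -` (I \<times> V)" unfolding open_contains_ball by blast
  define W where "W = ball u0 \<rho>"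
  have W: "open W" "connected W" by (simp_all add: W_def)
  have fW: "fst (f u) \<in> I" "snd (f u) \<in> V" "snd (f u) \<in> T" if "u \<in> W" for u
  proof -
    have "f u \<in> I \<times> V" using \<rho>(2) that by (auto simp: W_def)
    then show "fst (f u) \<in> I" "snd (f u) \<in> V" by auto
    have "f u \<in> UNIV \<times> T" using fg(3) by blast
    then show "snd (f u) \<in> T" by auto
  qed
  define \<psi> where "\<psi> u = (fst (f u), \<Psi> (snd (f u)))" for u
  define \<pi> where "\<pi> w = g (fst w, \<Phi> (snd w))" for w
  have \<Psi>U: "\<Psi> t \<in> U" if "t \<in> V" for t using c(4) that by (auto simp: homeomorphism_def)
  have \<psi>U: "\<psi> u \<in> UNIV \<times> U" "\<psi> u \<in> I \<times> S" if "u \<in> W" for u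
    using fW[OF that] \<Psi>U c(10) by (auto simp: \<psi>_def)
  have \<pi>\<psi>: "\<pi> (\<psi> u) = u" if "u \<in> W" for u
    using homeomorphism_apply2[OF c(4) fW(2)[OF that]] fg(5)[of u] by (simp add: \<pi>_def \<psi>_def)
  have sm\<psi>: "smooth_on W \<psi>"
    unfolding \<psi>_def
    by (intro smooth_on_Pair smooth_on_fst smooth_on_bounded_linear[OF bf] smooth_on_ident
        smooth_on_compose[OF smooth_on_snd[OF smooth_on_bounded_linear[OF bf smooth_on_ident]] c(6)])
      (use fW in auto)
  have sm\<pi>: "smooth_on (UNIV \<times> U) \<pi>"
    unfolding \<pi>_def
    by (intro smooth_on_bounded_linear[OF bg] smooth_on_Pair smooth_on_fst smooth_on_ident
        smooth_on_compose[OF smooth_on_snd[OF smooth_on_ident] c(5)]) auto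
  have oU: "open ((UNIV::real set) \<times> U)" by (intro open_Times c) simp
  have image: "\<psi> ` W = (I \<times> S) \<inter> ((UNIV \<times> U) \<inter> \<pi> -` W)"
  proof
    show "\<psi> ` W \<subseteq> (I \<times> S) \<inter> ((UNIV \<times> U) \<inter> \<pi> -` W)"
    proof
      fix w assume "w \<in> \<psi> ` W"
      then obtain u where "u \<in> W" "w = \<psi> u" by blast
      then show "w \<in> (I \<times> S) \<inter> ((UNIV \<times> U) \<inter> \<pi> -` W)" using \<psi>U \<pi>\<psi> by auto
    qed
    show "(I \<times> S) \<inter> ((UNIV \<times> U) \<inter> \<pi> -` W) \<subseteq> \<psi> ` W"
    proof
      fix w assume w: "w \<in> (I \<times> S) \<inter> ((UNIV \<times> U) \<inter> \<pi> -` W)"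
      then have sw: "snd w \<in> S" "snd w \<in> U" "\<pi> w \<in> W" by auto
      have "f (\<pi> w) = (fst w, \<Phi> (snd w))" unfolding \<pi>_def by (rule fg(6)) (use c(9) sw in auto)
      then have "\<psi> (\<pi> w) = w" using homeomorphism_apply1[OF c(4) sw(2)] by (simp add: \<psi>_def)
      then show "w \<in> \<psi> ` W" using sw(3) by (metis imageI)
    qed
  qed
  have lp: "local_parametrization (I \<times> S) W \<psi>"
    unfolding local_parametrization_def
  proof (intro conjI ballI W sm\<psi>)
    have "open ((UNIV \<times> U) \<inter> \<pi> -` W)"
      by (rule continuous_open_preimage[OF smooth_on_continuous_on[OF sm\<pi>] oU W(1)])
    then show "openin (top_of_set (I \<times> S)) (\<psi> ` W)" unfolding image by (rule openin_open_Int)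
    have "homeomorphism W (\<psi> ` W) \<psi> \<pi>"
      unfolding homeomorphism_def
    proof (intro conjI ballI)
      show "continuous_on (\<psi> ` W) \<pi>"
        by (rule continuous_on_subset[OF smooth_on_continuous_on[OF sm\<pi>]]) (use \<psi>U(1) in blast)
    qed (use \<pi>\<psi> smooth_on_continuous_on[OF sm\<psi>] in \<open>auto simp: image_image\<close>)
    then show "\<exists>\<pi>. homeomorphism W (\<psi> ` W) \<psi> \<pi>" by blast
    fix u assume u: "u \<in> W"
    have d1: "(\<psi> has_derivative frechet_derivative \<psi> (at u)) (at u)"
      by (rule ck_on_has_derivative[OF smooth_on_openD[OF W(1) sm\<psi>] u])
    have d2: "(\<pi> has_derivative frechet_derivative \<pi> (at (\<psi> u))) (at (\<psi> u))"
      by (rule ck_on_has_derivative[OF smooth_on_openD[OF oU sm\<pi>] \<psi>U(1)[OF u]])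
    have "frechet_derivative \<pi> (at (\<psi> u)) (frechet_derivative \<psi> (at u) v) = v" for v
      by (rule left_inverse_derivative[OF W(1) u d1 d2 \<pi>\<psi>])
    then show "inj (frechet_derivative \<psi> (at u))" by (metis injI)
  qed
  have "smooth_on (\<psi> ` W) \<pi>" by (rule smooth_on_subset[OF sm\<pi>]) (use \<psi>U(1) in blast)
  then have "adapted_chart (I \<times> S) W \<psi> \<pi>"
    unfolding adapted_chart_def using lp W \<pi>\<psi> by blast
  moreover have "z \<in> \<psi> ` W"
  proof -
    have "\<psi> u0 = z" using fg(6)[of "(s0, \<Phi> x)"] \<Phi>x homeomorphism_apply1[OF c(4,2)] z' by (simp add: u0_def \<psi>_def)
    then show ?thesis using \<rho>(1) by (force simp: W_def)
  qed
  ultimately show ?thesis by blast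
qed

text \<open>The count 1 + (n - 1) = n upgrades the inclusion of the range to equality. Thus
  conditions obtained in a parametrization can be tested on every tangent vector of
  \<open>I \<times> S\<close>.\<close>

lemma parametrization_derivative:
  fixes W :: "(real^('n::_)) set" and I :: "real set"
  assumes lp: "local_parametrization (I \<times> S) W \<phi>" and u: "u \<in> W" and I: "open I"
  shows "(\<phi> has_derivative frechet_derivative \<phi> (at u)) (at u)"
    "range (frechet_derivative \<phi> (at u)) = UNIV \<times> tangent_hyperplane (snd (\<phi> u))"
    "fst (\<phi> u) \<in> I" "snd (\<phi> u) \<in> S"
proof -
  note W = local_parametrizationD[OF lp]
  let ?L = "frechet_derivative \<phi> (at u)"
  show L: "(\<phi> has_derivative ?L) (at u)" by (rule ck_on_has_derivative[OF W(6) u])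
  show "fst (\<phi> u) \<in> I" and x: "snd (\<phi> u) \<in> S" using W(3) u by auto
  have lin: "linear ?L" using L has_derivative_linear by blast
  have inj: "inj ?L" using lp u unfolding local_parametrization_def by blast
  have N: "snd (?L v) \<in> tangent_hyperplane (snd (\<phi> u))" for v
    by (rule derivative_in_tangent_hyperplane[OF W(1) u has_derivative_snd[OF L]]) (use W(3) in auto)
  have "range ?L = UNIV \<times> tangent_hyperplane (snd (\<phi> u))"
  proof (rule subspace_dim_equal)
    show "subspace (range ?L)" by (rule linear_subspace_image[OF lin subspace_UNIV])
    show "subspace ((UNIV::real set) \<times> tangent_hyperplane (snd (\<phi> u)))"
      by (intro subspace_Times subspace_UNIV subspace_tangent_hyperplane)
    show "range ?L \<subseteq> UNIV \<times> tangent_hyperplane (snd (\<phi> u))"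
    proof
      fix w assume "w \<in> range ?L"
      then obtain v where "w = ?L v" by blast
      then show "w \<in> UNIV \<times> tangent_hyperplane (snd (\<phi> u))" using N[of v] by (simp add: mem_Times_iff)
    qed
    have "dim (range ?L) = dim (UNIV :: (real^('n::_)) set)"
      by (rule dim_image_eq[OF lin]) (use inj in simp)
    moreover have "dim ((UNIV::real set) \<times> tangent_hyperplane (snd (\<phi> u))) = 1 + (CARD('n) - 1)"
      by (subst dim_Times[OF subspace_UNIV subspace_tangent_hyperplane]) (simp add: dim_tangent_hyperplane[OF x])
    ultimately show "dim ((UNIV::real set) \<times> tangent_hyperplane (snd (\<phi> u))) \<le> dim (range ?L)" by simp
  qed
  then show "range ?L = UNIV \<times> tangent_hyperplane (snd (\<phi> u))" .
qed

end

section \<open>The immersion\<close>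

lemma matrix_vector_mult_smult: "(A :: complex^'n^'m) *v (a *s x) = a *s (A *v x)"
  by (simp add: vec_eq_iff matrix_vector_mult_def sum_distrib_left algebra_simps)

lemma imat_complex_vec: "imat M *v complex_vec x = \<i> *s complex_vec (M *v x)"
  by (simp add: vec_eq_iff matrix_vector_mult_def imat_def sum_distrib_left algebra_simps)

text \<open>The real factor between \<open>D\<close> and \<open>Q\<close> is not known to be
  differentiable. Differentiating Im (D cnj Q) = 0 avoids it, and only its value at \<open>u\<close>
  is used to pass from \<open>D\<close> to \<open>Q\<close>.\<close>

lemma Im_cnj_mult_real_multiple:
  fixes D Q :: "'a::real_normed_vector \<Rightarrow> complex"
  assumes W: "open W" "u \<in> W" and D: "(D has_derivative D') (at u)" and Q: "(Q has_derivative Q') (at u)"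
    and real: "\<And>x. x \<in> W \<Longrightarrow> \<exists>\<rho>::real. D x = of_real \<rho> * Q x" and nz: "D u \<noteq> 0"
    and im: "Im (cnj (D u) * D' v) = 0"
  shows "Im (cnj (Q u) * Q' v) = 0"
proof -
  obtain \<rho> :: real where \<rho>: "D u = of_real \<rho> * Q u" using real[OF W(2)] by blast
  have \<rho>0: "\<rho> \<noteq> 0" using nz \<rho> by auto
  have "((\<lambda>x. Im (D x * cnj (Q x))) has_derivative (\<lambda>v. Im (D u * cnj (Q' v) + D' v * cnj (Q u)))) (at u)"
    by (rule bounded_linear.has_derivative[OF bounded_linear_Im has_derivative_mult[OF D bounded_linear.has_derivative[OF bounded_linear_cnj Q]]])
  moreover have "((\<lambda>x. Im (D x * cnj (Q x))) has_derivative (\<lambda>v. 0)) (at u)"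
  proof (rule has_derivative_transform_within_open[OF has_derivative_const W])
    fix x assume "x \<in> W"
    then obtain \<rho> :: real where "D x = of_real \<rho> * Q x" using real by blast
    then show "0 = Im (D x * cnj (Q x))" by (simp add: mult.assoc complex_mult_cnj)
  qed
  ultimately have "(\<lambda>v. Im (D u * cnj (Q' v) + D' v * cnj (Q u))) = (\<lambda>v. 0)" by (rule has_derivative_unique)
  from fun_cong[OF this, of v] have 1: "Im (D u * cnj (Q' v) + D' v * cnj (Q u)) = 0" .
  have "\<rho> * Im (D u * cnj (Q' v) + D' v * cnj (Q u)) = - (\<rho>\<^sup>2) * Im (cnj (Q u) * Q' v) + Im (cnj (D u) * D' v)"
    by (simp add: \<rho> power2_eq_square algebra_simps)
  then show ?thesis using 1 im \<rho>0 by simp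
qed

locale quadric_immersion_data = quadric_data p M c
  for p :: nat and M :: "real^('n::{finite,wellorder})^('n::_)" and c :: real +
  fixes I :: "real set" and r :: "real \<Rightarrow> real"
  assumes openI: "open I" and intI: "is_interval I" and smooth_r: "smooth_on I r" and r_pos: "\<And>s. s \<in> I \<Longrightarrow> r s > 0"
begin

abbreviation "f \<equiv> quadric_immersion M r"
abbreviation "E s \<equiv> matrix_exp (s *\<^sub>R imat M)"
abbreviation "m x \<equiv> real_form p (M *v x) (M *v x)"

definition r' :: "real \<Rightarrow> real" where "r' s = frechet_derivative r (at s) 1"
definition r'' :: "real \<Rightarrow> real" where "r'' s = frechet_derivative r' (at s) 1"

text \<open>The \<open>s\<close>-derivative of the immersion is \<open>E s\<close> applied to this
  vector.\<close>

definition Z :: "real \<Rightarrow> real^('n::_) \<Rightarrow> complex^('n::_)" where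
  "Z s x = of_real (r' s) *s complex_vec x + (\<i> * of_real (r s)) *s complex_vec (M *v x)"

text \<open>Since \<open>x - (c / m x) M x\<close> is tangent to the quadric, \<open>\<kappa>\<close> is the coefficient of \<open>Z\<close> along
  \<open>M x\<close> modulo tangent vectors.\<close>

definition \<kappa> :: "real \<Rightarrow> real^('n::_) \<Rightarrow> complex" where
  "\<kappa> s x = Complex (r' s * c / m x) (r s)"

definition q :: "real \<times> (real^('n::_)) \<Rightarrow> complex" where
  "q z = exp (\<i> * of_real (fst z * trace M)) * \<kappa> (fst z) (snd z)"

lemma ck_r: "ck_on k I r"
  by (rule smooth_on_openD[OF openI smooth_r])

lemma frechet_derivative_real: "ck_on (Suc 0) I g \<Longrightarrow> s \<in> I \<Longrightarrow> (g has_real_derivative frechet_derivative g (at s) 1) (at s)" for g :: "real \<Rightarrow> real"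
proof -
  assume g: "ck_on (Suc 0) I g" and s: "s \<in> I"
  have d: "(g has_derivative frechet_derivative g (at s)) (at s)" by (rule ck_on_has_derivative[OF g s])
  have "frechet_derivative g (at s) = (*) (frechet_derivative g (at s) 1)"
  proof
    fix h show "frechet_derivative g (at s) h = frechet_derivative g (at s) 1 * h"
      using linear_cmul[OF has_derivative_linear[OF d], of h 1] by simp
  qed
  then show ?thesis using d unfolding has_field_derivative_def by metis
qed

lemma ck_r': "ck_on k I r'"
  using ck_r[of "Suc k"] by (simp add: r'_def[abs_def])

lemma r_deriv: "s \<in> I \<Longrightarrow> (r has_real_derivative r' s) (at s)"
  unfolding r'_def by (rule frechet_derivative_real[OF ck_r])

lemma r'_deriv: "s \<in> I \<Longrightarrow> (r' has_real_derivative r'' s) (at s)"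
  unfolding r''_def by (rule frechet_derivative_real[OF ck_r'])

lemma E_mult_Z:
  "E s *v (of_real a *s Z s x + of_real (r s) *s complex_vec v) =
   a *\<^sub>R (r' s *\<^sub>R (E s *v complex_vec x) + r s *\<^sub>R ((imat M ** E s) *v complex_vec x)) + r s *\<^sub>R (E s *v complex_vec v)"
proof -
  have "(imat M ** E s) *v complex_vec x = E s *v (\<i> *s complex_vec (M *v x))"
    by (simp only: matrix_exp_commute[symmetric] matrix_vector_mul_assoc[symmetric] imat_complex_vec)
  then show ?thesis
    unfolding Z_def by (simp add: matrix_vector_mult_smult matrix_vector_right_distrib vec_eq_iff scaleR_conv_of_real[where 'a=complex] algebra_simps)
qed

lemma immersion_has_derivative:
  assumes s: "s \<in> I"
  shows "(f has_derivative (\<lambda>w. E s *v (of_real (fst w) *s Z s x + of_real (r s) *s complex_vec (snd w)))) (at (s, x))"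
proof (rule has_derivative_vec_components)
  fix i
  have hf: "(fst has_derivative fst) (at (s, x))" by (rule has_derivative_fst[OF has_derivative_ident])
  have r: "((\<lambda>z. r (fst z)) has_derivative (\<lambda>w. r' s * fst w)) (at (s, x))"
    by (rule has_derivative_compose[OF hf, where g = r and g' = "(*) (r' s)"])
      (use r_deriv[OF s] in \<open>simp add: has_field_derivative_def\<close>)
  have E: "((\<lambda>z. E (fst z) $ i $ j) has_derivative (\<lambda>w. fst w *\<^sub>R (imat M ** E s) $ i $ j)) (at (s, x))" for j
    by (rule has_derivative_compose[OF hf, where g = "\<lambda>s. E s $ i $ j" and g' = "\<lambda>h. h *\<^sub>R (imat M ** E s) $ i $ j"])
      (use matrix_exp_has_vector_derivative[of "imat M" i j s] in \<open>simp add: has_vector_derivative_def\<close>)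
  have X: "((\<lambda>z. complex_of_real (snd z $ j)) has_derivative (\<lambda>w. of_real (snd w $ j))) (at (s, x))" for j
    by (intro bounded_linear.has_derivative[OF bounded_linear_of_real] bounded_linear.has_derivative[OF bounded_linear_vec_nth]
        has_derivative_snd has_derivative_ident)
  have "((\<lambda>z. r (fst z) *\<^sub>R (\<Sum>j\<in>UNIV. E (fst z) $ i $ j * of_real (snd z $ j))) has_derivative
    (\<lambda>w. r s *\<^sub>R (\<Sum>j\<in>UNIV. E s $ i $ j * of_real (snd w $ j) + (fst w *\<^sub>R (imat M ** E s) $ i $ j) * of_real (x $ j))
       + (r' s * fst w) *\<^sub>R (\<Sum>j\<in>UNIV. E s $ i $ j * of_real (x $ j)))) (at (s, x))"
  proof -
    have "((\<lambda>z. \<Sum>j\<in>UNIV. E (fst z) $ i $ j * of_real (snd z $ j)) has_derivative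
      (\<lambda>w. \<Sum>j\<in>UNIV. E s $ i $ j * of_real (snd w $ j) + (fst w *\<^sub>R (imat M ** E s) $ i $ j) * of_real (x $ j))) (at (s, x))"
      using has_derivative_mult[OF E X] by (intro has_derivative_sum) simp
    from has_derivative_scaleR[OF r this] show ?thesis by simp
  qed
  moreover have "r (fst z) *\<^sub>R (\<Sum>j\<in>UNIV. E (fst z) $ i $ j * of_real (snd z $ j)) = f z $ i" for z
    using quadric_immersion_eq[of M r "fst z" "snd z"] by (simp add: matrix_vector_mult_def)
  moreover have "r s *\<^sub>R (\<Sum>j\<in>UNIV. E s $ i $ j * of_real (snd w $ j) + (fst w *\<^sub>R (imat M ** E s) $ i $ j) * of_real (x $ j))
       + (r' s * fst w) *\<^sub>R (\<Sum>j\<in>UNIV. E s $ i $ j * of_real (x $ j))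
     = (E s *v (of_real (fst w) *s Z s x + of_real (r s) *s complex_vec (snd w))) $ i" for w
    unfolding E_mult_Z
    by (simp add: matrix_vector_mult_def sum.distrib scaleR_conv_of_real[where 'a=complex] sum_distrib_left algebra_simps)
  ultimately show "((\<lambda>z. f z $ i) has_derivative (\<lambda>w. (E s *v (of_real (fst w) *s Z s x + of_real (r s) *s complex_vec (snd w))) $ i)) (at (s, x))"
    by simp
qed

lemma smooth_immersion: "smooth_on (I \<times> S) f"
proof (rule smooth_onI)
  show o: "open (I \<times> (UNIV :: (real^('n::_)) set))" by (intro open_Times openI) simp
  show "I \<times> S \<subseteq> I \<times> UNIV" by auto
  fix k
  have "ck_on k (I \<times> UNIV) (\<lambda>z. \<chi> i. r (fst z) *\<^sub>R (\<Sum>j\<in>UNIV. E (fst z) $ i $ j * of_real (snd z $ j)))"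
    by (intro ck_on_vec ck_on_scaleR ck_on_sum ck_on_mult ck_on_compose[OF o openI ck_on_fst[OF o ck_on_ident[OF o]] ck_r]
        ck_on_compose[OF o open_UNIV ck_on_fst[OF o ck_on_ident[OF o]] ck_on_matrix_exp]
        ck_on_bounded_linear[OF bounded_linear_of_real] ck_on_nth ck_on_snd ck_on_ident o) auto
  moreover have "(\<chi> i. r (fst z) *\<^sub>R (\<Sum>j\<in>UNIV. E (fst z) $ i $ j * of_real (snd z $ j))) = f z" for z
    using quadric_immersion_eq[of M r "fst z" "snd z"] by (simp add: matrix_vector_mult_def vec_eq_iff)
  ultimately show "ck_on k (I \<times> UNIV) f" by simp
qed

context
  fixes W :: "(real^('n::_)) set" and \<phi> u
  assumes lp: "local_parametrization (I \<times> S) W \<phi>" and u: "u \<in> W"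
begin

abbreviation (input) "su \<equiv> fst (\<phi> u)"
abbreviation (input) "xu \<equiv> snd (\<phi> u)"
abbreviation (input) "Lu \<equiv> frechet_derivative \<phi> (at u)"
abbreviation (input) "tang v \<equiv> of_real (fst (Lu v)) *s Z su xu + of_real (r su) *s complex_vec (snd (Lu v))"

lemma chart_facts:
  "(\<phi> has_derivative Lu) (at u)" "su \<in> I" "xu \<in> S" "linear Lu" "inj Lu" "snd (Lu v) \<in> tangent_hyperplane xu" "m xu \<noteq> 0" "r su > 0"
  using parametrization_derivative[OF lp u openI] normal_nonnull r_pos
proof -
  note p = parametrization_derivative[OF lp u openI]
  show "(\<phi> has_derivative Lu) (at u)" "su \<in> I" "xu \<in> S" by (fact p)+
  then show "linear Lu" "m xu \<noteq> 0" "r su > 0" using has_derivative_linear normal_nonnull r_pos by blast+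
  show "inj Lu" using lp u unfolding local_parametrization_def by blast
  have "Lu v \<in> UNIV \<times> tangent_hyperplane xu" using p(2) by blast
  then show "snd (Lu v) \<in> tangent_hyperplane xu" by (simp add: mem_Times_iff)
qed

lemma frechet_f_chart: "frechet_derivative (f \<circ> \<phi>) (at u) = (\<lambda>v. E su *v tang v)"
proof (rule frechet_derivative_eqI)
  have "(f has_derivative (\<lambda>w. E su *v (of_real (fst w) *s Z su xu + of_real (r su) *s complex_vec (snd w)))) (at (\<phi> u))"
    using immersion_has_derivative[OF chart_facts(2), of xu] by simp
  from has_derivative_compose[OF chart_facts(1) this]
  show "(f \<circ> \<phi> has_derivative (\<lambda>v. E su *v tang v)) (at u)" by (simp add: o_def)
qed

lemma herm_Z:
  assumes "n \<in> tangent_hyperplane xu"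
  shows "herm_form p (Z su xu) (complex_vec (M *v xu)) = Complex (r' su * c) (r su * m xu)"
    "herm_form p (complex_vec n) (complex_vec (M *v xu)) = 0"
    "Im (herm_form p (Z su xu) (Z su xu)) = 0" "Im (herm_form p (Z su xu) (complex_vec n)) = 0" "Im (herm_form p (complex_vec n) (Z su xu)) = 0"
  using assms quadricD(1)[OF chart_facts(3)] real_form_commute[of p xu "M *v xu"] real_form_commute[of p n "M *v xu"]
  by (simp_all add: Z_def herm_form_linear herm_form_complex_vec tangent_hyperplane_def complex_eq_iff)

lemma lagrangian_chart: "Im (herm_form p (frechet_derivative (f \<circ> \<phi>) (at u) v) (frechet_derivative (f \<circ> \<phi>) (at u) w)) = 0"
proof -
  have "Im (herm_form p (tang v) (tang w)) = 0"
    using herm_Z[OF chart_facts(6)[of v]] herm_Z[OF chart_facts(6)[of w]]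
    by (simp add: herm_form_linear herm_form_complex_vec)
  then show ?thesis unfolding frechet_f_chart herm_form_matrix_exp[OF sa] .
qed

lemma jac_f_chart: "jac (f \<circ> \<phi>) u = (\<chi> j. tang (axis j 1)) ** transpose (E su)"
  unfolding jac_def frechet_f_chart
  by (simp add: vec_eq_iff matrix_matrix_mult_def matrix_vector_mult_def transpose_def mult.commute)

text \<open>A complex relation between the rows is split into real and imaginary parts
  \<open>a\<close> and \<open>b\<close>. Once the coefficient of \<open>Z\<close> is shown to
  vanish, injectivity of the differential of \<open>\<phi>\<close> forces both parts to be
  0.\<close>

lemma det_jac_nonzero: "det (jac (f \<circ> \<phi>) u) \<noteq> 0"
proof -
  let ?R = "\<chi> j. tang (axis j 1)"
  have "\<forall>w. transpose ?R *v w = 0 \<longrightarrow> w = 0"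
  proof (intro allI impI)
    fix w :: "complex^('n::_)" assume w: "transpose ?R *v w = 0"
    define a where "a = (\<chi> j. Re (w $ j))"
    define b where "b = (\<chi> j. Im (w $ j))"
    have La: "Lu v = (\<Sum>j\<in>UNIV. v $ j *\<^sub>R Lu (axis j 1))" for v by (rule linear_axis_expansion[OF chart_facts(4)])
    have comp: "fst (Lu v) = (\<Sum>j\<in>UNIV. v $ j * fst (Lu (axis j 1)))"
      "snd (Lu v) $ i = (\<Sum>j\<in>UNIV. v $ j * snd (Lu (axis j 1)) $ i)" for v i
      by (subst La, simp add: fst_sum snd_sum)+
    have w_fst: "(\<Sum>j\<in>UNIV. w $ j * of_real (fst (Lu (axis j 1)))) = Complex (fst (Lu a)) (fst (Lu b))"
      unfolding comp(1)[of a] comp(1)[of b] by (simp add: complex_eq_iff a_def b_def)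
    have w_snd: "(\<Sum>j\<in>UNIV. w $ j * of_real (snd (Lu (axis j 1)) $ i)) = Complex (snd (Lu a) $ i) (snd (Lu b) $ i)" for i
      unfolding comp(2)[of a] comp(2)[of b] by (simp add: complex_eq_iff a_def b_def)
    have eq: "Complex (fst (Lu a)) (fst (Lu b)) *s Z su xu + of_real (r su) *s (complex_vec (snd (Lu a)) + \<i> *s complex_vec (snd (Lu b))) = 0"
    proof (simp only: vec_eq_iff, intro allI)
      fix i
      have "0 = (\<Sum>j\<in>UNIV. tang (axis j 1) $ i * w $ j)"
        using w by (simp add: vec_eq_iff matrix_vector_mult_def transpose_def)
      also have "\<dots> = (\<Sum>j\<in>UNIV. w $ j * of_real (fst (Lu (axis j 1)))) * Z su xu $ i + of_real (r su) * (\<Sum>j\<in>UNIV. w $ j * of_real (snd (Lu (axis j 1)) $ i))"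
        by (simp add: sum_distrib_left sum_distrib_right sum.distrib algebra_simps)
      also have "\<dots> = Complex (fst (Lu a)) (fst (Lu b)) * Z su xu $ i + of_real (r su) * Complex (snd (Lu a) $ i) (snd (Lu b) $ i)"
        unfolding w_fst w_snd ..
      finally show "(Complex (fst (Lu a)) (fst (Lu b)) *s Z su xu + of_real (r su) *s (complex_vec (snd (Lu a)) + \<i> *s complex_vec (snd (Lu b)))) $ i = 0 $ i"
        by (simp add: complex_eq_iff)
    qed
    \<comment> \<open>Pairing with the normal kills the tangential terms and isolates the
      coefficient of \<open>Z\<close>, multiplied by a number with imaginary part
      \<open>r su * m xu\<close>, which is not 0.\<close>
    then have "herm_form p (Complex (fst (Lu a)) (fst (Lu b)) *s Z su xu + of_real (r su) *s (complex_vec (snd (Lu a)) + \<i> *s complex_vec (snd (Lu b)))) (complex_vec (M *v xu)) = 0"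
      by (simp add: herm_form_sum)
    then have "Complex (fst (Lu a)) (fst (Lu b)) * Complex (r' su * c) (r su * m xu) = 0"
      using herm_Z[OF chart_facts(6)[of a]] herm_Z[OF chart_facts(6)[of b]] by (simp add: herm_form_linear)
    moreover have "Complex (r' su * c) (r su * m xu) \<noteq> 0"
      using chart_facts(7,8) by (simp add: complex_eq_iff)
    ultimately have "Complex (fst (Lu a)) (fst (Lu b)) = 0" by (simp only: mult_eq_0_iff) simp
    then have f0: "fst (Lu a) = 0" "fst (Lu b) = 0" by (simp_all add: complex_eq_iff)
    have "snd (Lu a) $ i = 0 \<and> snd (Lu b) $ i = 0" for i
    proof -
      have "of_real (r su) * Complex (snd (Lu a) $ i) (snd (Lu b) $ i) = 0"
        using arg_cong[OF eq, of "\<lambda>z. z $ i"] f0 by (simp add: complex_eq_iff)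
      then show ?thesis using chart_facts(8) by (simp add: complex_eq_iff)
    qed
    then have "Lu a = 0" "Lu b = 0" using f0 by (simp_all add: prod_eq_iff vec_eq_iff)
    then have "a = 0" "b = 0" using chart_facts(4,5) by (simp_all add: linear_injective_0)
    then show "w = 0" by (simp add: a_def b_def vec_eq_iff complex_eq_iff)
  qed
  then have "invertible (transpose ?R)"
    unfolding invertible_left_inverse matrix_left_invertible_ker .
  then have "det ?R \<noteq> 0" unfolding invertible_det_nz det_transpose .
  then show ?thesis unfolding jac_f_chart det_mul det_transpose det_matrix_exp
    by (rule no_zero_divisors) (rule exp_not_eq_zero)
qed

text \<open>Every row is a real multiple of \<open>Z\<close> plus \<open>r\<close> times a tangent
  vector, before \<open>E s\<close> is applied. As \<open>r\<close> is real,
  \<open>det_rank_one_phase\<close> leaves \<open>\<kappa>\<close> as the only complex factor, and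
  \<open>E s\<close> contributes the exponential of the trace.\<close>

lemma det_jac_phase: "\<exists>\<rho>::real. det (jac (f \<circ> \<phi>) u) = of_real \<rho> * q (\<phi> u)"
proof -
  define z where "z = xu - (c / m xu) *\<^sub>R (M *v xu)"
  have Z_eq: "Z su xu = \<kappa> su xu *s complex_vec (M *v xu) + of_real (r' su) *s complex_vec z"
    using chart_facts(7) by (simp add: Z_def \<kappa>_def z_def vec_eq_iff complex_eq_iff algebra_simps)
  have "\<exists>\<rho>::real. det (\<chi> j. of_real (fst (Lu (axis j 1))) *s (\<kappa> su xu *s complex_vec (M *v xu) + of_real (r' su) *s complex_vec z)
      + of_real (r su) *s complex_vec (snd (Lu (axis j 1)))) = of_real \<rho> * \<kappa> su xu * of_real (r su) ^ (CARD('n) - 1)"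
  proof (rule det_rank_one_phase)
    show "form_dual p (M *v xu) \<noteq> 0" using quadricD(3)[OF chart_facts(3)] by (simp add: form_dual_eq_0)
    show "form_dual p (M *v xu) \<bullet> snd (Lu (axis j 1)) = 0" for j
      using chart_facts(6)[of "axis j 1"] by (simp add: inner_form_dual tangent_hyperplane_def real_form_commute)
    show "form_dual p (M *v xu) \<bullet> z = 0"
      using quadricD(1)[OF chart_facts(3)] chart_facts(7)
      by (simp add: inner_form_dual z_def real_form_linear real_form_commute[of p "M *v xu" xu])
  qed
  then obtain \<rho> :: real where "det (\<chi> j. tang (axis j 1)) = of_real \<rho> * \<kappa> su xu * of_real (r su) ^ (CARD('n) - 1)"
    unfolding Z_eq by blast
  then have "det (jac (f \<circ> \<phi>) u) = of_real (\<rho> * r su ^ (CARD('n) - 1)) * q (\<phi> u)"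
    unfolding jac_f_chart by (simp add: det_mul det_matrix_exp trace_imat q_def algebra_simps)
  then show ?thesis by blast
qed

end

lemma lagrangian_nondegenerate:
  "lagrangian_immersion p (I \<times> S) f" "nondegenerate_immersion p (I \<times> S) f"
proof -
  have nd: "v = 0" if lp: "local_parametrization (I \<times> S) W \<phi>" and u: "u \<in> W"
    and "\<forall>w. metric p (frechet_derivative (f \<circ> \<phi>) (at u) v) (frechet_derivative (f \<circ> \<phi>) (at u) w) = 0"
    for W \<phi> and u v :: "real^('n::_)"
  proof -
    have "linear (frechet_derivative (f \<circ> \<phi>) (at u))"
      using ck_on_has_derivative[OF ck_on_comp_parametrization[OF smooth_immersion lp] u] has_derivative_linear by blast
    from lagrangian_nondegenerate_iff[OF this lagrangian_chart[OF lp u]] det_jac_nonzero[OF lp u] that(3)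
    show ?thesis unfolding jac_def by blast
  qed
  have imm: "immersion_on (I \<times> S) f"
    unfolding immersion_on_def
  proof (intro conjI smooth_immersion allI impI ballI)
    fix W :: "(real^('n::_)) set" and \<phi> u
    assume lp: "local_parametrization (I \<times> S) W \<phi>" and u: "u \<in> W"
    have lin: "linear (frechet_derivative (f \<circ> \<phi>) (at u))"
      using ck_on_has_derivative[OF ck_on_comp_parametrization[OF smooth_immersion lp] u] has_derivative_linear by blast
    show "inj (frechet_derivative (f \<circ> \<phi>) (at u))"
      unfolding linear_injective_0[OF lin]
    proof (intro allI impI)
      fix v assume "frechet_derivative (f \<circ> \<phi>) (at u) v = 0"
      then have "\<forall>w. metric p (frechet_derivative (f \<circ> \<phi>) (at u) v) (frechet_derivative (f \<circ> \<phi>) (at u) w) = 0"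
        by (simp add: metric_def herm_form_sum)
      then show "v = 0" by (rule nd[OF lp u])
    qed
  qed
  show "nondegenerate_immersion p (I \<times> S) f"
    unfolding nondegenerate_immersion_def using imm nd by blast
  show "lagrangian_immersion p (I \<times> S) f"
    unfolding lagrangian_immersion_def symplectic_form_def using imm lagrangian_chart by simp
qed

lemma minimal_of_phase:
  assumes "\<And>z. z \<in> I \<times> S \<Longrightarrow> Re (q z) = 0"
  shows "minimal_immersion p (I \<times> S) f"
proof (rule minimal_of_constant_phase[OF adapted_charts_exist[OF openI] lagrangian_nondegenerate(2,1)])
  show "\<i> \<noteq> 0" by simp
  fix W :: "(real^('n::_)) set" and \<phi> u assume lp: "local_parametrization (I \<times> S) W \<phi>" and u: "u \<in> W"
  obtain \<rho> :: real where \<rho>: "det (jac (f \<circ> \<phi>) u) = of_real \<rho> * q (\<phi> u)" using det_jac_phase[OF lp u] by blast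
  have "\<phi> u \<in> I \<times> S" using local_parametrizationD(3)[OF lp] u by blast
  then show "Im (det (jac (f \<circ> \<phi>) u) / \<i>) = 0" using assms by (simp add: \<rho>)
qed

text \<open>The congruence need not be complex linear, so that it may destroy the phase of \<open>f\<close>; minimality is
  therefore read off from the phase of the congruent immersion and transported back.\<close>

lemma minimal_of_catenoid:
  assumes \<epsilon>: "\<epsilon> \<in> {1, -1}" and c0: "c\<^sub>0 \<noteq> 0" and cong: "congruent_sets p (f ` (I \<times> S)) T" and T: "T \<subseteq> lagrangian_catenoid p \<epsilon> c\<^sub>0"
  shows "minimal_immersion p (I \<times> S) f"
proof -
  obtain \<Phi> where \<Phi>: "affine_isometry p \<Phi>" "T = \<Phi> ` (f ` (I \<times> S))" using cong unfolding congruent_sets_def by blast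
  obtain A b where A: "bounded_linear A" "linear A" "\<And>z w. metric p (A z) (A w) = metric p z w" "\<And>z. \<Phi> z = A z + b"
    using affine_isometryE[OF \<Phi>(1)] by blast
  let ?g = "\<lambda>x. \<Phi> (f x)"
  have g: "smooth_on (I \<times> S) ?g" by (rule smooth_on_affine[OF A(1,4) smooth_immersion])
  have nd: "nondegenerate_immersion p (I \<times> S) ?g" by (rule nondegenerate_immersion_isometry[OF lagrangian_nondegenerate(2) \<Phi>(1)])
  have cat: "Im (herm_form p (frechet_derivative (?g \<circ> \<phi>) (at u) v) (frechet_derivative (?g \<circ> \<phi>) (at u) w)) = 0"
    "Im (det (jac (?g \<circ> \<phi>) u)) = 0"
    if lp: "local_parametrization (I \<times> S) W \<phi>" and u: "u \<in> W" for W \<phi> and u v w :: "real^('n::_)"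
  proof -
    have memb: "(?g \<circ> \<phi>) u \<in> lagrangian_catenoid p \<epsilon> c\<^sub>0" if "u \<in> W" for u
    proof -
      have "\<phi> u \<in> I \<times> S" using local_parametrizationD(3)[OF lp] that by blast
      then have "\<Phi> (f (\<phi> u)) \<in> T" unfolding \<Phi>(2) by (intro imageI)
      then show ?thesis using T by auto
    qed
    have e: "\<epsilon> = 1 \<or> \<epsilon> = -1" using \<epsilon> by auto
    note c = catenoid_phase[OF local_parametrizationD(1)[OF lp] ck_on_comp_parametrization[OF g lp] e c0 memb u]
    show "Im (herm_form p (frechet_derivative (?g \<circ> \<phi>) (at u) v) (frechet_derivative (?g \<circ> \<phi>) (at u) w)) = 0"
      "Im (det (jac (?g \<circ> \<phi>) u)) = 0"
      by (rule c, assumption)+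
  qed
  \<comment> \<open>The Lagrangian property of the congruent immersion is taken from the catenoid; a
    real isometry need not transfer it from \<open>f\<close>.\<close>
  have lag: "lagrangian_immersion p (I \<times> S) ?g"
    using nd cat(1) unfolding lagrangian_immersion_def nondegenerate_immersion_def symplectic_form_def by simp
  have "minimal_immersion p (I \<times> S) ?g"
  proof (rule minimal_of_constant_phase[OF adapted_charts_exist[OF openI] nd lag])
    show "(1::complex) \<noteq> 0" by simp
  qed (use cat(2) in simp_all)
  then show ?thesis by (rule minimal_immersion_isometry[OF lagrangian_nondegenerate(2) \<Phi>(1)])
qed

lemma q_has_derivative:
  assumes s: "s \<in> I" and x: "x \<in> S"
  shows "(q has_derivative (\<lambda>w. exp (\<i> * of_real (s * trace M)) *
     (\<i> * of_real (fst w * trace M) * \<kappa> s x + Complex (fst w * (r'' s * c / m x) - r' s * c * (2 * real_form p (M *v x) (M *v snd w)) / (m x)\<^sup>2) (r' s * fst w)))) (at (s, x))"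
proof -
  have mx: "m x \<noteq> 0" by (rule normal_nonnull[OF x])
  have hf: "(fst has_derivative fst) (at (s, x))" by (rule has_derivative_fst[OF has_derivative_ident])
  have r: "((\<lambda>z. g (fst z)) has_derivative (\<lambda>w. g' * fst w)) (at (s, x))" if "(g has_real_derivative g') (at s)" for g g'
    by (rule has_derivative_compose[OF hf, where g = g and g' = "(*) g'"])
      (use that in \<open>simp add: has_field_derivative_def\<close>)
  have Mx: "((\<lambda>z. M *v snd z) has_derivative (\<lambda>w. M *v snd w)) (at (s, x))"
    by (intro bounded_linear.has_derivative[OF matrix_vector_mul_bounded_linear] has_derivative_snd has_derivative_ident)
  have m: "((\<lambda>z. m (snd z)) has_derivative (\<lambda>w. 2 * real_form p (M *v x) (M *v snd w))) (at (s, x))"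
    using real_form_has_derivative[OF Mx Mx, of p] by (simp add: real_form_commute[of p _ "M *v x"])
  have e: "((\<lambda>z. exp (\<i> * of_real (fst z * trace M))) has_derivative (\<lambda>w. exp (\<i> * of_real (s * trace M)) * (\<i> * of_real (fst w * trace M)))) (at (s, x))"
  proof -
    have "((\<lambda>z. \<i> * complex_of_real (fst z * trace M)) has_derivative (\<lambda>w. \<i> * complex_of_real (fst w * trace M))) (at (s, x))"
      by (auto intro!: derivative_eq_intros)
    moreover have "(exp has_derivative (*) (exp (\<i> * complex_of_real (s * trace M)))) (at (\<i> * complex_of_real (fst (s, x) * trace M)))"
      using DERIV_exp[of "\<i> * complex_of_real (s * trace M)"] by (simp add: has_field_derivative_def)
    ultimately show ?thesis by (rule has_derivative_compose)
  qed
  have "((\<lambda>z. r' (fst z) * c / m (snd z)) has_derivative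
      (\<lambda>w. fst w * (r'' s * c / m x) - r' s * c * (2 * real_form p (M *v x) (M *v snd w)) / (m x)\<^sup>2)) (at (s, x))"
    by (rule has_derivative_eq_rhs[OF has_derivative_divide[OF has_derivative_mult_left[OF r[OF r'_deriv[OF s]]] m]])
      (use mx in \<open>auto simp: fun_eq_iff field_simps power2_eq_square\<close>)
  then have k: "((\<lambda>z. \<kappa> (fst z) (snd z)) has_derivative
      (\<lambda>w. Complex (fst w * (r'' s * c / m x) - r' s * c * (2 * real_form p (M *v x) (M *v snd w)) / (m x)\<^sup>2) (r' s * fst w))) (at (s, x))"
    unfolding \<kappa>_def Complex_eq
    by (intro has_derivative_add has_derivative_mult_right bounded_linear.has_derivative[OF bounded_linear_of_real] r[OF r_deriv[OF s]])
  show ?thesis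
    unfolding q_def by (rule has_derivative_eq_rhs[OF has_derivative_mult[OF e k]]) (simp add: fun_eq_iff algebra_simps)
qed

text \<open>Stationarity of the phase is passed from the determinant to \<open>q\<close>, whose
  derivative is explicit. The direction \<open>(1, 0)\<close> gives the differential equation for
  \<open>r\<close>, the direction \<open>(0, n)\<close> the condition on the quadric.\<close>

lemma minimal_imp_phase_stationary:
  assumes min: "minimal_immersion p (I \<times> S) f" and s: "s \<in> I" and x: "x \<in> S" and n: "n \<in> tangent_hyperplane x"
  shows "trace M * ((r' s * c / m x)\<^sup>2 + (r s)\<^sup>2) + (r' s)\<^sup>2 * c / m x - r s * r'' s * c / m x = 0"
    "r' s * c * real_form p (M *v x) (M *v n) = 0"
proof -
  have mx: "m x \<noteq> 0" by (rule normal_nonnull[OF x])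
  obtain W :: "(real^('n::_)) set" and \<psi> \<pi> where ch: "adapted_chart (I \<times> S) W \<psi> \<pi>" "(s, x) \<in> \<psi> ` W"
    using adapted_charts_exist[OF openI, of "(s, x)"] s x by auto
  have lp: "local_parametrization (I \<times> S) W \<psi>" using ch(1) unfolding adapted_chart_def by blast
  obtain u where u: "u \<in> W" "\<psi> u = (s, x)" using ch(2) by auto
  note pd = parametrization_derivative[OF lp u(1) openI]
  let ?e = "exp (\<i> * complex_of_real (s * trace M))"
  have main: "Im (cnj (\<kappa> s x) * (\<i> * of_real (fst w * trace M) * \<kappa> s x + Complex (fst w * (r'' s * c / m x) - r' s * c * (2 * real_form p (M *v x) (M *v snd w)) / (m x)\<^sup>2) (r' s * fst w))) = 0"
    if w: "snd w \<in> tangent_hyperplane x" for w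
  proof -
    have "w \<in> UNIV \<times> tangent_hyperplane (snd (\<psi> u))" using w u by (simp add: mem_Times_iff)
    \<comment> \<open>Every tangent vector of \<open>I \<times> S\<close> is the image of a
      coordinate direction \<open>v\<close>, where stationarity is known.\<close>
    then have "w \<in> range (frechet_derivative \<psi> (at u))" unfolding pd(2) .
    then obtain v where v: "frechet_derivative \<psi> (at u) v = w" by auto
    have D: "ck_on k W (\<lambda>u. det (jac (f \<circ> \<psi>) u))" for k
      by (rule ck_on_det[OF local_parametrizationD(1)[OF lp] ck_on_jac[OF local_parametrizationD(1)[OF lp] ck_on_comp_parametrization[OF smooth_immersion lp]]])
    have Q: "((\<lambda>u. q (\<psi> u)) has_derivative (\<lambda>v. (\<lambda>w. ?e * (\<i> * of_real (fst w * trace M) * \<kappa> s x + Complex (fst w * (r'' s * c / m x) - r' s * c * (2 * real_form p (M *v x) (M *v snd w)) / (m x)\<^sup>2) (r' s * fst w)))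
         (frechet_derivative \<psi> (at u) v))) (at u)"
      by (rule has_derivative_compose[OF pd(1)]) (use q_has_derivative[OF s x] u in simp)
    have "Im (cnj (q (\<psi> u)) * (?e * (\<i> * of_real (fst w * trace M) * \<kappa> s x + Complex (fst w * (r'' s * c / m x) - r' s * c * (2 * real_form p (M *v x) (M *v snd w)) / (m x)\<^sup>2) (r' s * fst w)))) = 0"
      using Im_cnj_mult_real_multiple[OF local_parametrizationD(1)[OF lp] u(1) ck_on_has_derivative[OF D u(1)] Q det_jac_phase[OF lp] det_jac_nonzero[OF lp u(1)]
        phase_stationary_of_minimal[OF ch(1) min lagrangian_nondegenerate(1) u(1)], of v]
      unfolding v .
    moreover have "cnj (q (\<psi> u)) * (?e * Y) = cnj (\<kappa> s x) * Y" for Y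
    proof -
      have "cnj (q (\<psi> u)) * (?e * Y) = (cnj ?e * ?e) * (cnj (\<kappa> s x) * Y)"
        by (simp add: u q_def)
      also have "cnj ?e * ?e = 1" by (simp only: cis_conv_exp[symmetric]) (simp add: cis_cnj cis_mult)
      finally show ?thesis by simp
    qed
    ultimately show ?thesis by (simp only:)
  qed
  have "0 \<in> tangent_hyperplane x" using subspace_0[OF subspace_tangent_hyperplane] .
  from main[of "(1, 0)"] this
  show "trace M * ((r' s * c / m x)\<^sup>2 + (r s)\<^sup>2) + (r' s)\<^sup>2 * c / m x - r s * r'' s * c / m x = 0"
    by (simp add: \<kappa>_def power2_eq_square algebra_simps)
  from main[of "(0, n)"] n
  show "r' s * c * real_form p (M *v x) (M *v n) = 0"
    using mx r_pos[OF s] by (simp add: \<kappa>_def)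
qed

end

lemma exp_line_has_vector_derivative:
  "((\<lambda>s. exp (a * of_real (s * u))) has_vector_derivative a * of_real u * exp (a * of_real (s * u))) (at s)"
  for a :: complex
proof -
  have "((\<lambda>s. exp (a * (of_real s * of_real u))) has_vector_derivative a * of_real u * exp (a * (of_real s * of_real u))) (at s)"
    by (rule has_vector_derivative_real_field) (auto intro!: derivative_eq_intros)
  then show ?thesis by simp
qed


lemma real_form_nondegenerate: "(\<And>w. real_form p a w = 0) \<Longrightarrow> a = 0"
  by (metis form_dual_eq_0 inner_eq_zero_iff inner_form_dual)

lemma matrix_vector_mult_scaleR_real: "(M :: real^'n^'m) *v (a *\<^sub>R x) = a *\<^sub>R (M *v x)"
  by (simp add: vec_eq_iff matrix_vector_mult_def sum_distrib_left algebra_simps)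

lemma linear_complex_scale: "linear (\<lambda>z :: complex^'n. \<omega> *s z)"
  by (rule linearI) (simp_all add: vec_eq_iff algebra_simps)

lemma affine_isometry_rotation:
  assumes "\<omega> * cnj \<omega> = 1"
  shows "affine_isometry p (\<lambda>z :: complex^('n::{finite,wellorder}). \<omega> *s z)"
proof -
  have "metric p (\<omega> *s z) (\<omega> *s w) = metric p z w" for z w :: "complex^('n::_)"
  proof -
    have "herm_form p (\<omega> *s z) (\<omega> *s w) = (\<omega> * cnj \<omega>) * herm_form p z w"
      by (simp add: herm_form_linear)
    then show ?thesis using assms by (simp add: metric_def)
  qed
  then show ?thesis
    unfolding affine_isometry_def by (intro exI[of _ "\<lambda>z. \<omega> *s z"] exI[of _ 0]) (simp add: linear_complex_scale)
qed

section \<open>Scalar matrices and the passage to catenoids\<close>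

context quadric_immersion_data
begin

text \<open>The function \<open>q\<close> when \<open>M\<close> is \<open>\<mu>\<close> times the
  identity: then \<open>m x = \<mu> * c\<close>, so both \<open>x\<close> and \<open>c\<close> drop
  out, and the trace is n \<mu>.\<close>

definition scalar_phase :: "real \<Rightarrow> real \<Rightarrow> complex" where
  "scalar_phase \<mu> s = exp (\<i> * of_real (s * (real CARD('n) * \<mu>))) * Complex (r' s / \<mu>) (r s)"

lemma scalar_phase_nonzero: "s \<in> I \<Longrightarrow> scalar_phase \<mu> s \<noteq> 0"
proof -
  assume "s \<in> I"
  from r_pos[OF this] have "Complex (r' s / \<mu>) (r s) \<noteq> 0" by (simp add: complex_eq_iff)
  then show ?thesis unfolding scalar_phase_def by (rule no_zero_divisors[OF exp_not_eq_zero])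
qed

lemma E_scalar:
  assumes "\<And>w. M *v w = \<mu> *\<^sub>R w"
  shows "E s *v complex_vec x = exp (\<i> * of_real (s * \<mu>)) *s complex_vec x"
proof -
  have iM: "imat M *v z = (\<i> * of_real \<mu>) *s z" for z
  proof -
    have "M $ i $ j = (if i = j then \<mu> else 0)" for i j
    proof -
      have "(M *v axis j 1) $ i = M $ i $ j" by (simp add: matrix_vector_mult_basis column_def)
      then show ?thesis by (cases "i = j") (auto simp: assms axis_def)
    qed
    then show ?thesis by (simp add: vec_eq_iff matrix_vector_mult_def imat_def if_distrib[of "\<lambda>x. of_real x"] if_distrib[of "\<lambda>x. _ * x"] if_distrib[of "\<lambda>x. x * _"] cong: if_cong)
  qed
  have "(E s *v z) $ i = exp (\<i> * of_real (s * \<mu>)) * z $ i" for z i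
  proof -
    have e: "((\<lambda>s. exp (- (\<i> * of_real (s * \<mu>)))) has_vector_derivative - (\<i> * of_real \<mu>) * exp (- (\<i> * of_real (s * \<mu>)))) (at s)" for s
      using exp_line_has_vector_derivative[of "- \<i>" \<mu> s] by simp
    have z: "((\<lambda>s. exp (- (\<i> * of_real (s * \<mu>))) * (E s *v z) $ i) has_vector_derivative 0) (at s within UNIV)" for s
      using has_vector_derivative_mult[OF e matrix_exp_mult_derivative[of "imat M" z i], of s]
      by (simp add: iM algebra_simps)
    have "\<exists>c. \<forall>s. exp (- (\<i> * of_real (s * \<mu>))) * (E s *v z) $ i = c"
      by (rule has_vector_derivative_zero_constant[OF convex_UNIV z]) auto
    then obtain c where c: "\<And>s. exp (- (\<i> * of_real (s * \<mu>))) * (E s *v z) $ i = c" by blast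
    have "c = z $ i" using c[of 0] by (simp add: matrix_exp_zero[simplified])
    then have "exp (\<i> * of_real (s * \<mu>)) * (exp (- (\<i> * of_real (s * \<mu>))) * (E s *v z) $ i) = exp (\<i> * of_real (s * \<mu>)) * z $ i"
      using c[of s] by simp
    then show ?thesis by (simp only: mult.assoc[symmetric] exp_minus_inverse mult_1_left)
  qed
  then show ?thesis by (simp add: vec_eq_iff)
qed

text \<open>The equation \<open>ode\<close> says that q' / q is real for this phase q. Hence q / cnj
  q, which remembers the direction of q up to sign and requires no choice of argument, has
  derivative 0 on the interval.\<close>

lemma scalar_phase_constant:
  assumes l: "\<mu> \<noteq> 0"
    and ode: "\<And>s. s \<in> I \<Longrightarrow> real CARD('n) * \<mu> * ((r' s / \<mu>)\<^sup>2 + (r s)\<^sup>2) + (r' s)\<^sup>2 / \<mu> - r s * r'' s / \<mu> = 0"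
    and s: "s \<in> I" "t \<in> I"
  shows "Im (scalar_phase \<mu> s * cnj (scalar_phase \<mu> t)) = 0"
proof -
  let ?q = "scalar_phase \<mu>"
  let ?T = "real CARD('n) * \<mu>"
  define q' where "q' s = exp (\<i> * of_real (s * ?T)) * (\<i> * of_real ?T * Complex (r' s / \<mu>) (r s) + Complex (r'' s / \<mu>) (r' s))" for s
  have nz: "?q s \<noteq> 0" if "s \<in> I" for s by (rule scalar_phase_nonzero[OF that])
  have dq: "(?q has_vector_derivative q' s) (at s)" if s: "s \<in> I" for s
  proof -
    have 1: "((\<lambda>s. exp (\<i> * of_real (s * ?T))) has_vector_derivative \<i> * of_real ?T * exp (\<i> * of_real (s * ?T))) (at s)"
      by (rule exp_line_has_vector_derivative)
    have "((\<lambda>s. r' s / \<mu>) has_vector_derivative r'' s / \<mu>) (at s)"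
      using DERIV_cdivide[OF r'_deriv[OF s], of \<mu>] by (simp add: has_real_derivative_iff_has_vector_derivative)
    moreover have "(r has_vector_derivative r' s) (at s)"
      using r_deriv[OF s] by (simp add: has_real_derivative_iff_has_vector_derivative)
    ultimately have 2: "((\<lambda>s. Complex (r' s / \<mu>) (r s)) has_vector_derivative Complex (r'' s / \<mu>) (r' s)) (at s)"
      unfolding Complex_eq
      by (intro has_vector_derivative_add has_vector_derivative_mult_right has_vector_derivative_of_real) (simp_all add: has_real_derivative_iff_has_vector_derivative)
    show ?thesis
      unfolding scalar_phase_def[abs_def] q'_def using has_vector_derivative_mult[OF 1 2] by (simp add: algebra_simps)
  qed
  have im: "Im (cnj (?q s) * q' s) = 0" if s: "s \<in> I" for s
  proof -
    let ?e = "exp (\<i> * complex_of_real (s * ?T))"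
    have "cnj (?q s) * q' s = (cnj ?e * ?e) * (cnj (Complex (r' s / \<mu>) (r s)) * (\<i> * of_real ?T * Complex (r' s / \<mu>) (r s) + Complex (r'' s / \<mu>) (r' s)))"
      by (simp add: scalar_phase_def q'_def)
    also have "cnj ?e * ?e = 1" by (simp only: cis_conv_exp[symmetric]) (simp add: cis_cnj cis_mult)
    finally show ?thesis using ode[OF s] by (simp add: power2_eq_square algebra_simps)
  qed
  have z: "((\<lambda>s. ?q s / cnj (?q s)) has_vector_derivative 0) (at s within I)" if s: "s \<in> I" for s
  proof -
    have c: "((\<lambda>s. cnj (?q s)) has_vector_derivative cnj (q' s)) (at s)"
      by (rule bounded_linear.has_vector_derivative[OF bounded_linear_cnj dq[OF s]])
    have "((\<lambda>s. ?q s / cnj (?q s)) has_derivative (\<lambda>h. (h *\<^sub>R q' s * cnj (?q s) - ?q s * (h *\<^sub>R cnj (q' s))) / (cnj (?q s) * cnj (?q s)))) (at s)"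
      by (rule has_derivative_divide') (use dq[OF s] c nz[OF s] in \<open>auto simp: has_vector_derivative_def\<close>)
    moreover have "h *\<^sub>R q' s * cnj (?q s) - ?q s * (h *\<^sub>R cnj (q' s)) = 0" for h
    proof -
      have "q' s * cnj (?q s) = ?q s * cnj (q' s)"
        using im[OF s] by (simp add: complex_eq_iff algebra_simps)
      then show ?thesis by (simp add: algebra_simps)
    qed
    ultimately have "((\<lambda>s. ?q s / cnj (?q s)) has_vector_derivative 0) (at s)"
      by (simp only: has_vector_derivative_def scaleR_zero_right div_0)
    then show ?thesis by (rule has_vector_derivative_at_within)
  qed
  have "\<exists>k. \<forall>s\<in>I. ?q s / cnj (?q s) = k"
    by (rule has_vector_derivative_zero_constant[OF is_interval_convex[OF intI] z]) auto
  then have "?q s / cnj (?q s) = ?q t / cnj (?q t)" using s by metis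
  then have "?q s * cnj (?q t) = ?q t * cnj (?q s)" using nz[OF s(1)] nz[OF s(2)] by (simp add: field_simps)
  from arg_cong[OF this, of Im] show ?thesis by (simp add: algebra_simps)
qed

text \<open>Here \<open>\<gamma> ^ (n - 1) \<gamma>'\<close> is a real multiple of the phase, so \<open>\<gamma> ^ n\<close> moves along a line; rotating by an
  \<open>n\<close>-th root of the inverse phase makes this line horizontal.\<close>

lemma catenoid_of_scalar:
  assumes c0: "c \<noteq> 0" and s1: "s\<^sub>1 \<in> I" and M: "\<And>w. M *v w = \<mu> *\<^sub>R w" and l: "\<mu> \<noteq> 0"
    and ode: "\<And>s. s \<in> I \<Longrightarrow> real CARD('n) * \<mu> * ((r' s / \<mu>)\<^sup>2 + (r s)\<^sup>2) + (r' s)\<^sup>2 / \<mu> - r s * r'' s / \<mu> = 0"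
  shows "\<exists>\<epsilon>\<in>{1, -1}. \<exists>c\<^sub>0. c\<^sub>0 \<noteq> 0 \<and> (\<exists>T. congruent_sets p (f ` (I \<times> S)) T \<and> T \<subseteq> lagrangian_catenoid p \<epsilon> c\<^sub>0)"
proof -
  let ?N = "CARD('n)"
  obtain N' where N': "?N = Suc N'" by (metis Suc_pred zero_less_card_finite)
  let ?q = "scalar_phase \<mu>"
  define \<gamma> where "\<gamma> s = of_real (r s) * exp (\<i> * of_real (s * \<mu>))" for s
  define \<gamma>' where "\<gamma>' s = of_real \<mu> * Complex (r' s / \<mu>) (r s) * exp (\<i> * of_real (s * \<mu>))" for s
  define \<theta> where "\<theta> = ?q s\<^sub>1"
  have \<gamma>nz: "\<gamma> s \<noteq> 0" if "s \<in> I" for s using r_pos[OF that] by (simp add: \<gamma>_def)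
  have \<theta>nz: "\<theta> \<noteq> 0" unfolding \<theta>_def by (rule scalar_phase_nonzero[OF s1])
  \<comment> \<open>n - 1 exponentials from the power and one from \<open>\<gamma>'\<close> combine
    to the exponential of the trace.\<close>
  have pw: "\<gamma> s ^ N' * \<gamma>' s = of_real (\<mu> * r s ^ N') * ?q s" for s
  proof -
    have "exp (\<i> * of_real (s * \<mu>)) ^ N' * exp (\<i> * of_real (s * \<mu>)) = exp (\<i> * complex_of_real (s * (real ?N * \<mu>)))"
      by (simp add: N' exp_of_nat_mult[symmetric] exp_add[symmetric] algebra_simps)
    then show ?thesis by (simp add: \<gamma>_def \<gamma>'_def scalar_phase_def power_mult_distrib algebra_simps)
  qed
  have d\<gamma>: "(\<gamma> has_vector_derivative \<gamma>' s) (at s)" if s: "s \<in> I" for s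
  proof -
    have 1: "((\<lambda>s. exp (\<i> * of_real (s * \<mu>))) has_vector_derivative \<i> * of_real \<mu> * exp (\<i> * of_real (s * \<mu>))) (at s)"
      by (rule exp_line_has_vector_derivative)
    have 2: "((\<lambda>s. complex_of_real (r s)) has_vector_derivative of_real (r' s)) (at s)"
      by (rule has_vector_derivative_of_real) (use r_deriv[OF s] in \<open>simp add: has_real_derivative_iff_has_vector_derivative\<close>)
    have "of_real \<mu> * Complex (r' s / \<mu>) (r s) = of_real (r' s) + \<i> * of_real (\<mu> * r s)"
      using l by (simp add: complex_eq_iff)
    then show ?thesis
      unfolding \<gamma>_def[abs_def] \<gamma>'_def using has_vector_derivative_mult[OF 2 1] by (simp add: algebra_simps)
  qed
  have z: "((\<lambda>s. Im (\<gamma> s ^ ?N * cnj \<theta>)) has_vector_derivative 0) (at s within I)" if s: "s \<in> I" for s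
  proof -
    have "((\<lambda>s. \<gamma> s ^ ?N) has_derivative (\<lambda>h. of_nat ?N * (h *\<^sub>R \<gamma>' s) * \<gamma> s ^ (?N - 1))) (at s)"
      by (rule has_derivative_power) (use d\<gamma>[OF s] in \<open>simp add: has_vector_derivative_def\<close>)
    then have "((\<lambda>s. Im (\<gamma> s ^ ?N * cnj \<theta>)) has_derivative (\<lambda>h. Im (of_nat ?N * (h *\<^sub>R \<gamma>' s) * \<gamma> s ^ (?N - 1) * cnj \<theta>))) (at s)"
      by (intro bounded_linear.has_derivative[OF bounded_linear_Im] has_derivative_mult_left)
    moreover have "Im (of_nat ?N * (h *\<^sub>R \<gamma>' s) * \<gamma> s ^ (?N - 1) * cnj \<theta>) = 0" for h
    proof -
      have "of_nat ?N * (h *\<^sub>R \<gamma>' s) * \<gamma> s ^ (?N - 1) * cnj \<theta> = of_real (real ?N * h) * ((\<gamma> s ^ N' * \<gamma>' s) * cnj \<theta>)"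
        by (simp add: N' scaleR_conv_of_real algebra_simps)
      also have "\<dots> = of_real (real ?N * h * (\<mu> * r s ^ N')) * (?q s * cnj \<theta>)" unfolding pw by simp
      finally show ?thesis using scalar_phase_constant[OF l ode s s1] unfolding \<theta>_def[symmetric]
        by (simp only: times_complex.sel Re_complex_of_real Im_complex_of_real mult_zero_left mult_zero_right add_0_right)
    qed
    ultimately have "((\<lambda>s. Im (\<gamma> s ^ ?N * cnj \<theta>)) has_vector_derivative 0) (at s)"
      by (simp only: has_vector_derivative_def scaleR_zero_right div_0)
    then show ?thesis by (rule has_vector_derivative_at_within)
  qed
  have "\<exists>k. \<forall>s\<in>I. Im (\<gamma> s ^ ?N * cnj \<theta>) = k"
    by (rule has_vector_derivative_zero_constant[OF is_interval_convex[OF intI] z]) auto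
  then obtain c1 where c1: "\<And>s. s \<in> I \<Longrightarrow> Im (\<gamma> s ^ ?N * cnj \<theta>) = c1" by blast
  \<comment> \<open>At \<open>s\<^sub>1\<close> the number \<gamma>^(n - 1) \<gamma>' cnj \<theta>
    is real, whereas \<gamma>' / \<gamma> = (r' + \<i> \<mu> r) / r is not. Thus \<gamma>^n cnj
    \<theta> could be real only by being 0, which it is not.\<close>
  have c1nz: "c1 \<noteq> 0"
  proof
    assume "c1 = 0"
    then have im0: "Im (\<gamma> s\<^sub>1 ^ ?N * cnj \<theta>) = 0" using c1[OF s1] by simp
    let ?\<Gamma> = "\<gamma> s\<^sub>1 ^ ?N * cnj \<theta>"
    have r1: "r s\<^sub>1 > 0" by (rule r_pos[OF s1])
    have "of_real (r s\<^sub>1) * \<gamma>' s\<^sub>1 = of_real \<mu> * Complex (r' s\<^sub>1 / \<mu>) (r s\<^sub>1) * \<gamma> s\<^sub>1"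
      by (simp add: \<gamma>_def \<gamma>'_def)
    then have "of_real \<mu> * Complex (r' s\<^sub>1 / \<mu>) (r s\<^sub>1) * ?\<Gamma> = of_real (r s\<^sub>1) * ((\<gamma> s\<^sub>1 ^ N' * \<gamma>' s\<^sub>1) * cnj \<theta>)"
      by (simp add: N' algebra_simps)
    also have "\<dots> = of_real (r s\<^sub>1 * \<mu> * r s\<^sub>1 ^ N' * (cmod \<theta>)\<^sup>2)"
      unfolding pw \<theta>_def[symmetric] using complex_norm_square[of \<theta>] by (simp only: of_real_mult mult.assoc of_real_power)
    finally have "Im (of_real \<mu> * Complex (r' s\<^sub>1 / \<mu>) (r s\<^sub>1) * ?\<Gamma>) = 0" by (simp only: Im_complex_of_real)
    moreover have "Im (of_real \<mu> * Complex (r' s\<^sub>1 / \<mu>) (r s\<^sub>1) * ?\<Gamma>) = r' s\<^sub>1 * Im ?\<Gamma> + \<mu> * r s\<^sub>1 * Re ?\<Gamma>"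
    proof -
      have "of_real \<mu> * Complex (r' s\<^sub>1 / \<mu>) (r s\<^sub>1) = Complex (r' s\<^sub>1) (\<mu> * r s\<^sub>1)"
        using l by (simp add: complex_eq_iff)
      then show ?thesis by (simp only: times_complex.sel complex.sel)
    qed
    ultimately have "Re ?\<Gamma> = 0" using im0 l r1 by simp
    then have "?\<Gamma> = 0" using im0 by (simp only: complex_eq_iff) simp
    then show False using \<gamma>nz[OF s1] \<theta>nz by simp
  qed
  define \<omega> where "\<omega> = cis (Arg (cnj \<theta>) / ?N)"
  have \<omega>1: "\<omega> * cnj \<omega> = 1" by (simp add: \<omega>_def cis_cnj cis_mult)
  have \<omega>N: "\<omega> ^ ?N = cnj \<theta> / of_real (cmod \<theta>)"
  proof -
    have "\<omega> ^ ?N = cis (Arg (cnj \<theta>))" unfolding \<omega>_def by (simp only: Complex.DeMoivre) simp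
    also have "\<dots> = sgn (cnj \<theta>)" using \<theta>nz by (intro cis_Arg) simp
    finally show ?thesis by (simp add: sgn_eq)
  qed
  \<comment> \<open>On the quadric \<open>real_form p x x = c / \<mu>\<close>. Dividing
    \<open>x\<close> by \<open>\<delta>\<close> leads to the pseudo-sphere of sign
    \<open>\<epsilon>\<close>; the coefficient \<open>\<gamma>\<close> absorbs the factor, whence
    \<delta>^n in \<open>c2\<close>.\<close>
  define \<delta> where "\<delta> = sqrt \<bar>c / \<mu>\<bar>"
  have \<delta>: "\<delta> > 0" "\<delta>\<^sup>2 = \<bar>c / \<mu>\<bar>" using c0 l by (simp_all add: \<delta>_def)
  define \<epsilon> where "\<epsilon> = sgn (c / \<mu>)"
  have \<epsilon>: "\<epsilon> \<in> {1, -1}" using c0 l by (auto simp: \<epsilon>_def sgn_if)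
  define c2 where "c2 = \<delta> ^ ?N * c1 / cmod \<theta>"
  have c2: "c2 \<noteq> 0" using \<delta>(1) c1nz \<theta>nz by (simp add: c2_def)
  have "(\<lambda>z. \<omega> *s z) ` (f ` (I \<times> S)) \<subseteq> lagrangian_catenoid p \<epsilon> c2"
  proof
    fix w assume "w \<in> (\<lambda>z. \<omega> *s z) ` (f ` (I \<times> S))"
    then obtain s x where sx: "s \<in> I" "x \<in> S" "w = \<omega> *s f (s, x)" by auto
    have f: "f (s, x) = \<gamma> s *s complex_vec x"
      by (simp add: quadric_immersion_eq E_scalar[OF M] \<gamma>_def vec_eq_iff scaleR_conv_of_real[where 'a=complex])
    have "w = (\<omega> * \<gamma> s * of_real \<delta>) *s complex_vec ((1 / \<delta>) *\<^sub>R x)"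
      using \<delta>(1) by (simp add: sx(3) f vec_eq_iff)
    moreover have "(1 / \<delta>) *\<^sub>R x \<in> pseudo_sphere p \<epsilon>"
    proof -
      have "\<mu> * real_form p x x = c" using quadricD(1)[OF sx(2)] by (simp add: M real_form_linear)
      then have "real_form p x x = c / \<mu>" using l by (simp add: field_simps)
      then have "real_form p ((1 / \<delta>) *\<^sub>R x) ((1 / \<delta>) *\<^sub>R x) = (c / \<mu>) / \<delta>\<^sup>2"
        by (simp add: real_form_linear power2_eq_square)
      also have "\<dots> = \<epsilon>" unfolding \<delta>(2) \<epsilon>_def using c0 l by (simp add: sgn_real_def abs_if)
      finally show ?thesis by (simp add: pseudo_sphere_def)
    qed
    moreover have "Im ((\<omega> * \<gamma> s * of_real \<delta>) ^ ?N) = c2"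
    proof -
      have "(\<omega> * \<gamma> s * of_real \<delta>) ^ ?N = of_real (\<delta> ^ ?N / cmod \<theta>) * (\<gamma> s ^ ?N * cnj \<theta>)"
        by (simp add: power_mult_distrib \<omega>N)
      then show ?thesis using c1[OF sx(1)]
        by (simp only: times_complex.sel Re_complex_of_real Im_complex_of_real c2_def) simp
    qed
    ultimately show "w \<in> lagrangian_catenoid p \<epsilon> c2" unfolding lagrangian_catenoid_def by blast
  qed
  moreover have "congruent_sets p (f ` (I \<times> S)) ((\<lambda>z. \<omega> *s z) ` (f ` (I \<times> S)))"
    unfolding congruent_sets_def using affine_isometry_rotation[OF \<omega>1] by blast
  ultimately show ?thesis using \<epsilon> c2 by blast
qed

text \<open>The hypothesis says that \<open>M (M x)\<close> is parallel to \<open>M x\<close>, so every point of the quadric is an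
  eigenvector; differentiating along the quadric shows that \<open>M\<close> is scalar on tangent vectors too.\<close>

lemma scalar_of_stationary:
  assumes c0: "c \<noteq> 0" and s: "s \<in> I" and x0: "x\<^sub>0 \<in> S"
    and stat: "\<And>x n. x \<in> S \<Longrightarrow> n \<in> tangent_hyperplane x \<Longrightarrow> real_form p (M *v x) (M *v n) = 0"
  shows "M *v w = (m x\<^sub>0 / c) *\<^sub>R w"
proof -
  have proj: "w - (real_form p w (M *v x) / m x) *\<^sub>R (M *v x) \<in> tangent_hyperplane x" if "x \<in> S" for x w
    using normal_nonnull[OF that] by (simp add: tangent_hyperplane_def real_form_linear)
  have eig: "M *v x = (m x / c) *\<^sub>R x" if x: "x \<in> S" for x
  proof -
    \<comment> \<open>The linear form given by \<open>M *v (M *v x)\<close> vanishes on the tangent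
      hyperplane, so it is a multiple of the one given by the normal; evaluation at the normal
      yields the factor.\<close>
    define k where "k = real_form p (M *v x) (M *v (M *v x)) / m x"
    have "real_form p (M *v (M *v x) - k *\<^sub>R (M *v x)) w = 0" for w
    proof -
      have "real_form p (M *v x) (M *v (w - (real_form p w (M *v x) / m x) *\<^sub>R (M *v x))) = 0"
        by (rule stat[OF x proj[OF x]])
      then have "real_form p (M *v x) (M *v w) = k * real_form p w (M *v x)"
        by (simp add: k_def matrix_vector_mult_diff_distrib real_form_linear
            matrix_vector_mult_scaleR_real)
      then show ?thesis
        using self_adj[of "M *v x" w] real_form_commute[of p w "M *v x"] by (simp add: real_form_linear)
    qed
    then have "M *v (M *v x) - k *\<^sub>R (M *v x) = 0" by (rule real_form_nondegenerate)
    \<comment> \<open>Injectivity of \<open>M\<close> removes one factor and leaves an eigenvector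
      equation for \<open>x\<close> itself.\<close>
    then have "M *v (M *v x - k *\<^sub>R x) = 0"
      by (simp add: matrix_vector_mult_diff_distrib matrix_vector_mult_scaleR_real)
    then have Mx: "M *v x = k *\<^sub>R x" using M_inj by fastforce
    have "m x = k * c" using quadricD(1)[OF x] real_form_linear(2)[of p k x "M *v x"] Mx by simp
    then show ?thesis using Mx c0 by simp
  qed
  let ?k = "m x\<^sub>0 / c"
  obtain W :: "(real^('n::_)) set" and \<psi> \<pi> where ch: "adapted_chart (I \<times> S) W \<psi> \<pi>" "(s, x\<^sub>0) \<in> \<psi> ` W"
    using adapted_charts_exist[OF openI, of "(s, x\<^sub>0)"] s x0 by auto
  have lp: "local_parametrization (I \<times> S) W \<psi>" using ch(1) unfolding adapted_chart_def by blast
  obtain u where u: "u \<in> W" "\<psi> u = (s, x\<^sub>0)" using ch(2) by auto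
  note pd = parametrization_derivative[OF lp u(1) openI]
  \<comment> \<open>The eigenvalue \<open>m x / c\<close> might vary with \<open>x\<close>.
    Differentiating the eigenvector equation along \<open>n\<close>, its derivative is 2 / c times
    the product of \<open>M *v x\<close> and \<open>M *v n\<close>, which is 0 by
    \<open>stat\<close>.\<close>
  have nrm: "M *v n = ?k *\<^sub>R n" if n: "n \<in> tangent_hyperplane x\<^sub>0" for n
  proof -
    have "(0, n) \<in> UNIV \<times> tangent_hyperplane (snd (\<psi> u))" using n u by simp
    then have "(0, n) \<in> range (frechet_derivative \<psi> (at u))" unfolding pd(2) .
    then obtain v where v: "frechet_derivative \<psi> (at u) v = (0, n)" by (metis rangeE)
    let ?y' = "\<lambda>v. snd (frechet_derivative \<psi> (at u) v)"
    have y: "((\<lambda>u. snd (\<psi> u)) has_derivative ?y') (at u)" by (rule has_derivative_snd[OF pd(1)])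
    have My: "((\<lambda>u. M *v snd (\<psi> u)) has_derivative (\<lambda>v. M *v ?y' v)) (at u)"
      by (rule bounded_linear.has_derivative[OF matrix_vector_mul_bounded_linear y])
    have "((\<lambda>u. (m (snd (\<psi> u)) * (1 / c)) *\<^sub>R snd (\<psi> u)) has_derivative
       (\<lambda>v. (m (snd (\<psi> u)) * (1 / c)) *\<^sub>R ?y' v + ((real_form p (M *v snd (\<psi> u)) (M *v ?y' v) + real_form p (M *v ?y' v) (M *v snd (\<psi> u))) * (1 / c)) *\<^sub>R snd (\<psi> u))) (at u)"
      by (rule has_derivative_scaleR[OF has_derivative_mult_left[OF real_form_has_derivative[OF My My]] y])
    moreover have "((\<lambda>u. (m (snd (\<psi> u)) * (1 / c)) *\<^sub>R snd (\<psi> u)) has_derivative (\<lambda>v. M *v ?y' v)) (at u)"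
    proof (rule has_derivative_transform_within_open[OF My local_parametrizationD(1)[OF lp] u(1)])
      fix z assume "z \<in> W"
      then have "snd (\<psi> z) \<in> S" using parametrization_derivative(4)[OF lp _ openI] by blast
      from eig[OF this] show "M *v snd (\<psi> z) = (m (snd (\<psi> z)) * (1 / c)) *\<^sub>R snd (\<psi> z)" by simp
    qed
    ultimately have "(\<lambda>v. (m (snd (\<psi> u)) * (1 / c)) *\<^sub>R ?y' v + ((real_form p (M *v snd (\<psi> u)) (M *v ?y' v) + real_form p (M *v ?y' v) (M *v snd (\<psi> u))) * (1 / c)) *\<^sub>R snd (\<psi> u)) = (\<lambda>v. M *v ?y' v)"
      by (rule has_derivative_unique)
    from fun_cong[OF this, of v] show ?thesis
      using stat[OF x0 n] real_form_commute[of p "M *v n" "M *v x\<^sub>0"] by (simp add: v u)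
  qed
  \<comment> \<open>An arbitrary vector is split into a tangent part and a multiple of the normal
    \<open>M *v x\<^sub>0\<close>, which is an eigenvector for the same eigenvalue.\<close>
  define a where "a = real_form p w (M *v x\<^sub>0) / m x\<^sub>0"
  define w' where "w' = w - a *\<^sub>R (M *v x\<^sub>0)"
  have w: "w = w' + a *\<^sub>R (M *v x\<^sub>0)" by (simp add: w'_def)
  have w'N: "M *v w' = ?k *\<^sub>R w'" unfolding w'_def a_def by (rule nrm[OF proj[OF x0]])
  have MM: "M *v (M *v x\<^sub>0) = ?k *\<^sub>R (M *v x\<^sub>0)"
    by (subst eig[OF x0]) (rule matrix_vector_mult_scaleR_real)
  have "M *v w = M *v w' + a *\<^sub>R (M *v (M *v x\<^sub>0))"
    unfolding w by (simp only: matrix_vector_right_distrib matrix_vector_mult_scaleR_real)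
  also have "\<dots> = ?k *\<^sub>R w" unfolding w'N MM by (simp add: w scaleR_add_right mult.commute)
  finally show ?thesis .
qed

section \<open>The case distinction\<close>

lemma minimal_imp_cases:
  assumes min: "minimal_immersion p (I \<times> S) f"
  shows "(trace M = 0 \<and> r constant_on I) \<or> (trace M = 0 \<and> c = 0) \<or>
      (\<exists>\<epsilon>\<in>{1, -1}. \<exists>c\<^sub>0. c\<^sub>0 \<noteq> 0 \<and> (\<exists>T. congruent_sets p (f ` (I \<times> S)) T \<and> T \<subseteq> lagrangian_catenoid p \<epsilon> c\<^sub>0))"
proof (cases "I \<times> S = {}")
  case True
  \<comment> \<open>The empty immersion falls under the third case, as the empty set is part of
    every catenoid; the values 1 for both constants are arbitrary.\<close>
  have "affine_isometry p (\<lambda>z. 1 *s z)" by (rule affine_isometry_rotation) simp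
  then have "congruent_sets p (f ` (I \<times> S)) {}" unfolding congruent_sets_def True by blast
  then show ?thesis by (intro disjI2 bexI[of _ 1] exI[of _ 1] conjI exI[of _ "{}"]) auto
next
  case False
  then obtain s0 x0 where s0: "s0 \<in> I" and x0: "x0 \<in> S" by auto
  note st = minimal_imp_phase_stationary[OF min]
  have N0: "0 \<in> tangent_hyperplane x" for x by (rule subspace_0[OF subspace_tangent_hyperplane])
  show ?thesis
  proof (cases "c = 0")
    case True
    \<comment> \<open>For \<open>c = 0\<close> every term of the differential equation that contains
      a derivative of \<open>r\<close> disappears.\<close>
    have "trace M * (r s0)\<^sup>2 = 0" using st(1)[OF s0 x0 N0] True by simp
    then show ?thesis using True r_pos[OF s0] by simp
  next
    case c: False
    show ?thesis
    proof (cases "\<forall>s\<in>I. r' s = 0")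
      case True
      have "(r' has_real_derivative 0) (at s0)"
        by (rule has_field_derivative_transform_within_open[OF DERIV_const openI s0]) (use True in auto)
      then have "r'' s0 = 0" using DERIV_unique[OF r'_deriv[OF s0]] by blast
      then have "trace M * (r s0)\<^sup>2 = 0" using st(1)[OF s0 x0 N0] True s0 by simp
      then have "trace M = 0" using r_pos[OF s0] by simp
      moreover have "\<exists>k. \<forall>s\<in>I. r s = k"
      proof (rule has_field_derivative_zero_constant[OF is_interval_convex[OF intI]])
        show "(r has_real_derivative 0) (at s within I)" if "s \<in> I" for s
          using r_deriv[OF that] True that by (simp add: has_field_derivative_at_within)
      qed
      ultimately show ?thesis unfolding constant_on_def by blast
    next
      case False
      then obtain s2 where s2: "s2 \<in> I" "r' s2 \<noteq> 0" by blast
      \<comment> \<open>A single parameter with nonzero \<open>r'\<close> suffices, as the condition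
        obtained involves the quadric only. Once \<open>M\<close> is scalar, the differential
        equation is used on all of \<open>I\<close>, including zeros of \<open>r'\<close>.\<close>
      have stat: "real_form p (M *v x) (M *v n) = 0" if "x \<in> S" "n \<in> tangent_hyperplane x" for x n
        using st(2)[OF s2(1) that] s2(2) c by simp
      define \<mu> where "\<mu> = m x0 / c"
      have M: "M *v w = \<mu> *\<^sub>R w" for w
        unfolding \<mu>_def by (rule scalar_of_stationary[OF c s0 x0 stat])
      have l: "\<mu> \<noteq> 0" using normal_nonnull[OF x0] c by (simp add: \<mu>_def)
      have mx: "m x0 = \<mu> * c" using c by (simp add: \<mu>_def)
      have "M $ i $ i = \<mu>" for i
      proof -
        have "(M *v axis i 1) $ i = M $ i $ i" by (simp add: matrix_vector_mult_basis column_def)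
        then show ?thesis by (simp add: M axis_def)
      qed
      then have tr: "trace M = real CARD('n) * \<mu>" by (simp add: trace_def)
      have "real CARD('n) * \<mu> * ((r' s / \<mu>)\<^sup>2 + (r s)\<^sup>2) + (r' s)\<^sup>2 / \<mu> - r s * r'' s / \<mu> = 0" if "s \<in> I" for s
        using st(1)[OF that x0 N0] c l unfolding tr mx by simp
      from catenoid_of_scalar[OF c s0 M l this] show ?thesis by blast
    qed
  qed
qed

lemma minimal_iff:
  "minimal_immersion p (I \<times> S) f \<longleftrightarrow> (trace M = 0 \<and> r constant_on I) \<or> (trace M = 0 \<and> c = 0) \<or>
      (\<exists>\<epsilon>\<in>{1, -1}. \<exists>c\<^sub>0. c\<^sub>0 \<noteq> 0 \<and> (\<exists>T. congruent_sets p (f ` (I \<times> S)) T \<and> T \<subseteq> lagrangian_catenoid p \<epsilon> c\<^sub>0))"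
proof
  assume "(trace M = 0 \<and> r constant_on I) \<or> (trace M = 0 \<and> c = 0) \<or>
      (\<exists>\<epsilon>\<in>{1, -1}. \<exists>c\<^sub>0. c\<^sub>0 \<noteq> 0 \<and> (\<exists>T. congruent_sets p (f ` (I \<times> S)) T \<and> T \<subseteq> lagrangian_catenoid p \<epsilon> c\<^sub>0))"
  then consider "trace M = 0" "r constant_on I" | "trace M = 0" "c = 0" |
    \<epsilon> c\<^sub>0 T where "\<epsilon> \<in> {1, -1}" "c\<^sub>0 \<noteq> 0" "congruent_sets p (f ` (I \<times> S)) T" "T \<subseteq> lagrangian_catenoid p \<epsilon> c\<^sub>0"
    by blast
  then show "minimal_immersion p (I \<times> S) f"
  proof cases
    case 1
    obtain k where k: "\<And>s. s \<in> I \<Longrightarrow> r s = k" using 1(2) unfolding constant_on_def by blast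
    have "r' s = 0" if s: "s \<in> I" for s
    proof -
      have "(r has_real_derivative 0) (at s)"
        by (rule has_field_derivative_transform_within_open[OF DERIV_const openI s]) (use k in auto)
      then show ?thesis using DERIV_unique[OF r_deriv[OF s]] by blast
    qed
    then show ?thesis using 1(1) by (intro minimal_of_phase) (auto simp: q_def \<kappa>_def)
  next
    case 2
    have "Re (q z) = 0" for z unfolding q_def \<kappa>_def using 2 by simp
    then show ?thesis by (rule minimal_of_phase)
  next
    case 3
    then show ?thesis using minimal_of_catenoid by blast
  qed
qed (rule minimal_imp_cases)

end

theorem corollary3:
  fixes p :: nat
    and M :: "real^('n::{finite,wellorder})^('n::_)"
    and c :: real
    and r :: "real \<Rightarrow> real"
    and I :: "real set"
  assumes "CARD('n) \<ge> 2"
    and "p \<le> CARD('n)"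
    and "invertible M"
    and "self_adjoint p M"
    and "nondegenerate_hypersurface p (quadric p M c)"
    and "open I" and "is_interval I"
    and "smooth_on I r"
    and "\<forall>s\<in>I. r s > 0"
  shows "lagrangian_immersion p (I \<times> quadric p M c) (quadric_immersion M r) \<and>
    (minimal_immersion p (I \<times> quadric p M c) (quadric_immersion M r) \<longleftrightarrow>
      (trace M = 0 \<and> r constant_on I) \<or>
      (trace M = 0 \<and> c = 0) \<or>
      (\<exists>\<epsilon>\<in>{1, -1}. \<exists>c\<^sub>0. c\<^sub>0 \<noteq> 0 \<and>
        (\<exists>T. congruent_sets p (quadric_immersion M r ` (I \<times> quadric p M c)) T \<and>
             T \<subseteq> lagrangian_catenoid p \<epsilon> c\<^sub>0)))"
proof -
  interpret quadric_immersion_data p M c I r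
    by unfold_locales (use assms in auto)
  show ?thesis using lagrangian_nondegenerate(1) minimal_iff by (rule conjI)
qed

end
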